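(* Let $X$ and $Y$ be sets, and let $F$ and $G$ be locally convex spaces (over $\mathbb K=\mathbb R$ or $\mathbb C$) consisting of scalar functions on $X$ and $Y$ respectively, such that either $F$ and $G$ are both Fréchet spaces, or $F$ and $G$ are both reflexive DF spaces. Let $H$ be a barrelled Hausdorff complete locally convex space consisting of scalar functions on $X\times Y$. Assume that $G$ is nuclear and that the topologies of $F$, $G$ and $H$ are stronger than the topology of simple (pointwise) convergence. Suppose: (i) for every $f\in F$ and $g\in G$, the function $(x,y)\mapsto f(x)g(y)$ on $X\times Y$ belongs to $H$, and the bilinear map $\Phi\colon F\times G\to H$ taking $(f,g)$ to this function is separately continuous; (ii) for every $h\in H$ and every $x\in X$, the function $h(x,\cdot)$ belongs to $G$, and for every $v\in G'$ the function $h_v(x)=\langle v,h(x,\cdot)\rangle$ belongs to $F$. Then $\Phi$ is continuous and the continuous linear map $F\widehat{\otimes}_\pi G\to H$ it induces is a topological isomorphism $F\widehat{\otimes}_\pi G\simeq H$.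
   Context: For a locally convex space $G$, $G'$ denotes its continuous dual and $\langle\cdot,\cdot\rangle$ the canonical pairing of $G'$ and $G$. $F\widehat{\otimes}_\pi G$ denotes the completion of $F\otimes G$ with respect to the projective tensor product topology (the strongest locally convex topology making $(f,g)\mapsto f\otimes g$ continuous). *)

theory Defs
  imports "HOL-Analysis.Analysis"
begin

text \<open>Locally convex spaces of scalar functions on a set (type) 'd, with scalars 'k
  (a real normed field, i.e. R or C). The vector operations are pointwise.\<close>

definition fzero :: "'d \<Rightarrow> 'k::real_normed_field" where
  "fzero = (\<lambda>z. 0)"

definition fadd :: "('d \<Rightarrow> 'k::real_normed_field) \<Rightarrow> ('d \<Rightarrow> 'k) \<Rightarrow> 'd \<Rightarrow> 'k" where
  "fadd f g = (\<lambda>z. f z + g z)"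

definition fdiff :: "('d \<Rightarrow> 'k::real_normed_field) \<Rightarrow> ('d \<Rightarrow> 'k) \<Rightarrow> 'd \<Rightarrow> 'k" where
  "fdiff f g = (\<lambda>z. f z - g z)"

definition fscale :: "'k::real_normed_field \<Rightarrow> ('d \<Rightarrow> 'k) \<Rightarrow> 'd \<Rightarrow> 'k" where
  "fscale c f = (\<lambda>z. c * f z)"

definition fun_subspace :: "('d \<Rightarrow> 'k::real_normed_field) set \<Rightarrow> bool" where
  "fun_subspace E \<longleftrightarrow> fzero \<in> E \<and> (\<forall>f\<in>E. \<forall>g\<in>E. fadd f g \<in> E) \<and> (\<forall>c. \<forall>f\<in>E. fscale c f \<in> E)"

definition abs_convex :: "('d \<Rightarrow> 'k::real_normed_field) set \<Rightarrow> bool" where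
  "abs_convex V \<longleftrightarrow>
     (\<forall>f\<in>V. \<forall>g\<in>V. \<forall>a b. norm a + norm b \<le> 1 \<longrightarrow> fadd (fscale a f) (fscale b g) \<in> V)"

definition lcs :: "('d \<Rightarrow> 'k::real_normed_field) set \<Rightarrow> ('d \<Rightarrow> 'k) topology \<Rightarrow> bool" where
  "lcs E T \<longleftrightarrow> topspace T = E \<and> fun_subspace E \<and>
     continuous_map (prod_topology T T) T (\<lambda>(f, g). fadd f g) \<and>
     continuous_map (prod_topology euclidean T) T (\<lambda>(c, f). fscale c f) \<and>
     (\<forall>U. openin T U \<and> fzero \<in> U \<longrightarrow>
        (\<exists>V. openin T V \<and> fzero \<in> V \<and> V \<subseteq> U \<and> abs_convex V))"

definition dual :: "('d \<Rightarrow> 'k::real_normed_field) set \<Rightarrow> ('d \<Rightarrow> 'k) topology \<Rightarrow> (('d \<Rightarrow> 'k) \<Rightarrow> 'k) set" where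
  "dual E T = {v. (\<forall>f\<in>E. \<forall>g\<in>E. \<forall>a b. v (fadd (fscale a f) (fscale b g)) = a * v f + b * v g) \<and>
                  continuous_map T euclidean v \<and> (\<forall>f. f \<notin> E \<longrightarrow> v f = 0)}"

definition lcs_bounded :: "('d \<Rightarrow> 'k::real_normed_field) topology \<Rightarrow> ('d \<Rightarrow> 'k) set \<Rightarrow> bool" where
  "lcs_bounded T B \<longleftrightarrow> B \<subseteq> topspace T \<and>
     (\<forall>U. openin T U \<and> fzero \<in> U \<longrightarrow> (\<exists>t>0. \<forall>c. norm c \<le> t \<longrightarrow> fscale c ` B \<subseteq> U))"

definition strong_dual_top :: "('d \<Rightarrow> 'k::real_normed_field) set \<Rightarrow> ('d \<Rightarrow> 'k) topology \<Rightarrow> (('d \<Rightarrow> 'k) \<Rightarrow> 'k) topology" where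
  "strong_dual_top E T = topology (\<lambda>U. U \<subseteq> dual E T \<and>
     (\<forall>v\<in>U. \<exists>B \<epsilon>. lcs_bounded T B \<and> \<epsilon> > 0 \<and>
        {w \<in> dual E T. \<forall>f\<in>B. norm (w f - v f) < \<epsilon>} \<subseteq> U))"

definition bidual_embed :: "('d \<Rightarrow> 'k::real_normed_field) set \<Rightarrow> ('d \<Rightarrow> 'k) topology \<Rightarrow> ('d \<Rightarrow> 'k) \<Rightarrow> (('d \<Rightarrow> 'k) \<Rightarrow> 'k) \<Rightarrow> 'k" where
  "bidual_embed E T f = (\<lambda>v. if v \<in> dual E T then v f else 0)"

definition reflexive_lcs :: "('d \<Rightarrow> 'k::real_normed_field) set \<Rightarrow> ('d \<Rightarrow> 'k) topology \<Rightarrow> bool" where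
  "reflexive_lcs E T \<longleftrightarrow> lcs E T \<and>
     bij_betw (bidual_embed E T) E (dual (dual E T) (strong_dual_top E T)) \<and>
     homeomorphic_map T (strong_dual_top (dual E T) (strong_dual_top E T)) (bidual_embed E T)"

definition equicontinuous :: "('d \<Rightarrow> 'k::real_normed_field) set \<Rightarrow> ('d \<Rightarrow> 'k) topology \<Rightarrow> (('d \<Rightarrow> 'k) \<Rightarrow> 'k) set \<Rightarrow> bool" where
  "equicontinuous E T M \<longleftrightarrow> M \<subseteq> dual E T \<and>
     (\<exists>U. openin T U \<and> fzero \<in> U \<and> (\<forall>v\<in>M. \<forall>f\<in>U. norm (v f) \<le> 1))"

definition DF_space :: "('d \<Rightarrow> 'k::real_normed_field) set \<Rightarrow> ('d \<Rightarrow> 'k) topology \<Rightarrow> bool" where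
  "DF_space E T \<longleftrightarrow> lcs E T \<and>
     (\<exists>B :: nat \<Rightarrow> ('d \<Rightarrow> 'k) set. (\<forall>n. lcs_bounded T (B n)) \<and>
         (\<forall>A. lcs_bounded T A \<longrightarrow> (\<exists>n. A \<subseteq> B n))) \<and>
     (\<forall>M :: nat \<Rightarrow> (('d \<Rightarrow> 'k) \<Rightarrow> 'k) set.
         (\<forall>n. equicontinuous E T (M n)) \<and> lcs_bounded (strong_dual_top E T) (\<Union>n. M n)
         \<longrightarrow> equicontinuous E T (\<Union>n. M n))"

definition cauchy_filter :: "('d \<Rightarrow> 'k::real_normed_field) topology \<Rightarrow> ('d \<Rightarrow> 'k) filter \<Rightarrow> bool" where
  "cauchy_filter T F \<longleftrightarrow> F \<noteq> bot \<and> eventually (\<lambda>f. f \<in> topspace T) F \<and>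
     (\<forall>U. openin T U \<and> fzero \<in> U \<longrightarrow> eventually (\<lambda>(f, g). fdiff f g \<in> U) (F \<times>\<^sub>F F))"

definition complete_lcs :: "('d \<Rightarrow> 'k::real_normed_field) topology \<Rightarrow> bool" where
  "complete_lcs T \<longleftrightarrow> (\<forall>F. cauchy_filter T F \<longrightarrow> (\<exists>h\<in>topspace T. limitin T (\<lambda>f. f) h F))"

definition frechet_space :: "('d \<Rightarrow> 'k::real_normed_field) set \<Rightarrow> ('d \<Rightarrow> 'k) topology \<Rightarrow> bool" where
  "frechet_space E T \<longleftrightarrow> lcs E T \<and> metrizable_space T \<and> complete_lcs T"

definition absorbing :: "('d \<Rightarrow> 'k::real_normed_field) set \<Rightarrow> ('d \<Rightarrow> 'k) set \<Rightarrow> bool" where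
  "absorbing E B \<longleftrightarrow> (\<forall>f\<in>E. \<exists>t>0. \<forall>c. norm c \<le> t \<longrightarrow> fscale c f \<in> B)"

definition barrelled :: "('d \<Rightarrow> 'k::real_normed_field) set \<Rightarrow> ('d \<Rightarrow> 'k) topology \<Rightarrow> bool" where
  "barrelled E T \<longleftrightarrow> lcs E T \<and>
     (\<forall>B. B \<subseteq> E \<and> closedin T B \<and> abs_convex B \<and> absorbing E B \<longrightarrow>
        (\<exists>U. openin T U \<and> fzero \<in> U \<and> U \<subseteq> B))"

definition cont_seminorm :: "('d \<Rightarrow> 'k::real_normed_field) set \<Rightarrow> ('d \<Rightarrow> 'k) topology \<Rightarrow> (('d \<Rightarrow> 'k) \<Rightarrow> real) \<Rightarrow> bool" where
  "cont_seminorm E T p \<longleftrightarrow> (\<forall>f\<in>E. \<forall>g\<in>E. p (fadd f g) \<le> p f + p g) \<and>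
     (\<forall>c. \<forall>f\<in>E. p (fscale c f) = norm c * p f) \<and> continuous_map T euclideanreal p"

text \<open>Nuclear (Grothendieck/Pietsch): for every continuous seminorm p there is a
  continuous seminorm q such that the canonical map E_q -> E_p is quasi-nuclear.\<close>
definition nuclear :: "('d \<Rightarrow> 'k::real_normed_field) set \<Rightarrow> ('d \<Rightarrow> 'k) topology \<Rightarrow> bool" where
  "nuclear E T \<longleftrightarrow> lcs E T \<and>
     (\<forall>p. cont_seminorm E T p \<longrightarrow>
        (\<exists>q a c. cont_seminorm E T q \<and> (\<forall>n. a n \<in> dual E T) \<and> (\<forall>n. c n \<ge> 0) \<and>
           summable c \<and> (\<forall>n. \<forall>f\<in>E. norm (a n f) \<le> c n * q f) \<and>
           (\<forall>f\<in>E. summable (\<lambda>n. norm (a n f)) \<and> p f \<le> (\<Sum>n. norm (a n f)))))"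

definition tensor_fun :: "('x \<Rightarrow> 'k::real_normed_field) \<Rightarrow> ('y \<Rightarrow> 'k) \<Rightarrow> 'x \<times> 'y \<Rightarrow> 'k" where
  "tensor_fun f g = (\<lambda>(x, y). f x * g y)"

text \<open>The algebraic tensor product F (x) G, realised (injectively) as the span of the
  functions tensor_fun f g inside the functions on X x Y.\<close>
definition tensor_span :: "('x \<Rightarrow> 'k::real_normed_field) set \<Rightarrow> ('y \<Rightarrow> 'k) set \<Rightarrow> ('x \<times> 'y \<Rightarrow> 'k) set" where
  "tensor_span F G = {u. \<exists>(n::nat) f g. (\<forall>i<n. f i \<in> F \<and> g i \<in> G) \<and>
                         u = (\<lambda>z. \<Sum>i<n. tensor_fun (f i) (g i) z)}"

definition pi_seminorm :: "('x \<Rightarrow> 'k::real_normed_field) set \<Rightarrow> ('y \<Rightarrow> 'k) set \<Rightarrow>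
    (('x \<Rightarrow> 'k) \<Rightarrow> real) \<Rightarrow> (('y \<Rightarrow> 'k) \<Rightarrow> real) \<Rightarrow> ('x \<times> 'y \<Rightarrow> 'k) \<Rightarrow> real" where
  "pi_seminorm F G p q u = Inf {\<Sum>i<n. p (f i) * q (g i) | (n::nat) f g.
       (\<forall>i<n. f i \<in> F \<and> g i \<in> G) \<and> u = (\<lambda>z. \<Sum>i<n. tensor_fun (f i) (g i) z)}"

definition seminorm_top :: "('d \<Rightarrow> 'k::real_normed_field) set \<Rightarrow> (('d \<Rightarrow> 'k) \<Rightarrow> real) set \<Rightarrow> ('d \<Rightarrow> 'k) topology" where
  "seminorm_top S P = topology (\<lambda>U. U \<subseteq> S \<and>
     (\<forall>u\<in>U. \<exists>Q \<epsilon>. finite Q \<and> Q \<subseteq> P \<and> \<epsilon> > 0 \<and> {w \<in> S. \<forall>p\<in>Q. p (fdiff w u) < \<epsilon>} \<subseteq> U))"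

definition proj_tensor_top :: "('x \<Rightarrow> 'k::real_normed_field) set \<Rightarrow> ('x \<Rightarrow> 'k) topology \<Rightarrow>
    ('y \<Rightarrow> 'k) set \<Rightarrow> ('y \<Rightarrow> 'k) topology \<Rightarrow> ('x \<times> 'y \<Rightarrow> 'k) topology" where
  "proj_tensor_top F TF G TG = seminorm_top (tensor_span F G)
     {pi_seminorm F G p q | p q. cont_seminorm F TF p \<and> cont_seminorm G TG q}"

text \<open>The continuous linear map from the completion of (F (x) G, pi) into the complete
  Hausdorff space H induced by Phi is a topological isomorphism iff the induced map on
  F (x) G (the inclusion of tensor_span F G into H) is a topological embedding with dense
  image (universal property / uniqueness of the completion).\<close>
definition completed_proj_tensor_iso :: "('x \<Rightarrow> 'k::real_normed_field) set \<Rightarrow> ('x \<Rightarrow> 'k) topology \<Rightarrow>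
    ('y \<Rightarrow> 'k) set \<Rightarrow> ('y \<Rightarrow> 'k) topology \<Rightarrow> ('x \<times> 'y \<Rightarrow> 'k) set \<Rightarrow> ('x \<times> 'y \<Rightarrow> 'k) topology \<Rightarrow> bool" where
  "completed_proj_tensor_iso F TF G TG H TH \<longleftrightarrow>
     tensor_span F G \<subseteq> H \<and>
     subtopology TH (tensor_span F G) = proj_tensor_top F TF G TG \<and>
     TH closure_of (tensor_span F G) = H"

end

theory Submission
  imports Defs "HOL-Library.Function_Algebras" "HOL-Computational_Algebra.Fundamental_Theorem_Algebra"
begin

text \<open>By the closed graph theorem, \<open>h \<mapsto> h_v\<close> is a continuous map from \<open>H\<close> to \<open>F\<close> for every \<open>v \<in> G'\<close>,
  and for fixed \<open>h\<close> the set of all \<open>h_v\<close> with \<open>v\<close> in an equicontinuous set is bounded; as \<open>H\<close> is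
  barrelled, \<open>h \<mapsto> sup {p(h_v) | \<bar>v\<bar> \<le> q}\<close> is a continuous seminorm on \<open>H\<close>. Nuclearity of \<open>G\<close> supplies
  finite-rank operators \<open>g \<mapsto> \<Sum>m. b m g * z m\<close> that approximate the identity of \<open>G\<close> with bounded
  nuclear norm. Applied to elements of the tensor product they bound the projective seminorms by the
  seminorms above, which gives the embedding; applied to an arbitrary \<open>h \<in> H\<close> they produce a Cauchy
  filter on the tensor product, whose limit in the complete space \<open>H\<close> is \<open>h\<close>, which gives density.

  Continuity of \<open>\<Phi>\<close> is uniform boundedness. For reflexive DF spaces the closed graph theorem
  follows from Hahn--Banach, reflexivity and metrizability of the dual.\<close>

section \<open>The scalar field\<close>

text \<open>The suprema of \<open>p (slice u v)\<close> over polars are continuous seminorms on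
  \<open>H\<close>, but nothing says beforehand that they define its topology. Closeness of an
  approximant to \<open>h\<close> in these seminorms is therefore not closeness in \<open>H\<close>;
  it becomes so only for the difference of two tensor elements, where the projective seminorms are
  controlled. This is why density goes through a Cauchy filter and completeness, with point
  evaluations identifying the limit. The bound on the nuclear norm must not depend on the accuracy:
  for a fixed tensor element the accuracy is chosen after one of its representations, and only the
  bounded part survives in the estimate. The closed graph theorem is used with two kinds of source,
  \<open>H\<close> and Banach spaces of functionals on \<open>G\<close>; hence it is stated for
  families of seminorms rather than for topologies. The scalars are an arbitrary real normed field,
  while Hahn--Banach, conjugation and convergence of scalar series rest on its being the real or the
  complex field.\<close>

text \<open>In the extension of the field by a formal imaginary unit \<open>i\<close>, the value of a complex polynomial at
  \<open>z\<close> is \<open>poly_re z p + i * poly_im z p\<close>, and \<open>poly_nrm\<close> is its multiplicative norm to the field.\<close>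

definition poly_re :: "'k::real_normed_field \<Rightarrow> complex poly \<Rightarrow> 'k" where
  "poly_re z p = poly (map_poly (\<lambda>c. of_real (Re c)) p) z"

definition poly_im :: "'k::real_normed_field \<Rightarrow> complex poly \<Rightarrow> 'k" where
  "poly_im z p = poly (map_poly (\<lambda>c. of_real (Im c)) p) z"

definition poly_nrm :: "'k::real_normed_field \<Rightarrow> complex poly \<Rightarrow> 'k" where
  "poly_nrm z p = (poly_re z p)\<^sup>2 + (poly_im z p)\<^sup>2"

lemma poly_re_0 [simp]: "poly_re z 0 = 0" and poly_im_0 [simp]: "poly_im z 0 = 0"
  by (simp_all add: poly_re_def poly_im_def)

lemma poly_re_pCons: "poly_re z (pCons a p) = of_real (Re a) + z * poly_re z p"
  and poly_im_pCons: "poly_im z (pCons a p) = of_real (Im a) + z * poly_im z p"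
  by (simp_all add: poly_re_def poly_im_def map_poly_pCons)

lemma poly_re_1 [simp]: "poly_re z 1 = 1" and poly_im_1 [simp]: "poly_im z 1 = 0"
  by (simp_all add: one_pCons poly_re_pCons poly_im_pCons)

lemma poly_re_add: "poly_re z (p + q) = poly_re z p + poly_re z q"
  by (induction p q rule: poly_induct2) (simp_all add: poly_re_pCons algebra_simps)

lemma poly_im_add: "poly_im z (p + q) = poly_im z p + poly_im z q"
  by (induction p q rule: poly_induct2) (simp_all add: poly_im_pCons algebra_simps)

lemma poly_re_im_smult:
  "poly_re z (smult c p) = of_real (Re c) * poly_re z p - of_real (Im c) * poly_im z p \<and>
   poly_im z (smult c p) = of_real (Re c) * poly_im z p + of_real (Im c) * poly_re z p"
proof (induction p)
  case 0
  then show ?case by simp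
next
  case (pCons a p)
  show ?case
    unfolding smult_pCons poly_re_pCons poly_im_pCons pCons.IH[THEN conjunct1] pCons.IH[THEN conjunct2]
    by (simp add: algebra_simps)
qed

lemma poly_re_im_mult:
  "poly_re z (p * q) = poly_re z p * poly_re z q - poly_im z p * poly_im z q \<and>
   poly_im z (p * q) = poly_re z p * poly_im z q + poly_im z p * poly_re z q"
proof (induction p)
  case 0
  then show ?case by simp
next
  case (pCons a p)
  show ?case
    unfolding mult_pCons_left poly_re_add poly_im_add poly_re_pCons poly_im_pCons
      poly_re_im_smult[THEN conjunct1] poly_re_im_smult[THEN conjunct2]
      pCons.IH[THEN conjunct1] pCons.IH[THEN conjunct2]
    by (simp add: algebra_simps)
qed

lemma poly_nrm_mult: "poly_nrm z (p * q) = poly_nrm z p * poly_nrm z q"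
  unfolding poly_nrm_def poly_re_im_mult[THEN conjunct1] poly_re_im_mult[THEN conjunct2]
  by (simp add: power2_eq_square algebra_simps)

text \<open>With \<open>w = a + i * b\<close> this is \<open>(z - w) * (z - cnj w)\<close>, so a
  zero of it is a real quadratic equation for \<open>z\<close>.\<close>

lemma poly_nrm_linear:
  "poly_nrm z [:- w, 1:] = (z - of_real (Re w))\<^sup>2 + of_real ((Im w)\<^sup>2)"
  by (simp add: poly_nrm_def poly_re_pCons poly_im_pCons)

lemma poly_nrm_power: "poly_nrm z (p ^ n) = poly_nrm z p ^ n"
  by (induction n) (simp_all add: poly_nrm_mult, simp add: poly_nrm_def)

text \<open>The quantity \<open>norm a + norm b\<close> is submultiplicative on elements
  \<open>a + i * b\<close>, which bounds the real part of a high power geometrically.\<close>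

lemma norm_poly_re_power_le:
  "norm (poly_re z (p ^ n)) + norm (poly_im z (p ^ n)) \<le> (norm (poly_re z p) + norm (poly_im z p)) ^ n"
proof (induction n)
  case 0
  then show ?case by simp
next
  case (Suc n)
  define a b c d where "a = poly_re z p" "b = poly_im z p" "c = poly_re z (p ^ n)" "d = poly_im z (p ^ n)"
  note abcd = this
  have "norm (a * c - b * d) + norm (a * d + b * c) \<le> (norm a + norm b) * (norm c + norm d)"
    using norm_triangle_ineq4[of "a * c" "b * d"] norm_triangle_ineq[of "a * d" "b * c"]
    by (simp add: norm_mult algebra_simps)
  also have "\<dots> \<le> (norm a + norm b) * (norm a + norm b) ^ n"
    using Suc by (intro mult_left_mono) (auto simp: abcd)
  finally show ?case
    by (simp add: poly_re_im_mult abcd)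
qed

text \<open>A monic polynomial splits over the complex numbers into \<open>k\<close> linear factors,
  each contributing at least \<open>m\<close>.\<close>

lemma poly_nrm_monic_ge:
  assumes m: "\<And>w. m \<le> norm (poly_nrm z [:- w, 1:])" "m \<ge> 0"
  shows "lead_coeff q = 1 \<Longrightarrow> degree q = k \<Longrightarrow> m ^ k \<le> norm (poly_nrm z q)"
proof (induction k arbitrary: q)
  case 0
  then obtain c where "q = [:c:]" by (metis degree_eq_zeroE)
  with 0 have "q = [:1:]" by simp
  then show ?case by (simp add: poly_nrm_def poly_re_pCons poly_im_pCons)
next
  case (Suc k)
  then have "\<not> constant (poly q)" by (simp add: constant_degree)
  then obtain w where "poly q w = 0" using fundamental_theorem_of_algebra by blast
  then obtain r where r: "q = [:- w, 1:] * r" by (auto simp: poly_eq_0_iff_dvd)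
  with Suc.prems have "r \<noteq> 0" by auto
  then have dr: "degree r = k" using Suc.prems unfolding r by (subst (asm) degree_mult_eq) auto
  have "lead_coeff r = 1" using Suc.prems(1) unfolding r lead_coeff_mult by simp
  with Suc.IH dr have "m ^ k \<le> norm (poly_nrm z r)" by blast
  then have "m * m ^ k \<le> norm (poly_nrm z [:- w, 1:]) * norm (poly_nrm z r)"
    using m by (intro mult_mono) auto
  then show ?case unfolding r poly_nrm_mult by (simp add: norm_mult)
qed

text \<open>Gelfand--Mazur by Tornheim's argument: if \<open>w0\<close> minimizes \<open>norm ((z - w) * (z - cnj w))\<close> with minimum
  \<open>m > 0\<close>, factoring \<open>(X - w0) ^ n - e ^ n\<close> over the complex numbers and letting \<open>n\<close> tend to infinity
  shows that \<open>w0 + e\<close> is a minimizer for all small \<open>e\<close>, although minimizers are bounded.\<close>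

lemma quadratic_root:
  fixes z :: "'k::real_normed_field"
  shows "\<exists>s t. (z - of_real s)\<^sup>2 + of_real (t\<^sup>2) = 0"
proof (rule ccontr)
  assume neg: "\<not> ?thesis"
  define f where "f w = norm (poly_nrm z [:- w, 1:])" for w
  have f_eq: "f w = norm ((z - of_real (Re w))\<^sup>2 + of_real ((Im w)\<^sup>2))" for w
    by (simp add: f_def poly_nrm_linear)
  have f_pos: "f w > 0" for w using neg by (auto simp: f_eq)
  have contf: "continuous_on S f" for S
    unfolding f_eq by (intro continuous_intros)
  \<comment> \<open>The radius is large enough that
    \<open>norm w * (norm w - 2 * norm z) > 2 * (norm z)\<^sup>2\<close> outside: one square absorbs
    the error term, the other is \<open>f 0\<close>.\<close>
  define R where "R = 4 * norm z + 1"
  have out: "f w > f 0" if "norm w > R" for w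
  proof -
    have e: "(z - of_real (Re w))\<^sup>2 + of_real ((Im w)\<^sup>2) = of_real ((norm w)\<^sup>2) - (of_real (2 * Re w) * z - z\<^sup>2)"
      unfolding cmod_power2 by (simp add: power2_eq_square algebra_simps)
    have "norm (of_real (2 * Re w) * z - z\<^sup>2) \<le> 2 * \<bar>Re w\<bar> * norm z + (norm z)\<^sup>2"
      by (rule norm_triangle_ineq4[THEN order_trans]) (simp add: norm_mult norm_power)
    also have "\<dots> \<le> 2 * norm w * norm z + (norm z)\<^sup>2"
      by (intro add_right_mono mult_right_mono) (auto simp: abs_Re_le_cmod)
    finally have "f w \<ge> (norm w)\<^sup>2 - (2 * norm w * norm z + (norm z)\<^sup>2)"
      unfolding f_eq e using norm_triangle_ineq2[of "of_real ((norm w)\<^sup>2) :: 'k" "of_real (2 * Re w) * z - z\<^sup>2"]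
      by (simp add: norm_power)
    moreover have "norm w * (norm w - 2 * norm z) \<ge> (4 * norm z + 1) * (2 * norm z + 1)"
      using that by (intro mult_mono) (auto simp: R_def)
    moreover have "(4 * norm z + 1) * (2 * norm z + 1) > 2 * (norm z)\<^sup>2"
      by (simp add: power2_eq_square algebra_simps add_pos_nonneg)
    moreover have "f 0 = (norm z)\<^sup>2" by (simp add: f_eq norm_power)
    ultimately show ?thesis by (simp add: power2_eq_square algebra_simps)
  qed
  have "R \<ge> 0" by (simp add: R_def)
  then have "\<exists>w\<in>cball 0 R. \<forall>y\<in>cball 0 R. f w \<le> f y"
    by (intro continuous_attains_inf contf) auto
  then obtain w' where w': "\<And>y. norm y \<le> R \<Longrightarrow> f w' \<le> f y" by (metis mem_cball_0)
  define m where "m = f w'"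
  have min: "m \<le> f w" for w
  proof (cases "norm w \<le> R")
    case True then show ?thesis using w' by (simp add: m_def)
  next
    case False
    then show ?thesis using out[of w] w'[of 0] \<open>R \<ge> 0\<close> by (simp add: m_def)
  qed
  have mpos: "m > 0" using f_pos by (simp add: m_def)
  define Z where "Z = {w. f w \<le> m}"
  have Zsub: "Z \<subseteq> cball 0 R" using out min[of 0] by (fastforce simp: Z_def intro!: leI)
  have "closed Z" unfolding Z_def using contf[of UNIV] by (intro closed_Collect_le) auto
  then have "compact Z" using Zsub bounded_subset bounded_cball by (auto simp: compact_eq_bounded_closed)
  moreover have "w' \<in> Z" by (simp add: Z_def m_def)
  \<comment> \<open>The minimizer with largest real part cannot be moved to the right; this is what
    \<open>w1 = w0 + e\<close> will contradict.\<close>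
  ultimately have "\<exists>w\<in>Z. \<forall>y\<in>Z. Re y \<le> Re w"
    by (intro continuous_attains_sup) (auto intro!: continuous_intros)
  then obtain w0 where w0: "w0 \<in> Z" "\<And>y. y \<in> Z \<Longrightarrow> Re y \<le> Re w0" by auto
  define A where "A = [:- w0, 1:]"
  define L where "L = norm (poly_re z A) + norm (poly_im z A)"
  have fw0: "norm (poly_nrm z A) = m" using w0(1) min[of w0] by (auto simp: Z_def A_def f_def)
  \<comment> \<open>Chosen so that \<open>e * L < m\<close> and \<open>e * e < m\<close>: the two
    error ratios below are then less than 1 and their powers vanish.\<close>
  define e where "e = min 1 (min (m / 2) (m / (2 * (L + 1))))"
  have L0: "L \<ge> 0" by (simp add: L_def)
  have e: "e > 0" "e \<le> 1" "e \<le> m / 2" "e \<le> m / (2 * (L + 1))"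
    subgoal using mpos L0 by (simp add: e_def)
    subgoal by (simp add: e_def)
    subgoal unfolding e_def by (intro min.coboundedI2 min.cobounded1)
    subgoal unfolding e_def by (intro min.coboundedI2 min.cobounded2)
    done
  have eL: "e * L < m"
  proof -
    have "e * L \<le> m / (2 * (L + 1)) * L" using e L0 by (intro mult_right_mono) auto
    also have "\<dots> < m" using mpos L0 by (simp add: divide_simps)
    finally show ?thesis .
  qed
  have ee: "e * e < m"
  proof -
    have "e * e \<le> 1 * (m / 2)" using e by (intro mult_mono) auto
    then show ?thesis using mpos by simp
  qed
  define w1 where "w1 = w0 + of_real e"
  have bound: "f w1 \<le> m * (1 + (2 * (e * L / m) ^ n + (e * e / m) ^ n))" if "n > 0" for n
  proof -
    \<comment> \<open>Since \<open>p\<close> vanishes at \<open>w1\<close>, one of its linear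
      factors has norm \<open>f w1\<close>; the remaining \<open>n - 1\<close> contribute at least
      \<open>m ^ (n - 1)\<close>.\<close>
    define p where "p = A ^ n - [:of_real (e ^ n):]"
    have degA: "degree (A ^ n) = n" by (subst degree_power_eq) (auto simp: A_def)
    have dp: "degree p = n" unfolding p_def diff_conv_add_uminus using degA that by (subst degree_add_eq_left) auto
    have "coeff p n = coeff (A ^ n) n" using that by (cases n) (auto simp: p_def)
    then have lp: "lead_coeff p = 1" using dp degA
      by (metis A_def lead_coeff_power lead_coeff_pCons(1) lead_coeff_1 one_pCons power_one one_neq_zero pCons_eq_0_iff)
    have "poly p w1 = 0" by (simp add: p_def A_def w1_def)
    then obtain q where q: "p = [:- w1, 1:] * q" by (auto simp: poly_eq_0_iff_dvd)
    have "q \<noteq> 0" using q lp by auto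
    then have dq: "degree q = n - 1" using dp unfolding q by (subst (asm) degree_mult_eq) auto
    have "lead_coeff q = 1" using lp unfolding q lead_coeff_mult by simp
    then have "m ^ (n - 1) \<le> norm (poly_nrm z q)"
      using dq mpos min by (intro poly_nrm_monic_ge) (auto simp: f_def)
    then have "f w1 * m ^ (n - 1) \<le> norm (poly_nrm z p)"
      unfolding q poly_nrm_mult norm_mult f_def by (intro mult_left_mono) auto
    \<comment> \<open>Only the real part is shifted by \<open>e ^ n\<close>; expanding the square
      leaves \<open>poly_nrm z A ^ n\<close> plus two terms of smaller growth.\<close>
    also have "poly_nrm z p = poly_nrm z A ^ n + (of_real ((e * e) ^ n) - of_real (2 * e ^ n) * poly_re z (A ^ n))"
    proof -
      have "poly_re z p = poly_re z (A ^ n) - of_real (e ^ n)" "poly_im z p = poly_im z (A ^ n)"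
        unfolding p_def diff_conv_add_uminus poly_re_add poly_im_add
        by (simp_all add: poly_re_pCons poly_im_pCons del: of_real_power)
      then have "poly_nrm z p = (poly_re z (A ^ n) - of_real (e ^ n))\<^sup>2 + (poly_im z (A ^ n))\<^sup>2"
        by (simp only: poly_nrm_def)
      also have "\<dots> = poly_nrm z (A ^ n) + (of_real ((e * e) ^ n) - of_real (2 * e ^ n) * poly_re z (A ^ n))"
        by (simp add: poly_nrm_def power2_eq_square power_mult_distrib algebra_simps)
      finally show ?thesis by (simp only: poly_nrm_power)
    qed
    also have "norm \<dots> \<le> m ^ n + ((e * e) ^ n + 2 * e ^ n * L ^ n)"
    proof -
      have "norm (poly_re z (A ^ n)) \<le> L ^ n"
        using norm_poly_re_power_le[of z A n] by (smt (verit) L_def norm_ge_zero)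
      then have "norm (of_real (2 * e ^ n) * poly_re z (A ^ n)) \<le> 2 * e ^ n * L ^ n"
        unfolding norm_mult norm_of_real using e by (simp add: abs_mult)
      moreover have "norm (poly_nrm z A ^ n) = m ^ n" by (simp add: norm_power fw0)
      moreover have "norm (of_real ((e * e) ^ n) :: 'k) = (e * e) ^ n"
        using e by (metis abs_of_nonneg less_imp_le mult_nonneg_nonneg norm_of_real zero_le_power)
      ultimately show ?thesis
        by (smt (verit) norm_triangle_ineq norm_triangle_ineq4)
    qed
    also have "\<dots> = m * (1 + (2 * (e * L / m) ^ n + (e * e / m) ^ n)) * m ^ (n - 1)"
    proof -
      have "m ^ n = m * m ^ (n - 1)" using that by (simp add: power_eq_if)
      moreover have "(e * L) ^ n = (e * L / m) ^ n * m ^ n" "(e * e) ^ n = (e * e / m) ^ n * m ^ n"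
        using mpos by (simp_all add: power_divide)
      ultimately show ?thesis
        by (simp add: algebra_simps power_mult_distrib)
    qed
    finally show ?thesis using mpos by simp
  qed
  have "(\<lambda>n. m * (1 + (2 * (e * L / m) ^ n + (e * e / m) ^ n))) \<longlonglongrightarrow> m * (1 + (2 * 0 + 0))"
    using eL ee mpos e L0 by (intro tendsto_intros LIMSEQ_power_zero) (auto simp: abs_mult)
  then have "f w1 \<le> m * (1 + (2 * 0 + 0))"
    by (rule LIMSEQ_le_const) (use bound in \<open>auto intro!: exI[of _ 1]\<close>)
  then have "w1 \<in> Z" by (simp add: Z_def)
  then show False using w0(2)[of w1] e by (simp add: w1_def)
qed

section \<open>Real and complex coordinates on the scalars\<close>

lemma sum_squares_of_real_eq_0:
  assumes "of_real (a\<^sup>2 + b\<^sup>2) = (0::'k::real_normed_field)"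
  shows "a = 0 \<and> b = 0"
  using assms unfolding of_real_eq_0_iff by (simp add: sum_power2_eq_zero_iff)

text \<open>The real case is included as \<open>j = 0\<close> with vanishing \<open>im\<close>.\<close>

definition scalar_coordinates :: "'k::real_normed_field \<Rightarrow> ('k \<Rightarrow> real) \<Rightarrow> ('k \<Rightarrow> real) \<Rightarrow> bool" where
  "scalar_coordinates j re im \<longleftrightarrow> (j = 0 \<or> j * j = - 1) \<and>
     (\<forall>z. of_real (re z) + of_real (im z) * j = z) \<and>
     (\<forall>a b. re (of_real a + of_real b * j) = a) \<and>
     (\<forall>x y. re (x + y) = re x + re y) \<and> (\<forall>x y. im (x + y) = im x + im y) \<and>
     (\<forall>z. (norm z)\<^sup>2 = (re z)\<^sup>2 + (im z)\<^sup>2)"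

text \<open>If some scalar is not real, its quadratic equation yields a square root \<open>j\<close>
  of -1, and the quadratic equation of every other scalar splits by means of \<open>j\<close>. That
  the norm is Euclidean follows from its multiplicativity: powers on the unit circle remain
  bounded.\<close>

lemma scalar_structure: "\<exists>(j::'k::real_normed_field) re im. scalar_coordinates j re im"
proof (cases "\<forall>z::'k. \<exists>a. z = of_real a")
  case True
  define re where "re z = (SOME a. z = of_real a)" for z :: 'k
  have re: "of_real (re z) = z" for z unfolding re_def using True by (metis (mono_tags) someI_ex)
  then have re1: "re (of_real a) = a" for a by (metis of_real_eq_iff)
  have re2: "re (x + y) = re x + re y" for x y by (metis re re1 of_real_add)
  have re3: "(norm z)\<^sup>2 = (re z)\<^sup>2" for z by (metis re norm_of_real power2_abs)
  have "scalar_coordinates 0 re (\<lambda>_. 0)" unfolding scalar_coordinates_def by (auto simp: re re1 re2 re3)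
  then show ?thesis by blast
next
  case False
  then obtain z0 :: 'k where z0: "\<And>a. z0 \<noteq> of_real a" by auto
  obtain s t where st: "(z0 - of_real s)\<^sup>2 + of_real (t\<^sup>2) = 0" using quadratic_root by blast
  then have t: "t \<noteq> 0" using z0[of s] by auto
  \<comment> \<open>Completing the square turns the quadratic equation of \<open>z0\<close> into
    \<open>j * j = - 1\<close>.\<close>
  define j where "j = (z0 - of_real s) / of_real t"
  have jj: "j * j = - 1"
    using st t by (simp add: j_def power2_eq_square field_simps)
  have "\<exists>a b. z = of_real a + of_real b * j" for z
  proof -
    obtain a b where "(z - of_real a)\<^sup>2 + of_real (b\<^sup>2) = 0" using quadratic_root by blast
    then have "(z - of_real a - of_real b * j) * (z - of_real a + of_real b * j) = 0"
    proof -
      have "(z - of_real a - of_real b * j) * (z - of_real a + of_real b * j)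
          = (z - of_real a)\<^sup>2 - of_real (b\<^sup>2) * (j * j)"
        by (simp add: power2_eq_square algebra_simps)
      with \<open>(z - of_real a)\<^sup>2 + of_real (b\<^sup>2) = 0\<close> show ?thesis by (simp add: jj)
    qed
    then have "z - of_real a - of_real b * j = 0 \<or> z - of_real a + of_real b * j = 0"
      unfolding mult_eq_0_iff .
    then have "z = of_real a + of_real b * j \<or> z = of_real a + of_real (- b) * j"
      by (elim disj_forward) (simp_all add: diff_eq_eq add.commute eq_diff_eq add_eq_0_iff)
    then show ?thesis by blast
  qed
  then have "\<forall>z. \<exists>w. z = of_real (fst w) + of_real (snd w) * j" by simp
  from choice[OF this] obtain w where "\<And>z. z = of_real (fst (w z)) + of_real (snd (w z)) * j" by blast
  then obtain re im where ri: "\<And>z. z = of_real (re z) + of_real (im z) * j"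
    by (rule that[of "\<lambda>z. fst (w z)" "\<lambda>z. snd (w z)"])
  have prod: "(of_real a + of_real b * j) * (of_real a - of_real b * j) = of_real (a\<^sup>2 + b\<^sup>2)" for a b
    using jj by (simp add: power2_eq_square algebra_simps) (simp add: mult.assoc[symmetric])
  have z: "a = 0 \<and> b = 0" if "of_real a + of_real b * j = 0" for a b
    using that prod[of a b] sum_squares_of_real_eq_0[of a b, where 'k = 'k] by simp
  have uni: "a = c \<and> b = d" if "of_real a + of_real b * j = of_real c + of_real d * j" for a b c d
    using that z[of "a - c" "b - d"] by (simp add: algebra_simps)
  have re1: "re (of_real a + of_real b * j) = a \<and> im (of_real a + of_real b * j) = b" for a b
    using ri[of "of_real a + of_real b * j"] uni by metis
  have add: "re (x + y) = re x + re y \<and> im (x + y) = im x + im y" for x y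
  proof -
    have "x + y = of_real (re x + re y) + of_real (im x + im y) * j"
    proof -
      have "of_real (re x + re y) + of_real (im x + im y) * j
          = (of_real (re x) + of_real (im x) * j) + (of_real (re y) + of_real (im y) * j)"
        by (simp add: algebra_simps)
      then show ?thesis unfolding ri[symmetric] by simp
    qed
    then show ?thesis using re1[of "re x + re y" "im x + im y"] by simp
  qed
  have nj: "norm j = 1"
  proof -
    have "norm j * norm j = 1" using jj by (metis norm_mult norm_minus_cancel norm_one)
    then show ?thesis using abs_square_eq_1[of "norm j"] by (auto simp: power2_eq_square)
  qed
  \<comment> \<open>Powers of a point of the unit circle stay on it, where the triangle inequality
    bounds the norm by 2; a norm above 1 would make them unbounded.\<close>
  have le1: "norm (of_real a + of_real b * j) \<le> 1" if "a\<^sup>2 + b\<^sup>2 = 1" for a b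
  proof (rule ccontr)
    assume gt: "\<not> ?thesis"
    define w where "w = of_real a + of_real b * j"
    have P: "\<exists>a b. w ^ n = of_real a + of_real b * j \<and> a\<^sup>2 + b\<^sup>2 = 1" for n
    proof (induction n)
      case 0
      show ?case by (intro exI[of _ 1] exI[of _ 0]) simp
    next
      case (Suc n)
      then obtain c d where cd: "w ^ n = of_real c + of_real d * j" "c\<^sup>2 + d\<^sup>2 = 1" by blast
      have "w ^ Suc n = of_real (a * c - b * d) + of_real (a * d + b * c) * j"
        using jj by (simp add: w_def[symmetric] cd) (simp add: w_def algebra_simps, simp add: mult.assoc[symmetric])
      moreover have "(a * c - b * d)\<^sup>2 + (a * d + b * c)\<^sup>2 = (a\<^sup>2 + b\<^sup>2) * (c\<^sup>2 + d\<^sup>2)"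
        by (simp add: power2_eq_square algebra_simps)
      ultimately show ?case using that cd by (metis mult_1)
    qed
    have "norm w ^ n \<le> 2" for n
    proof -
      obtain c d where cd: "w ^ n = of_real c + of_real d * j" "c\<^sup>2 + d\<^sup>2 = 1" using P by blast
      have "c\<^sup>2 \<le> 1" "d\<^sup>2 \<le> 1" using cd(2) zero_le_power2[of c] zero_le_power2[of d] by linarith+
      then have "\<bar>c\<bar> \<le> 1" "\<bar>d\<bar> \<le> 1" by (simp_all add: abs_square_le_1)
      then have "norm (w ^ n) \<le> 1 + 1"
        unfolding cd by (intro norm_triangle_le) (auto simp: norm_mult nj)
      then show ?thesis by (simp add: norm_power)
    qed
    moreover have "\<exists>n. 2 < norm w ^ n" using gt by (intro real_arch_pow) (simp add: w_def)
    ultimately show False by (meson not_le)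
  qed
  have nrm: "(norm z)\<^sup>2 = (re z)\<^sup>2 + (im z)\<^sup>2" for z
  proof (cases "z = 0")
    case True
    then show ?thesis using re1[of 0 0] by simp
  next
    case False
    define r where "r = sqrt ((re z)\<^sup>2 + (im z)\<^sup>2)"
    have "re z \<noteq> 0 \<or> im z \<noteq> 0" using ri[symmetric, of z] False by auto
    then have r: "r > 0" by (auto simp: r_def add_nonneg_pos add_pos_nonneg)
    have r2: "r\<^sup>2 = (re z)\<^sup>2 + (im z)\<^sup>2" by (simp add: r_def)
    \<comment> \<open>The normalized \<open>z\<close> and its conjugate have norm at most 1 and
      product 1, hence norm exactly 1.\<close>
    define w where "w = of_real (re z / r) + of_real (im z / r) * j"
    define v where "v = of_real (re z / r) + of_real (- im z / r) * j"
    have u: "(re z / r)\<^sup>2 + (im z / r)\<^sup>2 = 1"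
      unfolding power_divide add_divide_distrib[symmetric] r2[symmetric] using r by simp
    have "norm w \<le> 1" "norm v \<le> 1" unfolding w_def v_def using u by (intro le1; simp)+
    moreover have "norm w * norm v = 1"
      unfolding norm_mult[symmetric] using prod[of "re z / r" "im z / r"] u by (simp add: w_def v_def)
    ultimately have "norm w = 1"
      using mult_left_le[of "norm v" "norm w"] by (metis antisym norm_ge_zero)
    moreover have "of_real r * w = of_real (re z) + of_real (im z) * j"
      unfolding w_def distrib_left mult.assoc[symmetric] of_real_mult[symmetric] using r by simp
    then have "z = of_real r * w" by (simp add: ri[symmetric])
    ultimately show ?thesis using r by (simp add: norm_mult r2)
  qed
  have "scalar_coordinates j re im"
    unfolding scalar_coordinates_def using jj re1 add nrm by (simp add: ri[symmetric])
  then show ?thesis by blast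
qed

text \<open>Apart from additivity, all laws follow from
  \<open>x * c x = of_real ((norm x)\<^sup>2)\<close> by cancelling a nonzero factor, which treats
  both fields at once.\<close>

lemma scalar_conjugation:
  obtains c :: "'k::real_normed_field \<Rightarrow> 'k" where
    "\<And>x y. c (x + y) = c x + c y" "\<And>x y. c (x * y) = c x * c y"
    "\<And>x. x * c x = of_real ((norm x)\<^sup>2)" "\<And>x. c (c x) = x" "\<And>x. norm (c x) = norm x"
proof -
  obtain j :: 'k and re im where sc: "scalar_coordinates j re im" using scalar_structure by blast
  note S = sc[unfolded scalar_coordinates_def, THEN conjunct1]
    sc[unfolded scalar_coordinates_def, THEN conjunct2, THEN conjunct1, rule_format]
    sc[unfolded scalar_coordinates_def, THEN conjunct2, THEN conjunct2, THEN conjunct1, rule_format]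
    sc[unfolded scalar_coordinates_def, THEN conjunct2, THEN conjunct2, THEN conjunct2, THEN conjunct1, rule_format]
    sc[unfolded scalar_coordinates_def, THEN conjunct2, THEN conjunct2, THEN conjunct2, THEN conjunct2, THEN conjunct1, rule_format]
    sc[unfolded scalar_coordinates_def, THEN conjunct2, THEN conjunct2, THEN conjunct2, THEN conjunct2, THEN conjunct2, rule_format]
  define c where "c z = of_real (re z) - of_real (im z) * j" for z
  \<comment> \<open>In the real case the vanishing of \<open>im\<close> is not recorded in
    \<open>scalar_coordinates\<close>; it is read off from the norm formula.\<close>
  have j0: "im z = 0" if "j = 0" for z
  proof -
    have "z = of_real (re z)" using S(2)[of z] that by simp
    then have "(norm z)\<^sup>2 = (re z)\<^sup>2" by (metis norm_of_real power2_abs)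
    then show ?thesis using S(6)[of z] by simp
  qed
  have c1: "c (x + y) = c x + c y" for x y by (simp add: c_def S(4,5) algebra_simps)
  have c3: "x * c x = of_real ((norm x)\<^sup>2)" for x
  proof -
    have "x * c x = (of_real (re x) + of_real (im x) * j) * c x" by (simp add: S(2))
    also have "\<dots> = of_real ((re x)\<^sup>2) - of_real ((im x)\<^sup>2) * (j * j)"
      by (simp add: c_def power2_eq_square algebra_simps)
    also have "\<dots> = of_real ((norm x)\<^sup>2)" using S(1) j0[of x] by (auto simp: S(6))
    finally show ?thesis .
  qed
  have c0: "c 0 = 0" using c1[of 0 0] by simp
  have c5: "norm (c x) = norm x" for x
  proof (cases "x = 0")
    case False
    have "norm x * norm (c x) = norm x * norm x"
      unfolding norm_mult[symmetric] c3 by (simp add: power2_eq_square norm_mult)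
    then show ?thesis using False by simp
  qed (simp add: c0)
  have c4: "c (c x) = x" for x
  proof (cases "x = 0")
    case False
    have "c x * c (c x) = c x * x" using c3[of "c x"] c3[of x] by (simp add: c5 mult.commute)
    moreover have "c x \<noteq> 0" using c5[of x] False by auto
    ultimately show ?thesis by simp
  qed (simp add: c0)
  have c2: "c (x * y) = c x * c y" for x y
  proof (cases "x = 0 \<or> y = 0")
    case False
    have "(x * y) * c (x * y) = of_real ((norm (x * y))\<^sup>2)" by (rule c3)
    also have "\<dots> = (x * c x) * (y * c y)" unfolding c3 by (simp add: norm_mult power_mult_distrib)
    finally have "(x * y) * c (x * y) = (x * y) * (c x * c y)" by (simp add: algebra_simps)
    then show ?thesis using False by simp
  qed (auto simp: c0)
  show ?thesis by (rule that[of c]) (fact c1 c2 c3 c4 c5)+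
qed

text \<open>Completeness is not part of the type class; it is inherited from the reals because both
  coordinates are bounded by the norm.\<close>

lemma scalar_Cauchy_convergent:
  fixes X :: "nat \<Rightarrow> 'k::real_normed_field"
  assumes "Cauchy X" shows "convergent X"
proof -
  obtain j :: 'k and re im where sc: "scalar_coordinates j re im" using scalar_structure by blast
  note S = sc[unfolded scalar_coordinates_def, THEN conjunct1]
    sc[unfolded scalar_coordinates_def, THEN conjunct2, THEN conjunct1, rule_format]
    sc[unfolded scalar_coordinates_def, THEN conjunct2, THEN conjunct2, THEN conjunct1, rule_format]
    sc[unfolded scalar_coordinates_def, THEN conjunct2, THEN conjunct2, THEN conjunct2, THEN conjunct1, rule_format]
    sc[unfolded scalar_coordinates_def, THEN conjunct2, THEN conjunct2, THEN conjunct2, THEN conjunct2, THEN conjunct1, rule_format]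
    sc[unfolded scalar_coordinates_def, THEN conjunct2, THEN conjunct2, THEN conjunct2, THEN conjunct2, THEN conjunct2, rule_format]
  have conv: "convergent (\<lambda>n. r (X n))" if add: "\<And>x y. r (x + y) = r x + (r y :: real)"
    and le: "\<And>z. \<bar>r z\<bar> \<le> norm z" for r
  proof -
    have dif: "r (x - y) = r x - r y" for x y using add[of "x - y" y] by simp
    have "Cauchy (\<lambda>n. r (X n))"
    proof (rule metric_CauchyI)
      fix e :: real assume "e > 0"
      then obtain M where M: "\<And>m n. m \<ge> M \<Longrightarrow> n \<ge> M \<Longrightarrow> dist (X m) (X n) < e"
        using metric_CauchyD[OF assms] by blast
      show "\<exists>M. \<forall>m\<ge>M. \<forall>n\<ge>M. dist (r (X m)) (r (X n)) < e"
        using M le[of "X _ - X _"] by (intro exI[of _ M]) (smt (verit) dif dist_norm real_norm_def)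
    qed
    then show ?thesis by (simp add: Cauchy_convergent_iff)
  qed
  have "convergent (\<lambda>n. re (X n))" "convergent (\<lambda>n. im (X n))"
    using S(6) by (intro conv S; simp add: abs_le_square_iff[where y = "norm _", simplified])+
  then obtain a b where "(\<lambda>n. re (X n)) \<longlonglongrightarrow> a" "(\<lambda>n. im (X n)) \<longlonglongrightarrow> b" by (auto simp: convergent_def)
  then have "(\<lambda>n. of_real (re (X n)) + of_real (im (X n)) * j) \<longlonglongrightarrow> of_real a + of_real b * j"
    by (intro tendsto_intros)
  then show ?thesis unfolding S(2) by (rule convergentI)
qed

lemma scalar_summable_norm_cancel:
  fixes X :: "nat \<Rightarrow> 'k::real_normed_field"
  assumes "summable (\<lambda>n. norm (X n))" shows "summable X"
proof -
  have "Cauchy (\<lambda>n. \<Sum>i<n. norm (X i))"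
    using assms by (simp add: summable_iff_convergent convergent_Cauchy)
  have "Cauchy (\<lambda>n. \<Sum>i<n. X i)"
  proof (rule metric_CauchyI)
    fix e :: real assume "e > 0"
    then obtain M where M: "\<And>m n. m \<ge> M \<Longrightarrow> n \<ge> M \<Longrightarrow> dist (\<Sum>i<m. norm (X i)) (\<Sum>i<n. norm (X i)) < e"
      using metric_CauchyD[OF \<open>Cauchy (\<lambda>n. \<Sum>i<n. norm (X i))\<close>] by blast
    have *: "dist (\<Sum>i<m. X i) (\<Sum>i<n. X i) < e" if "m \<ge> M" "n \<ge> m" for m n
    proof -
      have "dist (\<Sum>i<m. X i) (\<Sum>i<n. X i) = norm (\<Sum>i\<in>{m..<n}. X i)"
        using that sum_diff_nat_ivl[of 0 m n X]
        by (subst dist_commute) (simp add: dist_norm atLeast0LessThan[symmetric])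
      also have "\<dots> \<le> (\<Sum>i\<in>{m..<n}. norm (X i))" by (rule norm_sum)
      also have "\<dots> \<le> dist (\<Sum>i<m. norm (X i)) (\<Sum>i<n. norm (X i))"
        using that sum_diff_nat_ivl[of 0 m n "\<lambda>i. norm (X i)"]
        by (simp add: dist_norm atLeast0LessThan[symmetric])
      also have "\<dots> < e" using M that by simp
      finally show ?thesis .
    qed
    show "\<exists>M. \<forall>m\<ge>M. \<forall>n\<ge>M. dist (\<Sum>i<m. X i) (\<Sum>i<n. X i) < e"
      using * by (intro exI[of _ M]) (metis dist_commute nle_le)
  qed
  then show ?thesis by (simp add: summable_iff_convergent scalar_Cauchy_convergent)
qed

section \<open>Seminorms and the Hahn--Banach theorem\<close>

text \<open>Otherwise the simplifier eta-expands sums and differences of functions.\<close>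

declare plus_fun_apply [simp del] minus_apply [simp del] uminus_apply [simp del]
  zero_fun_apply [simp del]

text \<open>Rewriting to the pointwise group operations makes the standard algebra of sums and
  differences available.\<close>

lemma fadd_eq_plus: "fadd f g = f + g"
  by (simp add: fadd_def fun_eq_iff plus_fun_apply)

lemma fdiff_eq_minus: "fdiff f g = f - g"
  by (simp add: fdiff_def fun_eq_iff minus_apply)

lemma fzero_eq_0: "fzero = 0"
  by (simp add: fzero_def fun_eq_iff zero_fun_apply)

lemmas fun_ops = fadd_eq_plus fdiff_eq_minus fzero_eq_0

lemma fscale_apply: "fscale c f x = c * f x"
  by (simp add: fscale_def)

lemmas fun_apply = plus_fun_apply minus_apply uminus_apply zero_fun_apply fscale_apply

lemma fscale_add: "fscale c (f + g) = fscale c f + fscale c g"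
  and fscale_diff: "fscale c (f - g) = fscale c f - fscale c g"
  and fscale_add_left: "fscale (a + b) f = fscale a f + fscale b f"
  and fscale_diff_left: "fscale (a - b) f = fscale a f - fscale b f"
  and fscale_fscale [simp]: "fscale a (fscale b f) = fscale (a * b) f"
  and fscale_1 [simp]: "fscale 1 f = f"
  and fscale_0 [simp]: "fscale 0 f = 0"
  and fscale_0_right [simp]: "fscale c 0 = 0"
  and fscale_minus: "fscale (- c) f = - fscale c f"
  by (simp_all add: fun_eq_iff fun_apply algebra_simps)

lemma sum_fun_apply: "(\<Sum>i\<in>A. f i) x = (\<Sum>i\<in>A. f i x)" for f :: "'a \<Rightarrow> 'b \<Rightarrow> 'c::comm_monoid_add"
  by (induction A rule: infinite_finite_induct) (auto simp: plus_fun_apply zero_fun_apply)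

lemma fscale_sum: "fscale c (\<Sum>i\<in>A. f i) = (\<Sum>i\<in>A. fscale c (f i))"
  by (simp add: fun_eq_iff sum_fun_apply fscale_apply sum_distrib_left)

lemma subspace_0: "fun_subspace E \<Longrightarrow> 0 \<in> E"
  and subspace_add: "fun_subspace E \<Longrightarrow> f \<in> E \<Longrightarrow> g \<in> E \<Longrightarrow> f + g \<in> E"
  and subspace_scale: "fun_subspace E \<Longrightarrow> f \<in> E \<Longrightarrow> fscale c f \<in> E"
  by (auto simp: fun_subspace_def fun_ops)

lemma subspace_minus: "fun_subspace E \<Longrightarrow> f \<in> E \<Longrightarrow> - f \<in> E"
  using subspace_scale[of E f "- 1"] by (simp add: fscale_minus)

lemma subspace_diff: "fun_subspace E \<Longrightarrow> f \<in> E \<Longrightarrow> g \<in> E \<Longrightarrow> f - g \<in> E"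
  using subspace_add[of E f "- g"] subspace_minus[of E g] by simp

lemma subspace_sum: "fun_subspace E \<Longrightarrow> (\<And>i. i \<in> A \<Longrightarrow> f i \<in> E) \<Longrightarrow> (\<Sum>i\<in>A. f i) \<in> E"
  by (induction A rule: infinite_finite_induct) (auto intro: subspace_0 subspace_add)

lemmas subspace_intros = subspace_0 subspace_add subspace_scale subspace_minus subspace_diff subspace_sum

definition seminorm_on :: "('d \<Rightarrow> 'k::real_normed_field) set \<Rightarrow> (('d \<Rightarrow> 'k) \<Rightarrow> real) \<Rightarrow> bool" where
  "seminorm_on E p \<longleftrightarrow> (\<forall>f\<in>E. \<forall>g\<in>E. p (f + g) \<le> p f + p g) \<and> (\<forall>c. \<forall>f\<in>E. p (fscale c f) = norm c * p f)"

definition linear_on :: "('d \<Rightarrow> 'k::real_normed_field) set \<Rightarrow> (('d \<Rightarrow> 'k) \<Rightarrow> 'k) \<Rightarrow> bool" where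
  "linear_on E v \<longleftrightarrow> (\<forall>f\<in>E. \<forall>g\<in>E. v (f + g) = v f + v g) \<and> (\<forall>c. \<forall>f\<in>E. v (fscale c f) = c * v f)"

text \<open>Linearity is tested pointwise on the values, so that no target space occurs in it; that
  the values lie in a given space is assumed separately.\<close>

definition linear_map_on :: "('d \<Rightarrow> 'k::real_normed_field) set \<Rightarrow> (('d \<Rightarrow> 'k) \<Rightarrow> 'e \<Rightarrow> 'k) \<Rightarrow> bool" where
  "linear_map_on E u \<longleftrightarrow> (\<forall>x. linear_on E (\<lambda>f. u f x))"

lemma linear_map_add: "linear_map_on E u \<Longrightarrow> f \<in> E \<Longrightarrow> g \<in> E \<Longrightarrow> u (f + g) = u f + u g"
  and linear_map_scale: "linear_map_on E u \<Longrightarrow> f \<in> E \<Longrightarrow> u (fscale c f) = fscale c (u f)"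
  by (auto simp: linear_map_on_def linear_on_def fun_eq_iff fun_apply)

lemma linear_on_add: "linear_on E v \<Longrightarrow> f \<in> E \<Longrightarrow> g \<in> E \<Longrightarrow> v (f + g) = v f + v g"
  and linear_on_scale: "linear_on E v \<Longrightarrow> f \<in> E \<Longrightarrow> v (fscale c f) = c * v f"
  by (auto simp: linear_on_def)

context
  fixes E :: "('d \<Rightarrow> 'k::real_normed_field) set"
  assumes E: "fun_subspace E"
begin

lemma linear_on_0: "linear_on E v \<Longrightarrow> v 0 = 0"
  using linear_on_scale[of E v 0 0] subspace_0[OF E] by simp

lemma linear_on_minus: "linear_on E v \<Longrightarrow> f \<in> E \<Longrightarrow> v (- f) = - v f"
  using linear_on_scale[of E v f "- 1"] by (simp add: fscale_minus)

lemma linear_on_diff: "linear_on E v \<Longrightarrow> f \<in> E \<Longrightarrow> g \<in> E \<Longrightarrow> v (f - g) = v f - v g"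
  using linear_on_add[of E v f "- g"] linear_on_minus[of v g] subspace_minus[OF E, of g] by simp

lemma linear_on_sum: "linear_on E v \<Longrightarrow> (\<And>i. i \<in> A \<Longrightarrow> f i \<in> E) \<Longrightarrow> v (\<Sum>i\<in>A. f i) = (\<Sum>i\<in>A. v (f i))"
  by (induction A rule: infinite_finite_induct)
    (auto simp: linear_on_0 linear_on_add subspace_sum[OF E])

lemma linear_map_diff: "linear_map_on E u \<Longrightarrow> f \<in> E \<Longrightarrow> g \<in> E \<Longrightarrow> u (f - g) = u f - u g"
  by (rule ext) (simp only: minus_apply linear_map_on_def linear_on_diff[of "\<lambda>f. u f x" for x])

context
  fixes p assumes p: "seminorm_on E p"
begin

lemma seminorm_add: "f \<in> E \<Longrightarrow> g \<in> E \<Longrightarrow> p (f + g) \<le> p f + p g"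
  and seminorm_scale: "f \<in> E \<Longrightarrow> p (fscale c f) = norm c * p f"
  using p by (auto simp: seminorm_on_def)

lemma seminorm_0: "p 0 = 0"
  using seminorm_scale[OF subspace_0[OF E], of 0] by simp

lemma seminorm_minus: "f \<in> E \<Longrightarrow> p (- f) = p f"
  using seminorm_scale[of f "- 1"] by (simp add: fscale_minus)

lemma seminorm_ge_0: "f \<in> E \<Longrightarrow> p f \<ge> 0"
  using seminorm_add[of f "- f"] seminorm_minus[of f] subspace_minus[OF E, of f] seminorm_0 by simp

lemma seminorm_diff: "f \<in> E \<Longrightarrow> g \<in> E \<Longrightarrow> p (f - g) \<le> p f + p g"
  using seminorm_add[of f "- g"] seminorm_minus[of g] subspace_minus[OF E, of g] by simp

lemma seminorm_commute: "f \<in> E \<Longrightarrow> g \<in> E \<Longrightarrow> p (f - g) = p (g - f)"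
  using seminorm_minus[of "f - g"] subspace_diff[OF E, of f g] by simp

lemma seminorm_triangle_ge: "f \<in> E \<Longrightarrow> g \<in> E \<Longrightarrow> p f \<le> p g + p (f - g)"
  using seminorm_add[of g "f - g"] subspace_diff[OF E, of f g] by simp

lemma seminorm_triangle3: "f \<in> E \<Longrightarrow> g \<in> E \<Longrightarrow> h \<in> E \<Longrightarrow> p (f - h) \<le> p (f - g) + p (g - h)"
  using seminorm_add[of "f - g" "g - h"] by (simp add: subspace_diff[OF E])

lemma seminorm_sum: "(\<And>i. i \<in> A \<Longrightarrow> f i \<in> E) \<Longrightarrow> p (\<Sum>i\<in>A. f i) \<le> (\<Sum>i\<in>A. p (f i))"
proof (induction A rule: infinite_finite_induct)
  case (insert x A)
  have "sum f A \<in> E" by (rule subspace_sum[OF E]) (simp add: insert.prems)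
  then have "p (f x + sum f A) \<le> p (f x) + p (sum f A)" by (intro seminorm_add insert.prems) auto
  moreover have "p (sum f A) \<le> (\<Sum>i\<in>A. p (f i))" by (intro insert.IH) (simp add: insert.prems)
  ultimately show ?case using insert.hyps by simp
qed (auto simp: seminorm_0)

end

text \<open>Homogeneity: scaling by \<open>1 / (p f + d)\<close> brings \<open>f\<close> into the
  unit ball, and the positive shift \<open>d\<close> covers the case \<open>p f = 0\<close>.\<close>

lemma seminorm_dominated:
  assumes p: "seminorm_on E p" and q: "seminorm_on E q"
    and le: "\<And>f. f \<in> E \<Longrightarrow> p f \<le> 1 \<Longrightarrow> q f \<le> C" and f: "f \<in> E"
  shows "q f \<le> C * p f"
proof (rule field_le_epsilon)
  fix e :: real assume e: "e > 0"
  have C: "C \<ge> 0" using le[of 0] seminorm_0[OF p] seminorm_0[OF q] subspace_0[OF E] by simp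
  define d where "d = e / (C + 1)"
  have d: "d > 0" using e C by (simp add: d_def)
  have pf: "p f \<ge> 0" by (rule seminorm_ge_0[OF p f])
  define s where "s = 1 / (p f + d)"
  have s: "s > 0" using d pf by (simp add: s_def)
  have "p (fscale (of_real s) f) = s * p f" using s by (simp add: seminorm_scale[OF p f])
  then have "p (fscale (of_real s) f) \<le> 1" using d pf by (simp add: s_def)
  then have "q (fscale (of_real s) f) \<le> C" using le subspace_scale[OF E f] by blast
  then have "s * q f \<le> C" using s by (simp add: seminorm_scale[OF q f])
  then have "q f \<le> C * (p f + d)" using d pf
    by (simp add: s_def divide_simps mult.commute)
  also have "\<dots> \<le> C * p f + e"
    using mult_right_mono[of C "C + 1" "e / (C + 1)"] e C by (simp add: d_def distrib_left)
  finally show "q f \<le> C * p f + e" .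
qed

lemma seminorm_on_add: "seminorm_on E p \<Longrightarrow> seminorm_on E q \<Longrightarrow> seminorm_on E (\<lambda>f. p f + q f)"
  by (auto simp: seminorm_on_def algebra_simps) (smt (verit))

lemma seminorm_on_scale: "seminorm_on E p \<Longrightarrow> c \<ge> 0 \<Longrightarrow> seminorm_on E (\<lambda>f. c * p f)"
  by (auto simp: seminorm_on_def algebra_simps) (metis mult_left_mono distrib_left)

lemma seminorm_on_const_0: "seminorm_on E (\<lambda>f. 0)"
  by (auto simp: seminorm_on_def)

lemma seminorm_on_linear: "linear_on E v \<Longrightarrow> seminorm_on E (\<lambda>f. norm (v f))"
  by (auto simp: seminorm_on_def linear_on_def norm_mult norm_triangle_ineq)

end

lemma seminorm_on_comp:
  assumes "linear_map_on E u" "\<And>f. f \<in> E \<Longrightarrow> u f \<in> F" "seminorm_on F p"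
  shows "seminorm_on E (\<lambda>f. p (u f))"
  using assms by (auto simp: seminorm_on_def linear_map_add linear_map_scale)

section \<open>Linear functionals below sublinear functions\<close>

definition sublinear_on :: "('d \<Rightarrow> 'k::real_normed_field) set \<Rightarrow> (('d \<Rightarrow> 'k) \<Rightarrow> real) \<Rightarrow> bool" where
  "sublinear_on E q \<longleftrightarrow> q 0 \<le> 0 \<and> (\<forall>f\<in>E. \<forall>g\<in>E. q (f + g) \<le> q f + q g) \<and>
     (\<forall>f\<in>E. \<forall>t>0. q (fscale (of_real t) f) \<le> t * q f)"

context
  fixes E :: "('d \<Rightarrow> 'k::real_normed_field) set"
  assumes E: "fun_subspace E"
begin

text \<open>The inequality for \<open>1 / t\<close> is the reverse of that for \<open>t\<close>; the
  definition asks for one direction because infima satisfy it directly.\<close>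

lemma sublinear_scale:
  assumes q: "sublinear_on E q" and f: "f \<in> E" and t: "t > 0"
  shows "q (fscale (of_real t) f) = t * q f"
proof (rule antisym)
  have "q f = q (fscale (of_real (1 / t)) (fscale (of_real t) f))"
    using t by (simp flip: of_real_mult del: of_real_divide)
  also have "\<dots> \<le> (1 / t) * q (fscale (of_real t) f)"
    using q t subspace_scale[OF E f] unfolding sublinear_on_def by (meson zero_less_divide_1_iff)
  finally show "t * q f \<le> q (fscale (of_real t) f)" using t by (simp add: field_simps)
qed (use q t f in \<open>auto simp: sublinear_on_def\<close>)

lemma sublinear_ge: "sublinear_on E q \<Longrightarrow> f \<in> E \<Longrightarrow> - q (- f) \<le> q f"
proof -
  assume q: "sublinear_on E q" and f: "f \<in> E"
  have "q (0 + 0) \<le> q 0 + q 0" "q (f + - f) \<le> q f + q (- f)"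
    using q f subspace_minus[OF E f] subspace_0[OF E] unfolding sublinear_on_def by blast+
  then show ?thesis by simp
qed

text \<open>Functions minimal in the set of sublinear functions below a given one are linear, so Zorn's lemma
  yields a real-linear functional below it.\<close>

definition shift_sublinear :: "(('d \<Rightarrow> 'k) \<Rightarrow> real) \<Rightarrow> ('d \<Rightarrow> 'k) \<Rightarrow> ('d \<Rightarrow> 'k) \<Rightarrow> real" where
  "shift_sublinear q y f = (INF t\<in>{0..}. q (f + fscale (of_real t) y) - t * q y)"

text \<open>The value \<open>t = 0\<close> puts the shift below \<open>q\<close>, and
  \<open>t = 1\<close> gives \<open>shift_sublinear q y f \<le> q (f + y) - q y\<close>; equality
  with a minimal \<open>q\<close> thus yields superadditivity.\<close>

lemma shift_sublinear:
  assumes q: "sublinear_on E q" and y: "y \<in> E"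
  shows shift_sublinear_le: "\<And>f t. f \<in> E \<Longrightarrow> t \<ge> 0 \<Longrightarrow>
      shift_sublinear q y f \<le> q (f + fscale (of_real t) y) - t * q y"
    and sublinear_shift: "sublinear_on E (shift_sublinear q y)"
proof -
  let ?s = "shift_sublinear q y"
  have yt: "fscale (of_real t) y \<in> E" for t by (rule subspace_scale[OF E y])
  have q0: "q 0 \<ge> 0" "q 0 \<le> 0" using sublinear_ge[OF q subspace_0[OF E]] q by (auto simp: sublinear_on_def)
  have qty: "q (fscale (of_real t) y) = t * q y" if "t \<ge> 0" for t
    using sublinear_scale[OF q y, of t] that q0 by (cases "t = 0") auto
  have qadd: "q (f + g) \<le> q f + q g" if "f \<in> E" "g \<in> E" for f g
    using q that by (auto simp: sublinear_on_def)
  have bdd: "bdd_below ((\<lambda>t. q (f + fscale (of_real t) y) - t * q y) ` {0..})" if f: "f \<in> E" for f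
  proof (rule bdd_belowI2)
    fix t :: real assume t: "t \<in> {0..}"
    have "q (fscale (of_real t) y) \<le> q (f + fscale (of_real t) y) + q (- f)"
      using qadd[of "f + fscale (of_real t) y" "- f"] f yt by (simp add: subspace_intros[OF E])
    then show "- q (- f) \<le> q (f + fscale (of_real t) y) - t * q y" using qty[of t] t by simp
  qed
  show le: "?s f \<le> q (f + fscale (of_real t) y) - t * q y" if "f \<in> E" "t \<ge> 0" for f t
    unfolding shift_sublinear_def using that by (intro cINF_lower bdd) auto
  have ge: "c \<le> ?s f" if "\<And>t. t \<ge> 0 \<Longrightarrow> c \<le> q (f + fscale (of_real t) y) - t * q y" for c f
    unfolding shift_sublinear_def using that by (intro cINF_greatest) auto
  show "sublinear_on E ?s"
    unfolding sublinear_on_def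
  proof (intro conjI ballI allI impI)
    show "?s 0 \<le> 0" using le[of 0 0] subspace_0[OF E] q0 by simp
  next
    fix f g assume fg: "f \<in> E" "g \<in> E"
    have "?s (f + g) - (q (f + fscale (of_real s) y) - s * q y) \<le> q (g + fscale (of_real t) y) - t * q y"
      if "s \<ge> 0" "t \<ge> 0" for s t
    proof -
      have "?s (f + g) \<le> q (f + g + fscale (of_real (s + t)) y) - (s + t) * q y"
        using fg that by (intro le subspace_add[OF E]) auto
      also have "f + g + fscale (of_real (s + t)) y = (f + fscale (of_real s) y) + (g + fscale (of_real t) y)"
        by (simp add: fscale_add_left)
      also have "q \<dots> \<le> q (f + fscale (of_real s) y) + q (g + fscale (of_real t) y)"
        using fg yt by (intro qadd subspace_add[OF E])
      finally show ?thesis by (simp add: algebra_simps)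
    qed
    then have "?s (f + g) - (q (f + fscale (of_real s) y) - s * q y) \<le> ?s g" if "s \<ge> 0" for s
      using that by (intro ge)
    then have "?s (f + g) - ?s g \<le> ?s f" by (intro ge) (smt (verit))
    then show "?s (f + g) \<le> ?s f + ?s g" by simp
  next
    fix f and c :: real assume f: "f \<in> E" and c: "c > 0"
    have "?s (fscale (of_real c) f) / c \<le> q (f + fscale (of_real t) y) - t * q y" if t: "t \<ge> 0" for t
    proof -
      have "?s (fscale (of_real c) f) \<le> q (fscale (of_real c) f + fscale (of_real (c * t)) y) - (c * t) * q y"
        using f c t by (intro le subspace_scale[OF E]) auto
      also have "fscale (of_real c) f + fscale (of_real (c * t)) y = fscale (of_real c) (f + fscale (of_real t) y)"
        by (simp add: fscale_add)
      also have "q \<dots> = c * q (f + fscale (of_real t) y)"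
        using f c yt by (intro sublinear_scale[OF q] subspace_add[OF E])
      finally show ?thesis using c by (simp add: field_simps)
    qed
    then have "?s (fscale (of_real c) f) / c \<le> ?s f" by (rule ge)
    then show "?s (fscale (of_real c) f) \<le> c * ?s f" using c by (simp add: field_simps)
  qed
qed

lemma ex_linear_below_sublinear:
  assumes p: "sublinear_on E p"
  shows "\<exists>l. (\<forall>f\<in>E. l f \<le> p f) \<and> (\<forall>f\<in>E. \<forall>g\<in>E. l (f + g) = l f + l g) \<and>
    (\<forall>t. \<forall>f\<in>E. l (fscale (of_real t) f) = t * l f)"
proof -
  define A where "A = {q. sublinear_on E q \<and> (\<forall>f\<in>E. q f \<le> p f) \<and> (\<forall>f. f \<notin> E \<longrightarrow> q f = 0)}"
  \<comment> \<open>The order is reversed, so a maximal element in the sense of Zorn is a pointwise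
    minimal function.\<close>
  let ?P = "\<lambda>a u :: ('d \<Rightarrow> 'k) \<Rightarrow> real. \<forall>f. u f \<le> a f"
  \<comment> \<open>Members of \<open>A\<close> vanish outside \<open>E\<close>, so that an
    inequality on \<open>E\<close> alone compares them; \<open>cut\<close> enforces this.\<close>
  define cut where "cut q f = (if f \<in> E then q f else 0)" for q :: "('d \<Rightarrow> 'k) \<Rightarrow> real" and f
  have cut: "sublinear_on E (cut q) \<longleftrightarrow> sublinear_on E q" for q
    by (auto simp: sublinear_on_def cut_def subspace_intros[OF E])
  have "\<exists>m\<in>A. \<forall>a\<in>A. ?P m a \<longrightarrow> a = m"
  proof (rule predicate_Zorn)
    show "partial_order_on A (relation_of ?P A)"
      by (rule partial_order_on_relation_ofI) (auto intro: order_trans intro!: ext antisym)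
  next
    fix C assume C: "C \<in> Chains (relation_of ?P A)"
    then have CA: "C \<subseteq> A" and tot: "\<And>a b. a \<in> C \<Longrightarrow> b \<in> C \<Longrightarrow> ?P a b \<or> ?P b a"
      by (auto simp: Chains_def relation_of_def)
    show "\<exists>u\<in>A. \<forall>a\<in>C. ?P a u"
    proof (cases "C = {}")
      case True
      then show ?thesis using p by (intro bexI[of _ "cut p"]) (auto simp: A_def cut, auto simp: cut_def)
    next
      case False
      \<comment> \<open>The infimum of a chain is finite because each member satisfies
        \<open>q f \<ge> - q (- f) \<ge> - p (- f)\<close> on \<open>E\<close>.\<close>
      define u where "u f = (INF q\<in>C. q f)" for f
      have bdd: "bdd_below ((\<lambda>q. q f) ` C)" for f
      proof (rule bdd_belowI2)
        fix q assume "q \<in> C"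
        then have q: "q \<in> A" using CA by auto
        show "(if f \<in> E then - p (- f) else 0) \<le> q f"
        proof (cases "f \<in> E")
          case True
          have "q (- f) \<le> p (- f)" using q subspace_minus[OF E True] by (auto simp: A_def)
          then show ?thesis using True sublinear_ge[of q f] q by (auto simp: A_def)
        qed (use q in \<open>auto simp: A_def\<close>)
      qed
      have le: "u f \<le> q f" if "q \<in> C" for f q
        unfolding u_def by (rule cINF_lower[OF bdd that])
      have ge: "c \<le> u f" if "\<And>q. q \<in> C \<Longrightarrow> c \<le> q f" for f c
        unfolding u_def by (rule cINF_greatest[OF False that])
      have "sublinear_on E u"
        unfolding sublinear_on_def
      proof (intro conjI ballI allI impI)
        from False obtain q where "q \<in> C" by auto
        then show "u 0 \<le> 0" using le[of q 0] CA by (auto simp: A_def sublinear_on_def)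
      next
        fix f g assume fg: "f \<in> E" "g \<in> E"
        have "u (f + g) - q f \<le> r g" if qr: "q \<in> C" "r \<in> C" for q r
        proof -
          \<comment> \<open>Two members of the chain are replaced by the smaller one, for which
            subadditivity is available.\<close>
          obtain s where s: "s \<in> C" "?P q s" "?P r s" using tot[OF qr] qr by blast
          have "u (f + g) \<le> s (f + g)" by (rule le[OF s(1)])
          also have "\<dots> \<le> s f + s g" using s(1) CA fg by (auto simp: A_def sublinear_on_def)
          also have "\<dots> \<le> q f + r g" using s by (intro add_mono) auto
          finally show ?thesis by simp
        qed
        then have "u (f + g) - q f \<le> u g" if "q \<in> C" for q using that by (intro ge)
        then have "u (f + g) - u g \<le> u f" by (intro ge) (smt (verit))
        then show "u (f + g) \<le> u f + u g" by simp
      next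
        fix f and c :: real assume f: "f \<in> E" and c: "c > 0"
        have "u (fscale (of_real c) f) / c \<le> q f" if "q \<in> C" for q
        proof -
          have "u (fscale (of_real c) f) \<le> q (fscale (of_real c) f)" by (rule le[OF that])
          also have "\<dots> \<le> c * q f" using that CA f c by (auto simp: A_def sublinear_on_def)
          finally show ?thesis using c by (simp add: field_simps)
        qed
        then have "u (fscale (of_real c) f) / c \<le> u f" by (rule ge)
        then show "u (fscale (of_real c) f) \<le> c * u f" using c by (simp add: field_simps)
      qed
      moreover have "u f \<le> p f" if "f \<in> E" for f
      proof -
        from False obtain q where "q \<in> C" by auto
        then have "u f \<le> q f" "q f \<le> p f" using le CA that by (auto simp: A_def)
        then show ?thesis by simp
      qed
      moreover have "u f = 0" if "f \<notin> E" for f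
      proof -
        have "q f = 0" if "q \<in> C" for q using CA that \<open>f \<notin> E\<close> by (auto simp: A_def)
        then have "u f = (INF q\<in>C. 0)" unfolding u_def by (intro INF_cong) auto
        then show ?thesis using False by simp
      qed
      ultimately have "u \<in> A" by (simp add: A_def)
      then show ?thesis using le by blast
    qed
  qed
  then obtain m where m: "m \<in> A" and min: "\<And>a. a \<in> A \<Longrightarrow> ?P m a \<Longrightarrow> a = m" by blast
  have sm: "sublinear_on E m" and mp: "\<And>f. f \<in> E \<Longrightarrow> m f \<le> p f" and m0: "\<And>f. f \<notin> E \<Longrightarrow> m f = 0"
    using m by (auto simp: A_def)
  have add: "m (f + y) = m f + m y" if f: "f \<in> E" and y: "y \<in> E" for f y
  proof -
    have s_le: "shift_sublinear m y g \<le> m g" if "g \<in> E" for g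
      using shift_sublinear_le[OF sm y that, of 0] by simp
    have "cut (shift_sublinear m y) \<in> A"
      unfolding A_def mem_Collect_eq cut using sublinear_shift[OF sm y] s_le mp
      by (auto simp: cut_def intro: order_trans)
    moreover have "?P m (cut (shift_sublinear m y))" using s_le m0 by (auto simp: cut_def)
    ultimately have "cut (shift_sublinear m y) = m" by (rule min)
    then have "m f = shift_sublinear m y f" using f by (metis cut_def)
    also have "\<dots> \<le> m (f + fscale (of_real 1) y) - 1 * m y" by (rule shift_sublinear_le[OF sm y f]) simp
    finally show ?thesis using sm f y by (auto simp: sublinear_on_def intro!: antisym)
  qed
  have zero: "m 0 = 0" using add[of 0 0] subspace_0[OF E] by simp
  have neg: "m (- f) = - m f" if "f \<in> E" for f
    using add[of f "- f"] that subspace_minus[OF E that] zero by simp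
  have "m (fscale (of_real t) f) = t * m f" if f: "f \<in> E" for t f
  proof -
    consider "t = 0" | "t > 0" | "- t > 0" by linarith
    then show ?thesis
    proof cases
      case 3
      have "m (fscale (of_real t) f) = m (- fscale (of_real (- t)) f)" by (simp add: fscale_minus)
      also have "\<dots> = t * m f"
        using neg[OF subspace_scale[OF E f]] sublinear_scale[OF sm f 3] by simp
      finally show ?thesis .
    qed (auto simp: zero sublinear_scale[OF sm f])
  qed
  then show ?thesis using mp add by blast
qed

text \<open>A functional below \<open>shift_sublinear p f0\<close> is at most \<open>- p f0\<close>
  at \<open>- f0\<close>, hence reaches \<open>p f0\<close> at \<open>f0\<close>; this replaces the
  extension from the line through \<open>f0\<close>.\<close>

theorem Hahn_Banach:
  assumes p: "seminorm_on E p" and f0: "f0 \<in> E"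
  shows "\<exists>v. linear_on E v \<and> (\<forall>f\<in>E. norm (v f) \<le> p f) \<and> p f0 \<le> norm (v f0) \<and> (\<forall>f. f \<notin> E \<longrightarrow> v f = 0)"
proof -
  have sp: "sublinear_on E p"
    using p by (auto simp: sublinear_on_def seminorm_0[OF E p] seminorm_scale[OF E p] seminorm_add[OF E p])
  obtain l where l: "\<And>f. f \<in> E \<Longrightarrow> l f \<le> shift_sublinear p f0 f"
    and ladd: "\<And>f g. f \<in> E \<Longrightarrow> g \<in> E \<Longrightarrow> l (f + g) = l f + l g"
    and lsc: "\<And>t f. f \<in> E \<Longrightarrow> l (fscale (of_real t) f) = t * l f"
    using ex_linear_below_sublinear[OF sublinear_shift[OF sp f0]] by blast
  have lp: "l f \<le> p f" if "f \<in> E" for f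
    using l[OF that] shift_sublinear_le[OF sp f0 that, of 0] by simp
  have "l (- f0) \<le> p (- f0 + fscale (of_real 1) f0) - 1 * p f0"
    using l[of "- f0"] shift_sublinear_le[OF sp f0, of "- f0" 1] subspace_minus[OF E f0] by simp
  moreover have "l (- f0) = - l f0" using lsc[of f0 "- 1"] f0 by (simp add: fscale_minus)
  ultimately have lf0: "p f0 \<le> l f0" by (simp add: seminorm_0[OF E p])
  obtain j :: 'k and re im where sc: "scalar_coordinates j re im" using scalar_structure by blast
  obtain c :: "'k \<Rightarrow> 'k" where c: "\<And>x. x * c x = of_real ((norm x)\<^sup>2)" "\<And>x. norm (c x) = norm x"
    by (rule scalar_conjugation) blast
  have re1: "\<And>a b. re (of_real a + of_real b * j) = a"
    using sc unfolding scalar_coordinates_def by blast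
  \<comment> \<open>The usual complexification with real part \<open>l\<close>; for
    \<open>j = 0\<close> it is \<open>l\<close> itself.\<close>
  define w where "w f = of_real (l f) - j * of_real (l (fscale j f))" for f
  have re_w: "re (w f) = l f" for f
  proof -
    have "w f = of_real (l f) + of_real (- l (fscale j f)) * j" by (simp add: w_def)
    then show ?thesis by (simp only: re1)
  qed
  have wadd: "w (f + g) = w f + w g" if "f \<in> E" "g \<in> E" for f g
    using that by (simp add: w_def fscale_add ladd subspace_scale[OF E] algebra_simps)
  have wr: "w (fscale (of_real t) f) = of_real t * w f" if "f \<in> E" for t f
  proof -
    have "fscale j (fscale (of_real t) f) = fscale (of_real t) (fscale j f)" by (simp add: mult.commute)
    then show ?thesis using that
      unfolding w_def by (simp only: lsc subspace_scale[OF E]) (simp add: algebra_simps)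
  qed
  have wj: "w (fscale j f) = j * w f" if f: "f \<in> E" for f
  proof -
    have "j = 0 \<or> j * j = - 1" using sc by (auto simp: scalar_coordinates_def)
    then show ?thesis
    proof
      assume "j = 0"
      then show ?thesis using lsc[of f 0] f by (simp add: w_def)
    next
      assume jj: "j * j = - 1"
      then have "l (fscale j (fscale j f)) = - l f" using lsc[of f "- 1"] f by simp
      then have "w (fscale j f) = of_real (l (fscale j f)) + j * of_real (l f)" by (simp add: w_def)
      also have "\<dots> = j * w f" using jj by (simp add: w_def right_diff_distrib mult.assoc[symmetric])
      finally show ?thesis .
    qed
  qed
  have wscale: "w (fscale a f) = a * w f" if f: "f \<in> E" for a f
  proof -
    have a: "of_real (re a) + of_real (im a) * j = a" using sc by (auto simp: scalar_coordinates_def)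
    have "fscale a f = fscale (of_real (re a)) f + fscale (of_real (im a)) (fscale j f)"
      by (simp add: fscale_add_left[symmetric] a)
    then have "w (fscale a f) = of_real (re a) * w f + of_real (im a) * (j * w f)"
      using f by (simp only: wadd wr wj subspace_scale[OF E])
    also have "\<dots> = (of_real (re a) + of_real (im a) * j) * w f" by (simp add: algebra_simps)
    finally show ?thesis by (simp add: a)
  qed
  have lin: "linear_on E w" by (auto simp: linear_on_def wadd wscale)
  have bound: "norm (w f) \<le> p f" if f: "f \<in> E" for f
  proof (cases "w f = 0")
    case False
    \<comment> \<open>A scalar of norm 1 that rotates \<open>w f\<close> onto its norm, where the
      real bound applies.\<close>
    define a where "a = c (w f) / of_real (norm (w f))"
    have na: "norm a = 1" using False c(2) by (simp add: a_def norm_divide)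
    have "a * w f = (w f * c (w f)) / of_real (norm (w f))" by (simp add: a_def)
    also have "\<dots> = of_real (norm (w f))" unfolding c(1) using False by (simp add: power2_eq_square)
    finally have "w (fscale a f) = of_real (norm (w f))" by (simp add: wscale[OF f])
    then have "re (w (fscale a f)) = norm (w f)"
      using re1[of _ 0] by simp
    then have "norm (w f) = l (fscale a f)" by (simp add: re_w)
    also have "\<dots> \<le> p (fscale a f)" by (rule lp[OF subspace_scale[OF E f]])
    also have "\<dots> = p f" by (simp add: seminorm_scale[OF E p f] na)
    finally show ?thesis .
  qed (simp add: seminorm_ge_0[OF E p f])
  have "l f0 \<le> norm (w f0)"
  proof -
    have "(re (w f0))\<^sup>2 \<le> (norm (w f0))\<^sup>2" using sc by (simp add: scalar_coordinates_def)
    then have "\<bar>re (w f0)\<bar> \<le> norm (w f0)" by (metis abs_le_square_iff abs_norm_cancel)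
    then show ?thesis by (simp add: re_w)
  qed
  \<comment> \<open>The functional is cut off outside \<open>E\<close> to match the convention of
    \<open>dual\<close>.\<close>
  moreover have "linear_on E (\<lambda>f. if f \<in> E then w f else 0)"
    using lin by (auto simp: linear_on_def subspace_intros[OF E])
  ultimately show ?thesis using bound lf0 f0 by (intro exI[of _ "\<lambda>f. if f \<in> E then w f else 0"]) auto
qed

end

section \<open>Locally convex topologies and continuous seminorms\<close>

lemma cont_seminorm_iff: "cont_seminorm E T p \<longleftrightarrow> seminorm_on E p \<and> continuous_map T euclideanreal p"
  by (auto simp: cont_seminorm_def seminorm_on_def fun_ops)

lemma abs_convex_scale:
  assumes "abs_convex V" "f \<in> V" "norm c \<le> 1" shows "fscale c f \<in> V"
  using assms unfolding abs_convex_def fun_ops by (metis add.right_neutral fscale_0 norm_zero)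

lemma abs_convex_add:
  "abs_convex V \<Longrightarrow> f \<in> V \<Longrightarrow> g \<in> V \<Longrightarrow> norm a + norm b \<le> 1 \<Longrightarrow> fscale a f + fscale b g \<in> V"
  by (auto simp: abs_convex_def fun_ops)

context
  fixes E :: "('d \<Rightarrow> 'k::real_normed_field) set" and T
  assumes lcs: "lcs E T"
begin

lemma lcs_subspace: "fun_subspace E" and lcs_topspace: "topspace T = E"
  using lcs by (auto simp: lcs_def)

lemma continuous_map_scale_diff:
  assumes u: "u \<in> E" shows "continuous_map T T (\<lambda>f. fscale c (f - u))"
proof -
  have a: "continuous_map T T (\<lambda>f. f + (- u))"
  proof -
    have "continuous_map T (prod_topology T T) (\<lambda>f. (f, - u))"
      using subspace_minus[OF lcs_subspace u] by (simp add: continuous_map_pairwise o_def lcs_topspace)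
    moreover have "continuous_map (prod_topology T T) T (\<lambda>(f, g). fadd f g)" using lcs by (simp add: lcs_def)
    ultimately show ?thesis
      by (drule_tac continuous_map_compose) (auto simp: o_def fun_ops)
  qed
  have b: "continuous_map T T (fscale c)"
  proof -
    have "continuous_map T (prod_topology euclidean T) (\<lambda>f. (c, f))"
      by (simp add: continuous_map_pairwise o_def)
    moreover have "continuous_map (prod_topology euclidean T) T (\<lambda>(c, f). fscale c f)"
      using lcs by (simp add: lcs_def)
    ultimately show ?thesis
      by (drule_tac continuous_map_compose) (auto simp: o_def)
  qed
  show ?thesis using continuous_map_compose[OF a b] by (simp add: o_def)
qed

lemma continuous_map_scale_left:
  assumes f: "f \<in> E" shows "continuous_map euclidean T (\<lambda>c. fscale c f)"
proof -
  have "continuous_map euclidean (prod_topology euclidean T) (\<lambda>c. (c, f))"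
    using f by (simp add: continuous_map_pairwise o_def lcs_topspace)
  moreover have "continuous_map (prod_topology euclidean T) T (\<lambda>(c, f). fscale c f)"
    using lcs by (simp add: lcs_def)
  ultimately show ?thesis by (drule_tac continuous_map_compose) (auto simp: o_def)
qed

lemma openin_scale_diff:
  assumes "openin T W" "u \<in> E" shows "openin T {f \<in> E. fscale c (f - u) \<in> W}"
  using openin_continuous_map_preimage[OF continuous_map_scale_diff[OF assms(2)] assms(1), of c]
  by (simp add: lcs_topspace)

text \<open>Boundedness on one neighbourhood of 0 suffices: translates of its small multiples are
  neighbourhoods of any given point on which the seminorm varies little.\<close>

lemma cont_seminormI:
  assumes p: "seminorm_on E p" and W: "openin T W" "0 \<in> W" "\<And>f. f \<in> W \<Longrightarrow> p f \<le> 1"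
  shows "cont_seminorm E T p"
proof -
  have "openin T {f \<in> E. p f \<in> S}" if S: "open S" for S
  proof (subst openin_subopen, safe)
    fix f assume f: "f \<in> E" "p f \<in> S"
    then obtain e where e: "e > 0" "ball (p f) e \<subseteq> S" using S by (meson openE)
    let ?U = "{g \<in> E. fscale (of_real (2 / e)) (g - f) \<in> W}"
    have "p g \<in> S" if g: "g \<in> E" "fscale (of_real (2 / e)) (g - f) \<in> W" for g
    proof -
      have gf: "g - f \<in> E" using f g by (intro subspace_diff lcs_subspace)
      have "p (fscale (of_real (2 / e)) (g - f)) \<le> 1" by (rule W(3)[OF g(2)])
      then have "2 / e * p (g - f) \<le> 1"
        unfolding seminorm_scale[OF lcs_subspace p gf] norm_of_real using e by simp
      then have "p (g - f) < e" using e by (simp add: field_simps)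
      moreover have "\<bar>p f - p g\<bar> \<le> p (g - f)"
        using seminorm_triangle_ge[OF lcs_subspace p f(1) g(1)] seminorm_triangle_ge[OF lcs_subspace p g(1) f(1)]
          seminorm_commute[OF lcs_subspace p f(1) g(1)] by linarith
      ultimately show ?thesis using e(2) by (auto simp: dist_real_def subset_iff)
    qed
    then show "\<exists>U. openin T U \<and> f \<in> U \<and> U \<subseteq> {f \<in> E. p f \<in> S}"
      using f W openin_scale_diff[OF W(1) f(1)] by (intro exI[of _ ?U]) auto
  qed
  then show ?thesis using p by (auto simp: cont_seminorm_iff continuous_map_def lcs_topspace)
qed

lemma cont_seminorm_seminorm: "cont_seminorm E T p \<Longrightarrow> seminorm_on E p"
  by (simp add: cont_seminorm_iff)

lemma openin_seminorm_ball:
  assumes p: "cont_seminorm E T p" and u: "u \<in> E"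
  shows "openin T {f \<in> E. p (f - u) < r}"
proof -
  have "openin T {f \<in> E. p f < r}"
    using p openin_continuous_map_preimage[of T euclideanreal p "{..<r}"]
    by (auto simp: cont_seminorm_iff lcs_topspace)
  then show ?thesis
    using openin_scale_diff[of "{f \<in> E. p f < r}" u 1] u
    by (simp add: subspace_diff[OF lcs_subspace] cong: conj_cong)
qed

lemma cont_seminorm_dominated:
  assumes "seminorm_on E q" "cont_seminorm E T p" "\<And>f. f \<in> E \<Longrightarrow> q f \<le> C * p f"
  shows "cont_seminorm E T q"
proof (rule cont_seminormI[OF assms(1)])
  note p = cont_seminorm_seminorm[OF assms(2)]
  \<comment> \<open>The radius satisfies \<open>\<bar>C\<bar> * ?r \<le> 1\<close> whatever the sign
    of \<open>C\<close>, and is positive also for \<open>C = 0\<close>.\<close>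
  let ?r = "1 / (\<bar>C\<bar> + 1)"
  show "openin T {f \<in> E. p (f - 0) < ?r}"
    by (rule openin_seminorm_ball[OF assms(2) subspace_0[OF lcs_subspace]])
  show "0 \<in> {f \<in> E. p (f - 0) < ?r}"
    by (simp add: subspace_0[OF lcs_subspace] seminorm_0[OF lcs_subspace p] add_nonneg_pos)
  fix f assume f: "f \<in> {f \<in> E. p (f - 0) < ?r}"
  then have "q f \<le> C * p f" "p f \<ge> 0" "p f < ?r" using assms(3) seminorm_ge_0[OF lcs_subspace p] by auto
  then have "q f \<le> \<bar>C\<bar> * p f" by (smt (verit) mult_right_mono)
  also have "\<dots> \<le> \<bar>C\<bar> * ?r" using \<open>p f < ?r\<close> by (intro mult_left_mono) auto
  also have "\<dots> \<le> 1" by (simp add: divide_simps)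
  finally show "q f \<le> 1" .
qed

lemma cont_seminorm_add:
  assumes p: "cont_seminorm E T p" and q: "cont_seminorm E T q"
  shows "cont_seminorm E T (\<lambda>f. p f + q f)"
  using assms unfolding cont_seminorm_iff
  by (auto intro: seminorm_on_add[OF lcs_subspace] continuous_map_add)

lemma cont_seminorm_scale:
  "cont_seminorm E T p \<Longrightarrow> c \<ge> 0 \<Longrightarrow> cont_seminorm E T (\<lambda>f. c * p f)"
  by (rule cont_seminorm_dominated[of _ p c])
    (auto simp: cont_seminorm_seminorm seminorm_on_scale[OF lcs_subspace])

lemma cont_seminorm_zero: "cont_seminorm E T (\<lambda>f. 0)"
  by (rule cont_seminormI[where W = E])
    (use openin_topspace[of T] in \<open>auto simp: lcs_topspace seminorm_on_const_0 lcs_subspace subspace_0\<close>)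

lemma cont_seminorm_sum:
  "(\<And>i. i \<in> A \<Longrightarrow> cont_seminorm E T (p i)) \<Longrightarrow> cont_seminorm E T (\<lambda>f. \<Sum>i\<in>A. p i f)"
  by (induction A rule: infinite_finite_induct) (simp_all add: cont_seminorm_add cont_seminorm_zero)

text \<open>The seminorm is the Minkowski gauge of an open absolutely convex neighbourhood inside
  \<open>U\<close>.\<close>

lemma ex_cont_seminorm_subset:
  assumes U: "openin T U" "0 \<in> U"
  shows "\<exists>p. cont_seminorm E T p \<and> {f \<in> E. p f < 1} \<subseteq> U"
proof -
  obtain V where V: "openin T V" "0 \<in> V" "V \<subseteq> U" "abs_convex V"
    using lcs U unfolding lcs_def fun_ops by blast
  have VE: "V \<subseteq> E" using openin_subset[OF V(1)] by (simp add: lcs_topspace)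
  define S where "S f = {t. t > 0 \<and> fscale (of_real (inverse t)) f \<in> V}" for f
  define p where "p f = Inf (S f)" for f
  have bdd: "bdd_below (S f)" for f by (rule bdd_belowI[of _ 0]) (auto simp: S_def)
  have ne: "S f \<noteq> {}" if f: "f \<in> E" for f
  proof -
    have "openin euclidean {c \<in> topspace euclidean. fscale c f \<in> V}"
      using openin_continuous_map_preimage[OF continuous_map_scale_left[OF f] V(1)] .
    then have "open {c. fscale c f \<in> V}" by simp
    then obtain e where e: "e > 0" "ball 0 e \<subseteq> {c. fscale c f \<in> V}"
      using V(2) openE[of "{c. fscale c f \<in> V}" 0] by auto
    have "of_real (inverse (2 / e)) \<in> (ball 0 e :: 'k set)" using e by (simp add: norm_divide)
    from subsetD[OF e(2) this] have "2 / e \<in> S f" using e(1) unfolding S_def mem_Collect_eq by simp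
    then show ?thesis by blast
  qed
  have up: "s \<in> S f" if "t \<in> S f" "t \<le> s" for s t f
  proof -
    have t: "t > 0" "s > 0" using that by (auto simp: S_def)
    have "fscale (of_real (t / s)) (fscale (of_real (inverse t)) f) \<in> V"
    proof (rule abs_convex_scale[OF V(4)])
      show "fscale (of_real (inverse t)) f \<in> V" using that by (simp add: S_def)
      have "norm (of_real (t / s) :: 'k) = \<bar>t / s\<bar>" by (rule norm_of_real)
      then show "norm (of_real (t / s) :: 'k) \<le> 1" using t that(2) by simp
    qed
    then have "fscale (of_real (t / s * inverse t)) f \<in> V" unfolding fscale_fscale of_real_mult .
    moreover have "t / s * inverse t = inverse s" using t by (simp add: field_simps)
    ultimately show ?thesis using t(2) unfolding S_def mem_Collect_eq by (simp only:)
  qed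
  have lt: "\<exists>t\<in>S f. t < r" if "f \<in> E" "p f < r" for f r
    using that ne[OF that(1)] by (simp add: p_def cInf_less_iff[OF _ bdd])
  have le: "p f \<le> t" if "t \<in> S f" for t f unfolding p_def by (rule cInf_lower[OF that bdd])
  have p0: "p f \<ge> 0" if "f \<in> E" for f
    unfolding p_def using ne[OF that] by (intro cInf_greatest) (auto simp: S_def)
  have add: "p (f + g) \<le> p f + p g" if fg: "f \<in> E" "g \<in> E" for f g
  proof (rule field_le_epsilon)
    fix e :: real assume "e > 0"
    then obtain s t where s: "s \<in> S f" "s < p f + e / 2" and t: "t \<in> S g" "t < p g + e / 2"
      using lt[OF fg(1), of "p f + e / 2"] lt[OF fg(2), of "p g + e / 2"] by auto
    have st: "s > 0" "t > 0" using s t by (auto simp: S_def)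
    \<comment> \<open>The weights \<open>s / (s + t)\<close> and \<open>t / (s + t)\<close> write
      \<open>(f + g) / (s + t)\<close> as a convex combination of \<open>f / s\<close> and
      \<open>g / t\<close>, both in \<open>V\<close>.\<close>
    have "fscale (of_real (s / (s + t))) (fscale (of_real (inverse s)) f) +
        fscale (of_real (t / (s + t))) (fscale (of_real (inverse t)) g) \<in> V"
      using s t st
      by (intro abs_convex_add[OF V(4)]) (auto simp: S_def norm_divide add_divide_distrib[symmetric] simp flip: of_real_add)
    also have "fscale (of_real (s / (s + t))) (fscale (of_real (inverse s)) f) +
        fscale (of_real (t / (s + t))) (fscale (of_real (inverse t)) g) = fscale (of_real (inverse (s + t))) (f + g)"
    proof -
      have "s / (s + t) * inverse s = inverse (s + t)" "t / (s + t) * inverse t = inverse (s + t)" using st by (simp_all add: divide_simps)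
      then show ?thesis unfolding fscale_fscale of_real_mult[symmetric] fscale_add by simp
    qed
    finally have "s + t \<in> S (f + g)" using st by (simp add: S_def)
    from le[OF this] show "p (f + g) \<le> p f + p g + e" using s t by simp
  qed
  have sc: "p (fscale c f) \<le> norm c * p f" if f: "f \<in> E" and c: "c \<noteq> 0" for c f
  proof -
    have "p (fscale c f) / norm c \<le> t" if t: "t \<in> S f" for t
    proof -
      have "fscale (c / of_real (norm c)) (fscale (of_real (inverse t)) f) \<in> V"
        using t c by (intro abs_convex_scale[OF V(4), of "fscale (of_real (inverse t)) f"])
          (simp_all add: S_def norm_divide del: fscale_fscale)
      then have "norm c * t \<in> S (fscale c f)" using t c by (simp add: S_def field_simps)
      from le[OF this] show ?thesis using c by (simp add: field_simps)
    qed
    then have "p (fscale c f) / norm c \<le> p f" unfolding p_def[of f] by (rule cInf_greatest[OF ne[OF f]])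
    then show ?thesis using c by (simp add: field_simps)
  qed
  have "p (fscale c f) = norm c * p f" if f: "f \<in> E" for c f
  proof (cases "c = 0")
    case True
    have "p 0 \<le> e" if "e > 0" for e using that V(2) by (intro le) (simp add: S_def)
    then have "p 0 \<le> 0" by (rule field_le_epsilon[of "p 0" 0, simplified])
    then show ?thesis using True p0[of 0] subspace_0[OF lcs_subspace] by simp
  next
    case False
    have "p (fscale (inverse c) (fscale c f)) \<le> norm (inverse c) * p (fscale c f)"
      using False f by (intro sc subspace_scale[OF lcs_subspace]) auto
    then have "norm c * p f \<le> p (fscale c f)" using False by (simp add: norm_inverse norm_divide field_simps)
    then show ?thesis using sc[OF f False] by simp
  qed
  then have sn: "seminorm_on E p" using add by (simp add: seminorm_on_def)
  have "cont_seminorm E T p"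
  proof (rule cont_seminormI[OF sn V(1,2)])
    fix f assume "f \<in> V" then show "p f \<le> 1" by (intro le) (simp add: S_def)
  qed
  moreover have "f \<in> U" if "f \<in> E" "p f < 1" for f
  proof -
    obtain t where "t \<in> S f" "t < 1" using lt[OF \<open>f \<in> E\<close> \<open>p f < 1\<close>] by blast
    then have "1 \<in> S f" using up by simp
    then show ?thesis using V(3) by (auto simp: S_def)
  qed
  ultimately show ?thesis by blast
qed

text \<open>From here on the topology is handled mainly through its continuous seminorms; radius 1
  loses nothing since they may be scaled.\<close>

lemma openin_iff_cont_seminorm:
  "openin T U \<longleftrightarrow> U \<subseteq> E \<and> (\<forall>u\<in>U. \<exists>p. cont_seminorm E T p \<and> {f \<in> E. p (f - u) < 1} \<subseteq> U)" (is "?L \<longleftrightarrow> ?R")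
proof
  assume U: ?L
  then have UE: "U \<subseteq> E" using openin_subset[OF U] by (simp add: lcs_topspace)
  have "\<exists>p. cont_seminorm E T p \<and> {f \<in> E. p (f - u) < 1} \<subseteq> U" if u: "u \<in> U" for u
  proof -
    have uE: "- u \<in> E" "u \<in> E" using u UE subspace_minus[OF lcs_subspace] by auto
    have "openin T {f \<in> E. fscale 1 (f - (- u)) \<in> U}" by (rule openin_scale_diff[OF U uE(1)])
    moreover have "0 \<in> {f \<in> E. fscale 1 (f - (- u)) \<in> U}" using u subspace_0[OF lcs_subspace] by simp
    ultimately obtain p where p: "cont_seminorm E T p" "{f \<in> E. p f < 1} \<subseteq> {f \<in> E. fscale 1 (f - (- u)) \<in> U}"
      using ex_cont_seminorm_subset by blast
    have "f \<in> U" if "f \<in> E" "p (f - u) < 1" for f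
    proof -
      have "f - u \<in> {f \<in> E. p f < 1}" using that uE by (simp add: subspace_diff[OF lcs_subspace])
      then show ?thesis using p(2) by auto
    qed
    then show ?thesis using p(1) by blast
  qed
  then show ?R using UE by blast
next
  assume R: ?R
  show ?L
  proof (subst openin_subopen, safe)
    fix u assume u: "u \<in> U"
    then obtain p where p: "cont_seminorm E T p" "{f \<in> E. p (f - u) < 1} \<subseteq> U" using R by blast
    have uE: "u \<in> E" using u R by auto
    then show "\<exists>V. openin T V \<and> u \<in> V \<and> V \<subseteq> U"
      using p openin_seminorm_ball[OF p(1) uE, of 1] seminorm_0[OF lcs_subspace cont_seminorm_seminorm[OF p(1)]]
      by (intro exI[of _ "{f \<in> E. p (f - u) < 1}"]) auto
  qed
qed

lemma closure_of_iff_cont_seminorm: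
  assumes "A \<subseteq> E"
  shows "T closure_of A = {f \<in> E. \<forall>p. cont_seminorm E T p \<longrightarrow> (\<exists>g\<in>A. p (f - g) < 1)}" (is "_ = ?R")
proof (intro equalityI subsetI)
  fix f assume f: "f \<in> T closure_of A"
  then have fE: "f \<in> E" by (metis in_closure_of lcs_topspace)
  have "\<exists>g\<in>A. p (f - g) < 1" if p: "cont_seminorm E T p" for p
  proof -
    note ps = cont_seminorm_seminorm[OF p]
    have "f \<in> {g \<in> E. p (g - f) < 1}" using fE seminorm_0[OF lcs_subspace ps] by simp
    moreover have "openin T {g \<in> E. p (g - f) < 1}" by (rule openin_seminorm_ball[OF p fE])
    ultimately obtain g where "g \<in> A" "g \<in> {g \<in> E. p (g - f) < 1}"
      using f unfolding in_closure_of by meson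
    then have "g \<in> A" "g \<in> E" "p (g - f) < 1" by auto
    then show ?thesis using seminorm_commute[OF lcs_subspace ps fE] by metis
  qed
  then show "f \<in> ?R" using fE by blast
next
  fix f assume f: "f \<in> ?R"
  show "f \<in> T closure_of A"
    unfolding in_closure_of
  proof (intro conjI allI impI)
    show "f \<in> topspace T" using f by (simp add: lcs_topspace)
    fix U assume "f \<in> U \<and> openin T U"
    then obtain p where p: "cont_seminorm E T p" "{g \<in> E. p (g - f) < 1} \<subseteq> U"
      unfolding openin_iff_cont_seminorm by blast
    then obtain g where "g \<in> A" "p (f - g) < 1" using f by blast
    then show "\<exists>y. y \<in> A \<and> y \<in> U"
    proof -
      have "g \<in> E" using \<open>g \<in> A\<close> assms by auto
      then have "p (g - f) < 1"
        using \<open>p (f - g) < 1\<close> f seminorm_commute[OF lcs_subspace cont_seminorm_seminorm[OF p(1)], of f g] by auto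
      then show ?thesis using \<open>g \<in> A\<close> \<open>g \<in> E\<close> p(2) by blast
    qed
  qed
qed

lemma lcs_bounded_iff:
  "lcs_bounded T B \<longleftrightarrow> B \<subseteq> E \<and> (\<forall>p. cont_seminorm E T p \<longrightarrow> (\<exists>C. \<forall>f\<in>B. p f \<le> C))"
proof (intro iffI conjI allI impI)
  assume B: "lcs_bounded T B"
  then show BE: "B \<subseteq> E" by (simp add: lcs_bounded_def lcs_topspace)
  fix p assume p: "cont_seminorm E T p"
  note ps = cont_seminorm_seminorm[OF p]
  have "openin T {f \<in> E. p (f - 0) < 1}" "0 \<in> {f \<in> E. p (f - 0) < 1}"
    using openin_seminorm_ball[OF p subspace_0[OF lcs_subspace], of 1] subspace_0[OF lcs_subspace]
      seminorm_0[OF lcs_subspace ps] by auto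
  then obtain t where t: "t > 0" "\<And>c. norm c \<le> t \<Longrightarrow> fscale c ` B \<subseteq> {f \<in> E. p (f - 0) < 1}"
    using B unfolding lcs_bounded_def fun_ops by blast
  have "p f \<le> 1 / t" if f: "f \<in> B" for f
  proof -
    have "p (fscale (of_real t) f) < 1" using t(2)[of "of_real t"] t(1) f by auto
    then show ?thesis using t(1) f BE by (simp add: seminorm_scale[OF lcs_subspace ps] subset_iff field_simps)
  qed
  then show "\<exists>C. \<forall>f\<in>B. p f \<le> C" by blast
next
  assume R: "B \<subseteq> E \<and> (\<forall>p. cont_seminorm E T p \<longrightarrow> (\<exists>C. \<forall>f\<in>B. p f \<le> C))"
  show "lcs_bounded T B"
    unfolding lcs_bounded_def fun_ops
  proof (intro conjI allI impI)
    show "B \<subseteq> topspace T" using R by (simp add: lcs_topspace)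
    fix U assume U: "openin T U \<and> 0 \<in> U"
    then obtain p where p: "cont_seminorm E T p" "{f \<in> E. p f < 1} \<subseteq> U" using ex_cont_seminorm_subset by blast
    note ps = cont_seminorm_seminorm[OF p(1)]
    obtain C where C: "\<And>f. f \<in> B \<Longrightarrow> p f \<le> C" using R p by blast
    let ?t = "1 / (\<bar>C\<bar> + 2)"
    have "fscale c f \<in> U" if c: "norm c \<le> ?t" and f: "f \<in> B" for c f
    proof -
      have fE: "f \<in> E" using R f by auto
      have "p (fscale c f) = norm c * p f" by (rule seminorm_scale[OF lcs_subspace ps fE])
      also have "\<dots> \<le> ?t * \<bar>C\<bar>"
        using c C[OF f] seminorm_ge_0[OF lcs_subspace ps fE] by (intro mult_mono) auto
      also have "\<dots> < 1" by (simp add: divide_simps)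
      finally show ?thesis using p(2) subspace_scale[OF lcs_subspace fE] by blast
    qed
    then show "\<exists>t>0. \<forall>c. norm c \<le> t \<longrightarrow> fscale c ` B \<subseteq> U"
      by (intro exI[of _ ?t]) (auto simp: add_nonneg_pos)
  qed
qed

text \<open>For a continuous \<open>v\<close> the dominating seminorm is \<open>norm (v f)\<close>
  itself.\<close>

lemma dual_iff:
  "v \<in> dual E T \<longleftrightarrow> linear_on E v \<and> (\<forall>f. f \<notin> E \<longrightarrow> v f = 0) \<and> (\<exists>p. cont_seminorm E T p \<and> (\<forall>f\<in>E. norm (v f) \<le> p f))"
  (is "_ \<longleftrightarrow> ?R")
proof
  assume v: "v \<in> dual E T"
  then have vl: "\<And>f g a b. f \<in> E \<Longrightarrow> g \<in> E \<Longrightarrow> v (fscale a f + fscale b g) = a * v f + b * v g"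
    and c: "continuous_map T euclidean v" and 0: "\<forall>f. f \<notin> E \<longrightarrow> v f = 0"
    by (auto simp: dual_def fun_ops)
  have "v (f + g) = v f + v g" if "f \<in> E" "g \<in> E" for f g using vl[OF that, of 1 1] by simp
  moreover have "v (fscale a f) = a * v f" if "f \<in> E" for a f using vl[OF that that, of a 0] by simp
  ultimately have lin: "linear_on E v" by (simp add: linear_on_def)
  have "cont_seminorm E T (\<lambda>f. norm (v f))"
    using c seminorm_on_linear[OF lcs_subspace lin] by (auto simp: cont_seminorm_iff intro!: continuous_map_norm)
  then show ?R using lin 0 by blast
next
  assume R: ?R
  then obtain p where p: "cont_seminorm E T p" "\<And>f. f \<in> E \<Longrightarrow> norm (v f) \<le> p f" by blast
  have lin: "linear_on E v" using R by blast
  have "openin T {f \<in> E. v f \<in> S}" if S: "open S" for S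
    unfolding openin_iff_cont_seminorm
  proof safe
    fix f assume f: "f \<in> E" "v f \<in> S"
    then obtain e where e: "e > 0" "ball (v f) e \<subseteq> S" using S by (meson openE)
    have "v g \<in> S" if g: "g \<in> E" "1 / e * p (g - f) < 1" for g
    proof -
      have "norm (v g - v f) \<le> p (g - f)"
        using p(2)[of "g - f"] f g by (simp add: linear_on_diff[OF lcs_subspace lin] subspace_diff[OF lcs_subspace])
      also have "\<dots> < e" using g(2) e(1) by (simp add: field_simps)
      finally show ?thesis using e(2) by (auto simp: dist_norm norm_minus_commute subset_iff)
    qed
    then show "\<exists>p. cont_seminorm E T p \<and> {g \<in> E. p (g - f) < 1} \<subseteq> {f \<in> E. v f \<in> S}"
      using cont_seminorm_scale[OF p(1), of "1 / e"] e(1) by (intro exI[of _ "\<lambda>g. 1 / e * p g"]) auto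
  qed
  then have "continuous_map T euclidean v" by (simp add: continuous_map_def lcs_topspace)
  moreover have "v (fscale a f + fscale b g) = a * v f + b * v g" if "f \<in> E" "g \<in> E" for a b f g
    using that by (simp add: linear_on_add[OF lin] linear_on_scale[OF lin] subspace_scale[OF lcs_subspace])
  ultimately show "v \<in> dual E T" using R by (auto simp: dual_def fun_ops)
qed

end

section \<open>Barrelled and Frechet families of seminorms\<close>

text \<open>Axiomatizes the set of continuous seminorms of a locally convex topology, so that the
  closed graph theorem also covers normed spaces of functionals on which no topology is
  constructed.\<close>

definition seminorm_family :: "('d \<Rightarrow> 'k::real_normed_field) set \<Rightarrow> ((('d \<Rightarrow> 'k) \<Rightarrow> real) \<Rightarrow> bool) \<Rightarrow> bool" where
  "seminorm_family E P \<longleftrightarrow> fun_subspace E \<and> (\<forall>p. P p \<longrightarrow> seminorm_on E p) \<and> P (\<lambda>f. 0) \<and>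
     (\<forall>p q. P p \<longrightarrow> P q \<longrightarrow> P (\<lambda>f. p f + q f)) \<and>
     (\<forall>p q C. P p \<longrightarrow> seminorm_on E q \<longrightarrow> (\<forall>f\<in>E. q f \<le> C * p f) \<longrightarrow> P q)"

text \<open>The principle of uniform boundedness; reflexive spaces enter in this form.\<close>

definition sup_closed :: "('d \<Rightarrow> 'k::real_normed_field) set \<Rightarrow> ((('d \<Rightarrow> 'k) \<Rightarrow> real) \<Rightarrow> bool) \<Rightarrow> bool" where
  "sup_closed E P \<longleftrightarrow> (\<forall>S. (\<forall>t\<in>S. P t) \<longrightarrow> (\<forall>h\<in>E. \<exists>C. \<forall>t\<in>S. t h \<le> C) \<longrightarrow>
     (\<exists>s. P s \<and> (\<forall>t\<in>S. \<forall>h\<in>E. t h \<le> s h)))"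

text \<open>The closure of \<open>A\<close> in the topology of the family contains a ball.\<close>

definition barrelled_family :: "('d \<Rightarrow> 'k::real_normed_field) set \<Rightarrow> ((('d \<Rightarrow> 'k) \<Rightarrow> real) \<Rightarrow> bool) \<Rightarrow> bool" where
  "barrelled_family E P \<longleftrightarrow> seminorm_family E P \<and>
     (\<forall>A. A \<subseteq> E \<longrightarrow> abs_convex A \<longrightarrow> absorbing E A \<longrightarrow>
        (\<exists>s. P s \<and> (\<forall>h\<in>E. s h \<le> 1 \<longrightarrow> (\<forall>t. P t \<longrightarrow> (\<exists>z\<in>A. t (h - z) < 1)))))"

text \<open>Completeness concerns sequences whose n-th increment is at most
  \<open>(1 / 2) ^ n\<close> in the n-th seminorm, the shape produced by successive
  approximation.\<close>

definition frechet_family ::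
  "('d \<Rightarrow> 'k::real_normed_field) set \<Rightarrow> ((('d \<Rightarrow> 'k) \<Rightarrow> real) \<Rightarrow> bool) \<Rightarrow> (nat \<Rightarrow> ('d \<Rightarrow> 'k) \<Rightarrow> real) \<Rightarrow> bool" where
  "frechet_family E P p \<longleftrightarrow> seminorm_family E P \<and> (\<forall>n. P (p n)) \<and> (\<forall>n. \<forall>f\<in>E. p n f \<le> p (Suc n) f) \<and>
     (\<forall>t. P t \<longrightarrow> (\<exists>n. \<forall>f\<in>E. t f \<le> p n f)) \<and>
     (\<forall>s. (\<forall>n. s n \<in> E) \<longrightarrow> (\<forall>n. p n (s (Suc n) - s n) \<le> (1 / 2) ^ n) \<longrightarrow>
        (\<exists>f\<in>E. \<forall>n. (\<lambda>k. p n (s k - f)) \<longlonglongrightarrow> 0))"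

lemma seminorm_familyD:
  assumes "seminorm_family E P"
  shows "fun_subspace E" "P p \<Longrightarrow> seminorm_on E p" "P (\<lambda>f. 0)" "P p \<Longrightarrow> P q \<Longrightarrow> P (\<lambda>f. p f + q f)"
    "P p \<Longrightarrow> seminorm_on E q \<Longrightarrow> (\<And>f. f \<in> E \<Longrightarrow> q f \<le> C * p f) \<Longrightarrow> P q"
proof -
  note d = assms[unfolded seminorm_family_def]
  show "fun_subspace E" by (rule d[THEN conjunct1])
  show "seminorm_on E p" if "P p" by (rule d[THEN conjunct2, THEN conjunct1, rule_format, OF that])
  show "P (\<lambda>f. 0)" by (rule d[THEN conjunct2, THEN conjunct2, THEN conjunct1])
  show "P (\<lambda>f. p f + q f)" if "P p" "P q"
    by (rule d[THEN conjunct2, THEN conjunct2, THEN conjunct2, THEN conjunct1, rule_format, OF that])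
  show "P q" if "P p" "seminorm_on E q" "\<And>f. f \<in> E \<Longrightarrow> q f \<le> C * p f"
    using d[THEN conjunct2, THEN conjunct2, THEN conjunct2, THEN conjunct2, rule_format, of p q C] that by simp
qed

lemma seminorm_family_scale:
  assumes "seminorm_family E P" "P p" "c \<ge> 0" shows "P (\<lambda>f. c * p f)"
  using seminorm_familyD(5)[OF assms(1), OF assms(2), of "\<lambda>f. c * p f" c]
    seminorm_on_scale[OF seminorm_familyD(1)[OF assms(1)] seminorm_familyD(2)[OF assms(1), OF assms(2)] assms(3)]
  by simp

lemma seminorm_family_lcs:
  assumes "lcs E T" shows "seminorm_family E (cont_seminorm E T)"
  unfolding seminorm_family_def
  using lcs_subspace[OF assms] cont_seminorm_seminorm[OF assms] cont_seminorm_zero[OF assms]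
    cont_seminorm_add[OF assms] cont_seminorm_dominated[OF assms]
  by blast

text \<open>The closure of an absolutely convex absorbing set is a barrel.\<close>

lemma barrelled_family_barrelled:
  assumes "barrelled E T" shows "barrelled_family E (cont_seminorm E T)"
proof -
  have lcs: "lcs E T" using assms by (simp add: barrelled_def)
  note sub = lcs_subspace[OF lcs]
  show ?thesis
    unfolding barrelled_family_def
  proof (intro conjI allI impI seminorm_family_lcs[OF lcs])
    fix A assume A: "A \<subseteq> E" "abs_convex A" "absorbing E A"
    define B where "B = T closure_of A"
    have B: "B = {f \<in> E. \<forall>p. cont_seminorm E T p \<longrightarrow> (\<exists>g\<in>A. p (f - g) < 1)}"
      unfolding B_def by (rule closure_of_iff_cont_seminorm[OF lcs A(1)])
    have "A \<subseteq> B" unfolding B_def by (rule closure_of_subset) (simp add: A lcs_topspace[OF lcs])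
    have "absorbing E B" using A(3) \<open>A \<subseteq> B\<close> unfolding absorbing_def by blast
    moreover have "abs_convex B"
      unfolding abs_convex_def fun_ops
    proof (intro ballI allI impI)
      fix f g and a b :: 'b assume fg: "f \<in> B" "g \<in> B" and ab: "norm a + norm b \<le> 1"
      have fgE: "f \<in> E" "g \<in> E" using fg by (auto simp: B)
      have "\<exists>h\<in>A. p (fscale a f + fscale b g - h) < 1" if p: "cont_seminorm E T p" for p
      proof -
        note ps = cont_seminorm_seminorm[OF lcs p]
        obtain z w where zw: "z \<in> A" "p (f - z) < 1" "w \<in> A" "p (g - w) < 1" using fg p unfolding B by blast
        have zwE: "f - z \<in> E" "g - w \<in> E" using zw A(1) fgE by (auto intro: subspace_diff[OF sub])
        have "p (fscale a f + fscale b g - (fscale a z + fscale b w)) = p (fscale a (f - z) + fscale b (g - w))"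
          by (simp add: fscale_diff algebra_simps)
        also have "\<dots> \<le> norm a * p (f - z) + norm b * p (g - w)"
          using seminorm_add[OF sub ps, of "fscale a (f - z)" "fscale b (g - w)"] zwE
          by (simp add: seminorm_scale[OF sub ps] subspace_scale[OF sub])
        \<comment> \<open>Passing to the maximum keeps the strict inequality when
          \<open>norm a + norm b \<le> 1\<close>.\<close>
        also have "\<dots> \<le> norm a * max (p (f - z)) (p (g - w)) + norm b * max (p (f - z)) (p (g - w))"
          by (intro add_mono mult_left_mono) auto
        also have "\<dots> = (norm a + norm b) * max (p (f - z)) (p (g - w))" by (simp add: distrib_right)
        also have "\<dots> \<le> 1 * max (p (f - z)) (p (g - w))"
          using ab seminorm_ge_0[OF sub ps zwE(1)] by (intro mult_right_mono) auto
        also have "\<dots> < 1" using zw by simp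
        finally show ?thesis using abs_convex_add[OF A(2) zw(1,3) ab] by blast
      qed
      then show "fscale a f + fscale b g \<in> B"
        using fgE by (auto simp: B intro!: subspace_add[OF sub] subspace_scale[OF sub])
    qed
    moreover have "closedin T B" by (simp add: B_def)
    moreover have "B \<subseteq> E" unfolding B by blast
    ultimately obtain U where U: "openin T U" "0 \<in> U" "U \<subseteq> B"
      using assms unfolding barrelled_def fun_ops by blast
    then obtain p where p: "cont_seminorm E T p" "{f \<in> E. p f < 1} \<subseteq> U"
      using ex_cont_seminorm_subset[OF lcs] by blast
    \<comment> \<open>Doubling the seminorm places its closed unit ball inside the open unit ball of
      \<open>p\<close>.\<close>
    have "h \<in> B" if "h \<in> E" "2 * p h \<le> 1" for h using that p(2) U(3) by auto
    then show "\<exists>s. cont_seminorm E T s \<and> (\<forall>h\<in>E. s h \<le> 1 \<longrightarrow> (\<forall>t. cont_seminorm E T t \<longrightarrow> (\<exists>z\<in>A. t (h - z) < 1)))"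
      using cont_seminorm_scale[OF lcs p(1), of 2] by (intro exI[of _ "\<lambda>f. 2 * p f"]) (auto simp: B)
  qed
qed

lemma seminorm_ball_abs_convex:
  assumes E: "fun_subspace E" and p: "\<And>t. t \<in> S \<Longrightarrow> seminorm_on E t"
  shows "abs_convex {h \<in> E. \<forall>t\<in>S. t h \<le> c}"
  unfolding abs_convex_def fun_ops
proof (intro ballI allI impI)
  fix f g and a b :: 'b
  assume fg: "f \<in> {h \<in> E. \<forall>t\<in>S. t h \<le> c}" "g \<in> {h \<in> E. \<forall>t\<in>S. t h \<le> c}" and ab: "norm a + norm b \<le> 1"
  have "t (fscale a f + fscale b g) \<le> c" if t: "t \<in> S" for t
  proof -
    note ts = p[OF t]
    have fg': "f \<in> E" "g \<in> E" "t f \<le> c" "t g \<le> c" using fg t by auto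
    have "t (fscale a f + fscale b g) \<le> norm a * t f + norm b * t g"
      using seminorm_add[OF E ts, of "fscale a f" "fscale b g"] fg'
      by (simp add: seminorm_scale[OF E ts] subspace_scale[OF E])
    also have "\<dots> \<le> norm a * c + norm b * c" using fg' by (intro add_mono mult_left_mono) auto
    also have "\<dots> = (norm a + norm b) * c" by (simp add: distrib_right)
    also have "\<dots> \<le> 1 * c" using ab fg' seminorm_ge_0[OF E ts fg'(1)] by (intro mult_right_mono) auto
    finally show ?thesis by simp
  qed
  then show "fscale a f + fscale b g \<in> {h \<in> E. \<forall>t\<in>S. t h \<le> c}"
    using fg by (auto intro!: subspace_add[OF E] subspace_scale[OF E])
qed

lemma seminorm_ball_absorbing:
  assumes E: "fun_subspace E" and p: "\<And>t. t \<in> S \<Longrightarrow> seminorm_on E t"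
    and bd: "\<And>h. h \<in> E \<Longrightarrow> \<exists>C. \<forall>t\<in>S. t h \<le> C" and c: "c > 0"
  shows "absorbing E {h \<in> E. \<forall>t\<in>S. t h \<le> c}"
  unfolding absorbing_def
proof
  fix f assume f: "f \<in> E"
  obtain C where C: "\<And>t. t \<in> S \<Longrightarrow> t f \<le> C" using bd[OF f] by blast
  let ?r = "c / (\<bar>C\<bar> + 1)"
  have "t (fscale a f) \<le> c" if a: "norm a \<le> ?r" and t: "t \<in> S" for a t
  proof -
    have "t (fscale a f) = norm a * t f" by (rule seminorm_scale[OF E p[OF t] f])
    also have "\<dots> \<le> ?r * (\<bar>C\<bar> + 1)"
      using a C[OF t] seminorm_ge_0[OF E p[OF t] f] c by (intro mult_mono) auto
    finally show ?thesis by simp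
  qed
  moreover have "?r > 0" using c by (simp add: add_nonneg_pos)
  ultimately show "\<exists>t>0. \<forall>c'. norm c' \<le> t \<longrightarrow> fscale c' f \<in> {h \<in> E. \<forall>t\<in>S. t h \<le> c}"
    using subspace_scale[OF E f] by (intro exI[of _ ?r]) auto
qed

text \<open>The common unit ball of \<open>S\<close> is absolutely convex and absorbing; replacing
  it by its closure costs the factor 2.\<close>

lemma barrelled_family_sup_closed:
  assumes "barrelled_family E P" shows "sup_closed E P"
  unfolding sup_closed_def
proof (intro allI impI)
  fix S assume S: "\<forall>t\<in>S. P t" and bd: "\<forall>h\<in>E. \<exists>C. \<forall>t\<in>S. t h \<le> C"
  have fam: "seminorm_family E P" using assms by (simp add: barrelled_family_def)
  note E = seminorm_familyD(1)[OF fam] and sn = seminorm_familyD(2)[OF fam]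
  let ?A = "{h \<in> E. \<forall>t\<in>S. t h \<le> 1}"
  have "abs_convex ?A" using S by (intro seminorm_ball_abs_convex E sn) auto
  moreover have "absorbing E ?A" using S bd by (intro seminorm_ball_absorbing E sn) auto
  moreover have "?A \<subseteq> E" by auto
  ultimately obtain s where s: "P s" "\<And>h t. h \<in> E \<Longrightarrow> s h \<le> 1 \<Longrightarrow> P t \<Longrightarrow> \<exists>z\<in>?A. t (h - z) < 1"
    using assms unfolding barrelled_family_def by meson
  have "t h \<le> 2 * s h" if t: "t \<in> S" and h: "h \<in> E" for t h
  proof (rule seminorm_dominated[OF E sn[OF s(1)] sn[OF bspec[OF S t]] _ h])
    fix f assume f: "f \<in> E" "s f \<le> 1"
    obtain z where z: "z \<in> ?A" "t (f - z) < 1" using s(2)[OF f bspec[OF S t]] by blast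
    then show "t f \<le> 2"
      using seminorm_triangle_ge[OF E sn[OF bspec[OF S t]] f(1), of z] t by auto
  qed
  then show "\<exists>s. P s \<and> (\<forall>t\<in>S. \<forall>h\<in>E. t h \<le> s h)"
    using seminorm_family_scale[OF fam, OF s(1), of 2] by (intro exI[of _ "\<lambda>h. 2 * s h"]) auto
qed

lemma sup_closedD:
  assumes "sup_closed E P" "\<And>i. i \<in> I \<Longrightarrow> P (t i)" "\<And>h. h \<in> E \<Longrightarrow> \<exists>C. \<forall>i\<in>I. t i h \<le> C"
  shows "\<exists>s. P s \<and> (\<forall>i\<in>I. \<forall>h\<in>E. t i h \<le> s h)"
proof -
  have "(\<forall>u\<in>t ` I. P u) \<longrightarrow> (\<forall>h\<in>E. \<exists>C. \<forall>u\<in>t ` I. u h \<le> C) \<longrightarrow>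
      (\<exists>s. P s \<and> (\<forall>u\<in>t ` I. \<forall>h\<in>E. u h \<le> s h))"
    using assms(1) unfolding sup_closed_def by blast
  then show ?thesis using assms(2,3) by simp
qed

lemma frechet_familyD:
  assumes "frechet_family E P p"
  shows "seminorm_family E P" "P (p n)" "f \<in> E \<Longrightarrow> p n f \<le> p (Suc n) f"
    "P t \<Longrightarrow> \<exists>n. \<forall>f\<in>E. t f \<le> p n f"
    "(\<And>n. s n \<in> E) \<Longrightarrow> (\<And>n. p n (s (Suc n) - s n) \<le> (1 / 2) ^ n) \<Longrightarrow>
        \<exists>f\<in>E. \<forall>n. (\<lambda>k. p n (s k - f)) \<longlonglongrightarrow> 0"
proof -
  note d = assms[unfolded frechet_family_def]
  show "seminorm_family E P" "P (p n)" "f \<in> E \<Longrightarrow> p n f \<le> p (Suc n) f" "P t \<Longrightarrow> \<exists>n. \<forall>f\<in>E. t f \<le> p n f"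
    using d by simp_all
  show "\<exists>f\<in>E. \<forall>n. (\<lambda>k. p n (s k - f)) \<longlonglongrightarrow> 0"
    if "\<And>n. s n \<in> E" "\<And>n. p n (s (Suc n) - s n) \<le> (1 / 2) ^ n"
    using d[THEN conjunct2, THEN conjunct2, THEN conjunct2, THEN conjunct2, rule_format, of s] that by simp
qed

lemma frechet_family_mono:
  assumes "frechet_family E P p" "f \<in> E" "m \<le> n" shows "p m f \<le> p n f"
  by (rule lift_Suc_mono_le[of "\<lambda>n. p n f", OF _ assms(3)]) (rule frechet_familyD(3)[OF assms(1), OF assms(2)])

text \<open>Allows a given continuous seminorm to be dominated by the member with index 0.\<close>

lemma frechet_family_shift:
  assumes fr: "frechet_family E P p" shows "frechet_family E P (\<lambda>n. p (n + m))"
proof -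
  note D = frechet_familyD[OF fr] and mono = frechet_family_mono[OF fr]
  have sub: "fun_subspace E" by (rule seminorm_familyD(1)[OF D(1)])
  have "\<exists>n. \<forall>f\<in>E. t f \<le> p (n + m) f" if t: "P t" for t
  proof -
    obtain n where "\<forall>f\<in>E. t f \<le> p n f" using D(4)[OF t] by blast
    then have "\<forall>f\<in>E. t f \<le> p (n + m) f" using mono[of _ n "n + m"] by (meson le_add1 order_trans)
    then show ?thesis by blast
  qed
  moreover have "\<exists>f\<in>E. \<forall>n. (\<lambda>k. p (n + m) (s k - f)) \<longlonglongrightarrow> 0"
    if s: "\<And>n. s n \<in> E" and le: "\<And>n. p (n + m) (s (Suc n) - s n) \<le> (1 / 2) ^ n" for s
  proof -
    have "p n (s (Suc n) - s n) \<le> (1 / 2) ^ n" for n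
      using le[of n] mono[of "s (Suc n) - s n" n "n + m"] subspace_diff[OF sub s s] by (meson le_add1 order_trans)
    then show ?thesis using D(5)[of s] s by blast
  qed
  ultimately show ?thesis
    unfolding frechet_family_def using D(1,2,3) by auto
qed

context
  fixes E :: "('d \<Rightarrow> 'k::real_normed_field) set" and p s and c :: real
  assumes E: "fun_subspace E" and p: "\<And>n. seminorm_on E (p n)"
    and mono: "\<And>m n f. f \<in> E \<Longrightarrow> m \<le> n \<Longrightarrow> p m f \<le> p n f"
    and s: "\<And>n. s n \<in> E" and le: "\<And>n. p n (s (Suc n) - s n) \<le> c * (1 / 2) ^ n"
begin

lemma telescoping_bound: "p n (s n - s (n + k)) \<le> 2 * c * (1 / 2) ^ n"
proof -
  \<comment> \<open>The rest of the geometric tail is subtracted so that the induction on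
    \<open>k\<close> closes; later increments are measured in larger seminorms.\<close>
  have "p n (s n - s (n + k)) \<le> 2 * c * (1 / 2) ^ n - 2 * c * (1 / 2) ^ (n + k)"
  proof (induction k)
    case 0
    show ?case by (simp add: seminorm_0[OF E p])
  next
    case (Suc k)
    have "p n (s n - s (n + Suc k)) \<le> p n (s n - s (n + k)) + p n (s (n + k) - s (n + Suc k))"
      by (intro seminorm_triangle3[OF E p] s)
    also have "p n (s (n + k) - s (n + Suc k)) = p n (s (Suc (n + k)) - s (n + k))"
      by (simp add: seminorm_commute[OF E p s s])
    also have "\<dots> \<le> p (n + k) (s (Suc (n + k)) - s (n + k))" by (intro mono subspace_diff[OF E] s) simp
    also have "\<dots> \<le> c * (1 / 2) ^ (n + k)" by (rule le)
    also note Suc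
    finally show ?case by (simp add: algebra_simps)
  qed
  moreover have "c \<ge> 0" using seminorm_ge_0[OF E p subspace_diff[OF E s s], of 0 "Suc 0" 0] le[of 0] by simp
  ultimately show ?thesis by (smt (verit) mult_nonneg_nonneg zero_le_divide_1_iff zero_le_power)
qed

lemma telescoping_tail:
  assumes f: "f \<in> E" and lim: "(\<lambda>k. p n (s k - f)) \<longlonglongrightarrow> 0"
  shows "p n (s n - f) \<le> 2 * c * (1 / 2) ^ n"
proof -
  have "p n (s n - f) \<le> 2 * c * (1 / 2) ^ n + p n (s (n + k) - f)" for k
  proof -
    have "p n (s n - f) \<le> p n (s n - s (n + k)) + p n (s (n + k) - f)"
      by (intro seminorm_triangle3[OF E p] s f)
    then show ?thesis using telescoping_bound[of n k] by simp
  qed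
  moreover have "(\<lambda>k. 2 * c * (1 / 2) ^ n + p n (s (n + k) - f)) \<longlonglongrightarrow> 2 * c * (1 / 2) ^ n + 0"
    using LIMSEQ_ignore_initial_segment[OF lim, of n] by (intro tendsto_intros) (simp add: add.commute)
  ultimately show ?thesis by (intro LIMSEQ_le_const[of _ "2 * c * (1 / 2) ^ n"]) auto
qed

end

text \<open>Baire's argument by hand: if no ball lies in the closure of \<open>A\<close>, successive
  small corrections produce a point that stays away from \<open>n * A\<close> for every
  \<open>n \<ge> 1\<close>, although \<open>A\<close> absorbs it.\<close>

lemma frechet_barrelled_family:
  assumes fr: "frechet_family E P p" shows "barrelled_family E P"
  unfolding barrelled_family_def
proof (intro conjI allI impI)
  note D = frechet_familyD[OF fr] and mono = frechet_family_mono[OF fr]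
  show fam: "seminorm_family E P" by (rule D(1))
  note E = seminorm_familyD(1)[OF fam] and sn = seminorm_familyD(2)[OF fam]
  fix A assume A: "A \<subseteq> E" "abs_convex A" "absorbing E A"
  show "\<exists>s. P s \<and> (\<forall>h\<in>E. s h \<le> 1 \<longrightarrow> (\<forall>t. P t \<longrightarrow> (\<exists>z\<in>A. t (h - z) < 1)))"
  proof (rule ccontr)
    assume "\<not> ?thesis"
    then have neg: "\<exists>h\<in>E. s h \<le> 1 \<and> (\<exists>t. P t \<and> (\<forall>z\<in>A. 1 \<le> t (h - z)))" if "P s" for s
      using that by (meson not_le)
    have step: "\<exists>f'\<in>E. \<exists>i>j. p j (f' - f) \<le> d \<and> (\<forall>z\<in>A. 1 \<le> p i (f' - fscale (of_real n) z))"
      if f: "f \<in> E" and d: "d > 0" and n: "n \<ge> 1" for f d n j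
    proof -
      \<comment> \<open>The scaling makes \<open>g = 2 * n * h\<close> at most \<open>d\<close> in
        \<open>p j\<close>.\<close>
      have "P (\<lambda>f. (2 * n / d) * p j f)" using d n by (intro seminorm_family_scale[OF fam, OF D(2)]) auto
      then obtain h t where h: "h \<in> E" "(2 * n / d) * p j h \<le> 1" and t: "P t" "\<And>z. z \<in> A \<Longrightarrow> 1 \<le> t (h - z)"
        using neg by blast
      have t_s: "seminorm_on E t" by (rule sn[OF t(1)])
      define g where "g = fscale (of_real (2 * n)) h"
      have g: "g \<in> E" "p j g \<le> d"
      proof -
        show "g \<in> E" unfolding g_def by (rule subspace_scale[OF E h(1)])
        have "p j g = 2 * n * p j h" unfolding g_def seminorm_scale[OF E sn[OF D(2)] h(1)] norm_of_real using n by simp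
        then show "p j g \<le> d" using h(2) d by (simp add: field_simps)
      qed
      have zE: "fscale (of_real n) z \<in> E" if "z \<in> A" for z using that A(1) subspace_scale[OF E] by blast
      have "\<exists>f'\<in>E. p j (f' - f) \<le> d \<and> (\<forall>z\<in>A. n \<le> t (f' - fscale (of_real n) z))"
      proof (cases "\<forall>z\<in>A. n \<le> t (f - fscale (of_real n) z)")
        case True
        then show ?thesis using f d by (intro bexI[of _ f]) (auto simp: seminorm_0[OF E sn[OF D(2)]])
      next
        case False
        then obtain z0 where z0: "z0 \<in> A" "t (f - fscale (of_real n) z0) < n" by auto
        have "n \<le> t (f + g - fscale (of_real n) z)" if z: "z \<in> A" for z
        proof (rule ccontr)
          assume lt: "\<not> ?thesis"
          \<comment> \<open>If both \<open>f\<close> and \<open>f + g\<close> were within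
            \<open>n\<close> of \<open>n * A\<close>, half the difference of the two points of
            \<open>A\<close> would be within 1 of \<open>h\<close>.\<close>
          define w where "w = fscale (1 / 2) z + fscale (- 1 / 2) z0"
          have w: "w \<in> A" unfolding w_def using z z0 by (intro abs_convex_add[OF A(2)]) (auto simp: norm_divide)
          have wE: "w \<in> E" using w A by auto
          have "fscale (of_real (2 * n)) w = fscale (of_real n) z - fscale (of_real n) z0"
            by (simp add: w_def fscale_add fscale_diff fscale_minus)
          then have "fscale (of_real (2 * n)) (h - w)
              = (f + g - fscale (of_real n) z) - (f - fscale (of_real n) z0)"
            by (simp add: g_def fscale_diff)
          then have "t (fscale (of_real (2 * n)) (h - w)) \<le> t (f + g - fscale (of_real n) z) + t (f - fscale (of_real n) z0)"
            using f g zE[OF z] zE[OF z0(1)]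
            by (simp only:) (intro seminorm_diff[OF E t_s] subspace_diff[OF E] subspace_add[OF E])
          also have "\<dots> < 2 * n" using lt z0 by simp
          also have "t (fscale (of_real (2 * n)) (h - w)) = 2 * n * t (h - w)"
            unfolding seminorm_scale[OF E t_s subspace_diff[OF E h(1) wE]] norm_of_real using n by simp
          finally have "t (h - w) < 1" using n by simp
          then show False using t(2)[OF w] by simp
        qed
        then show ?thesis using f g by (intro bexI[of _ "f + g"]) (auto intro: subspace_add[OF E])
      qed
      then obtain f' where f': "f' \<in> E" "p j (f' - f) \<le> d" "\<And>z. z \<in> A \<Longrightarrow> n \<le> t (f' - fscale (of_real n) z)" by blast
      obtain i where i: "\<And>f. f \<in> E \<Longrightarrow> t f \<le> p i f" using D(4)[OF t(1)] by blast
      \<comment> \<open>The index is raised above \<open>j\<close> so that the chosen indices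
        increase strictly.\<close>
      have "1 \<le> p (max i (Suc j)) (f' - fscale (of_real n) z)" if z: "z \<in> A" for z
      proof -
        have e: "f' - fscale (of_real n) z \<in> E" by (rule subspace_diff[OF E f'(1) zE[OF z]])
        have "1 \<le> t (f' - fscale (of_real n) z)" using f'(3)[OF z] n by simp
        also have "\<dots> \<le> p i (f' - fscale (of_real n) z)" by (rule i[OF e])
        also have "\<dots> \<le> p (max i (Suc j)) (f' - fscale (of_real n) z)" by (rule mono[OF e]) simp
        finally show ?thesis .
      qed
      then show ?thesis using f' by (intro bexI[of _ f'] exI[of _ "max i (Suc j)"]) auto
    qed
    \<comment> \<open>A state pairs the current point with the index of a seminorm that separates it
      from \<open>n * A\<close>; the next correction is small in that seminorm.\<close>
    let ?R = "\<lambda>n x. fst x \<in> E \<and> (n \<ge> 1 \<longrightarrow> (\<forall>z\<in>A. 1 \<le> p (snd x) (fst x - fscale (of_real (real n)) z)))"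
    let ?Q = "\<lambda>n x y. snd x < snd y \<and> p (snd x) (fst y - fst x) \<le> (1 / 4) * (1 / 2) ^ n"
    have "\<exists>x. \<forall>n. ?R n (x n) \<and> ?Q n (x n) (x (Suc n))"
    proof (rule dependent_nat_choice)
      show "\<exists>x. ?R 0 x" using subspace_0[OF E] by (intro exI[of _ "(0, 0)"]) simp
      fix x n assume x: "?R n x"
      have "\<exists>f'\<in>E. \<exists>i>snd x. p (snd x) (f' - fst x) \<le> 1 / 4 * (1 / 2) ^ n \<and>
          (\<forall>z\<in>A. 1 \<le> p i (f' - fscale (of_real (real (Suc n))) z))"
        using x by (intro step) auto
      then obtain f' i where "f' \<in> E" "i > snd x" "p (snd x) (f' - fst x) \<le> 1 / 4 * (1 / 2) ^ n"
        "\<forall>z\<in>A. 1 \<le> p i (f' - fscale (of_real (real (Suc n))) z)" by blast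
      then show "\<exists>y. ?R (Suc n) y \<and> ?Q n x y" by (intro exI[of _ "(f', i)"]) auto
    qed
    then obtain x where x: "\<And>n. ?R n (x n)" "\<And>n. ?Q n (x n) (x (Suc n))" by blast
    define s where "s n = fst (x n)" for n
    define i where "i n = snd (x n)" for n
    have s: "s n \<in> E" for n using x(1) by (simp add: s_def)
    have i: "i n < i (Suc n)" for n using x(2) by (simp add: i_def)
    have imono: "strict_mono i" using i by (simp add: strict_mono_Suc_iff)
    have inc: "p (i n) (s (Suc n) - s n) \<le> (1 / 4) * (1 / 2) ^ n" for n using x(2) by (simp add: i_def s_def)
    have far: "1 \<le> p (i n) (s n - fscale (of_real (real n)) z)" if "n \<ge> 1" "z \<in> A" for n z
      using x(1) that by (simp add: i_def s_def)
    have "p n (s (Suc n) - s n) \<le> (1 / 2) ^ n" for n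
    proof -
      have "p n (s (Suc n) - s n) \<le> p (i n) (s (Suc n) - s n)"
        by (intro mono subspace_diff[OF E] s seq_suble[OF imono])
      also have "\<dots> \<le> (1 / 4) * (1 / 2) ^ n" by (rule inc)
      also have "\<dots> \<le> (1 / 2) ^ n" by simp
      finally show ?thesis .
    qed
    then obtain f where f: "f \<in> E" "\<And>n. (\<lambda>k. p n (s k - f)) \<longlonglongrightarrow> 0" using D(5)[of s] s by blast
    obtain t where t: "t > 0" "\<And>c. norm c \<le> t \<Longrightarrow> fscale c f \<in> A" using A(3) f(1) unfolding absorbing_def by blast
    obtain n where n: "real n > max 1 (1 / t)" using reals_Archimedean2 by blast
    have n1: "n \<ge> 1" "1 / real n \<le> t" using n t by (auto simp: field_simps)
    define z where "z = fscale (of_real (1 / real n)) f"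
    have "norm (of_real (1 / real n) :: 'b) \<le> t" unfolding norm_of_real using n1 by simp
    then have z: "z \<in> A" unfolding z_def by (rule t(2))
    have "fscale (of_real (real n)) z = f"
      unfolding z_def fscale_fscale of_real_mult[symmetric] using n1 by simp
    with far[OF n1(1) z] have "1 \<le> p (i n) (s n - f)" by simp
    \<comment> \<open>The factor \<open>1 / 4\<close> in the corrections keeps their total at most
      \<open>1 / 2\<close>, below the separation 1.\<close>
    also have "\<dots> \<le> 2 * (1 / 4) * (1 / 2) ^ n"
    proof (rule telescoping_tail[OF E, of "\<lambda>n. p (i n)"])
      show "p (i m) g \<le> p (i k) g" if "g \<in> E" "m \<le> k" for m k g
        using that imono by (intro mono) (auto simp: strict_mono_less_eq)
    qed (use s f inc sn[OF D(2)] in auto)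
    also have "\<dots> \<le> 2 * (1 / 4) * 1" by (intro mult_left_mono power_le_one) auto
    finally show False by simp
  qed
qed

text \<open>The preimages \<open>A n\<close> of small balls are absolutely convex and absorbing, so
  their closures contain balls. Approximating \<open>h\<close> from \<open>A 0\<close>, the
  remainder from \<open>A 1\<close>, and so on, writes \<open>u h\<close> as a convergent series;
  continuity of the coordinates \<open>u h x\<close> takes the place of the closed graph and
  identifies its sum.\<close>

theorem closed_graph_frechet:
  assumes bar: "barrelled_family H P" and fr: "frechet_family F Q p0"
    and u: "linear_map_on H u" "\<And>h. h \<in> H \<Longrightarrow> u h \<in> F"
    and ptu: "\<And>x. \<exists>s. P s \<and> (\<forall>h\<in>H. norm (u h x) \<le> s h)"
    and ptF: "\<And>x. \<exists>q. Q q \<and> (\<forall>f\<in>F. norm (f x) \<le> q f)"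
    and q: "Q q"
  shows "P (\<lambda>h. q (u h))"
proof -
  obtain m where m: "\<And>f. f \<in> F \<Longrightarrow> q f \<le> p0 m f" using frechet_familyD(4)[OF fr, OF q] by blast
  define p where "p n = p0 (n + m)" for n
  have fr: "frechet_family F Q p" unfolding p_def by (rule frechet_family_shift[OF fr])
  have qp: "q f \<le> p 0 f" if "f \<in> F" for f using m[OF that] by (simp add: p_def)
  note D = frechet_familyD[OF fr] and mono = frechet_family_mono[OF fr]
  note F = seminorm_familyD(1)[OF D(1)] and snF = seminorm_familyD(2)[OF D(1)]
  have fam: "seminorm_family H P" using bar by (simp add: barrelled_family_def)
  note H = seminorm_familyD(1)[OF fam] and sn = seminorm_familyD(2)[OF fam]
  have pu: "seminorm_on H (\<lambda>h. p n (u h))" for n by (rule seminorm_on_comp[OF u snF[OF D(2)]])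
  define A where "A n = {h \<in> H. p n (u h) \<le> (1 / 2) ^ n}" for n
  have "\<exists>s. P s \<and> (\<forall>h\<in>H. s h \<le> 1 \<longrightarrow> (\<forall>t. P t \<longrightarrow> (\<exists>z\<in>A n. t (h - z) < 1)))" for n
  proof -
    have "A n = {h \<in> H. \<forall>t\<in>{\<lambda>h. p n (u h)}. t h \<le> (1 / 2) ^ n}" by (simp add: A_def)
    then have "A n \<subseteq> H" "abs_convex (A n)" "absorbing H (A n)"
      using seminorm_ball_abs_convex[OF H, of "{\<lambda>h. p n (u h)}" "(1 / 2) ^ n"]
        seminorm_ball_absorbing[OF H, of "{\<lambda>h. p n (u h)}" "(1 / 2) ^ n"] pu
      by auto
    then show ?thesis using bar unfolding barrelled_family_def by blast
  qed
  then obtain s where s: "\<And>n. P (s n)"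
    "\<And>n h t. h \<in> H \<Longrightarrow> s n h \<le> 1 \<Longrightarrow> P t \<Longrightarrow> \<exists>z\<in>A n. t (h - z) < 1" by metis
  have key: "p 0 (u h) \<le> 2" if h: "h \<in> H" "s 0 h \<le> 1" for h
  proof -
    \<comment> \<open>Here \<open>y n\<close> is the remainder before the n-th approximation; it
      stays in the ball where approximation from \<open>A n\<close> is possible.\<close>
    have "\<exists>y. \<forall>n. ((y n \<in> H \<and> s n (y n) \<le> 1) \<and> (n = 0 \<longrightarrow> y n = h)) \<and> y n - y (Suc n) \<in> A n"
    proof (rule dependent_nat_choice)
      show "\<exists>x. (x \<in> H \<and> s 0 x \<le> 1) \<and> (0 = 0 \<longrightarrow> x = h)" using h by blast
      fix x n assume x: "(x \<in> H \<and> s n x \<le> 1) \<and> (n = 0 \<longrightarrow> x = h)"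
      then obtain z where z: "z \<in> A n" "s (Suc n) (x - z) < 1" using s(2)[of x n "s (Suc n)"] s(1) by blast
      then show "\<exists>y. ((y \<in> H \<and> s (Suc n) y \<le> 1) \<and> (Suc n = 0 \<longrightarrow> y = h)) \<and> x - y \<in> A n"
        using x by (intro exI[of _ "x - z"]) (auto simp: A_def subspace_diff[OF H])
    qed
    then obtain y where y: "\<And>n. y n \<in> H" "\<And>n. s n (y n) \<le> 1" "y 0 = h" "\<And>n. y n - y (Suc n) \<in> A n" by blast
    define S where "S n = u h - u (y n)" for n
    have SF: "S n \<in> F" for n unfolding S_def by (intro subspace_diff[OF F] u y h)
    have "S (Suc n) - S n = u (y n - y (Suc n))" for n
      using linear_map_diff[OF H u(1) y(1) y(1), of n "Suc n"] by (simp add: S_def)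
    then have inc: "p n (S (Suc n) - S n) \<le> (1 / 2) ^ n" for n using y(4)[of n] by (simp add: A_def)
    then obtain f where f: "f \<in> F" "\<And>n. (\<lambda>k. p n (S k - f)) \<longlonglongrightarrow> 0" using D(5)[of S] SF by blast
    have "p 0 (S 0 - f) \<le> 2 * 1 * (1 / 2) ^ 0"
      by (rule telescoping_tail[OF F snF[OF D(2)] mono SF _ f]) (use inc in auto)
    moreover have "S 0 = 0" by (simp add: S_def y(3))
    ultimately have pf: "p 0 f \<le> 2" using seminorm_minus[OF F snF[OF D(2)] f(1)] by simp
    have "f x = u h x" for x
    proof -
      obtain q' where q': "Q q'" "\<And>f. f \<in> F \<Longrightarrow> norm (f x) \<le> q' f" using ptF by blast
      obtain m where m: "\<And>f. f \<in> F \<Longrightarrow> q' f \<le> p m f" using D(4)[OF q'(1)] by blast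
      obtain t where t: "P t" "\<And>h. h \<in> H \<Longrightarrow> norm (u h x) \<le> t h" using ptu by blast
      have "(\<lambda>k. S k x - f x) \<longlonglongrightarrow> 0"
      proof (rule Lim_null_comparison[OF _ f(2)[of m]], intro always_eventually allI)
        fix k
        have e: "S k - f \<in> F" by (rule subspace_diff[OF F SF f(1)])
        show "norm (S k x - f x) \<le> p m (S k - f)"
          using q'(2)[OF e] m[OF e] by (simp add: minus_apply)
      qed
      moreover have "(\<lambda>k. u (y k) x) \<longlonglongrightarrow> 0"
      proof (rule LIMSEQ_I)
        fix e :: real assume e: "e > 0"
        have "(\<lambda>n. (1 / 2 :: real) ^ n) \<longlonglongrightarrow> 0" by (intro LIMSEQ_power_zero) simp
        then obtain N where N: "\<And>n. n \<ge> N \<Longrightarrow> (1 / 2 :: real) ^ n < e / 2"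
          using order_tendstoD(2)[of _ 0 sequentially "e / 2"] e unfolding eventually_sequentially by auto
        have "norm (u (y n) x) < e" if n: "n \<ge> max N m" for n
        proof -
          \<comment> \<open>Being in the ball of \<open>s n\<close> says nothing about
            \<open>t\<close>, so \<open>y n\<close> is compared with a nearby
            \<open>z \<in> A n\<close>, whose image is small in \<open>F\<close>.\<close>
          have "P (\<lambda>h. 2 / e * t h)" using e by (intro seminorm_family_scale[OF fam, OF t(1)]) simp
          from s(2)[OF y(1) y(2) this, of n] obtain z where z: "z \<in> A n" "2 / e * t (y n - z) < 1" by blast
          have zH: "z \<in> H" using z by (simp add: A_def)
          have "norm (u (y n - z) x) \<le> t (y n - z)" by (intro t(2) subspace_diff[OF H] y zH)
          also have "\<dots> < e / 2" using z(2) e by (simp add: field_simps)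
          finally have 1: "norm (u (y n - z) x) < e / 2" .
          have "norm (u z x) \<le> p m (u z)" using q'(2)[OF u(2)[OF zH]] m[OF u(2)[OF zH]] by simp
          also have "\<dots> \<le> p n (u z)" using n by (intro mono u(2) zH) simp
          also have "\<dots> \<le> (1 / 2) ^ n" using z(1) by (simp add: A_def)
          also have "\<dots> < e / 2" using N n by simp
          finally have 2: "norm (u z x) < e / 2" .
          have "u (y n) x = u (y n - z) x + u z x"
            using linear_map_diff[OF H u(1) y(1) zH, of n] by (simp add: minus_apply)
          then show ?thesis using 1 2 norm_triangle_ineq[of "u (y n - z) x" "u z x"] by simp
        qed
        then show "\<exists>N. \<forall>n\<ge>N. norm (u (y n) x - 0) < e" by (intro exI[of _ "max N m"]) auto
      qed
      ultimately have "(\<lambda>k. (S k x - f x) + u (y k) x) \<longlonglongrightarrow> 0 + 0" by (rule tendsto_add)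
      then have "(\<lambda>k. u h x - f x) \<longlonglongrightarrow> 0" by (simp add: S_def minus_apply)
      then show ?thesis by (simp add: LIMSEQ_const_iff)
    qed
    then have "f = u h" by (rule ext)
    then show ?thesis using pf by simp
  qed
  have "p 0 (u h) \<le> 2 * s 0 h" if h: "h \<in> H" for h
    by (rule seminorm_dominated[OF H sn[OF s(1)] pu key h])
  then have le: "q (u h) \<le> 2 * s 0 h" if "h \<in> H" for h
    using order_trans[OF qp[OF u(2)[OF that]]] that by simp
  show ?thesis
    by (rule seminorm_familyD(5)[OF fam s(1)[of 0] seminorm_on_comp[OF u snF[OF q]] le])
qed

section \<open>Banach spaces of linear functionals\<close>

text \<open>The dual Banach space of the seminormed space \<open>(V, q)\<close>; it is applied to
  \<open>G\<close> with a continuous seminorm and to a dual space with the gauge of a polar.\<close>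

definition functional_space ::
  "('d \<Rightarrow> 'k::real_normed_field) set \<Rightarrow> (('d \<Rightarrow> 'k) \<Rightarrow> real) \<Rightarrow> (('d \<Rightarrow> 'k) \<Rightarrow> 'k) set" where
  "functional_space V q = {w. linear_on V w \<and> (\<forall>f. f \<notin> V \<longrightarrow> w f = 0) \<and> (\<exists>C. \<forall>f\<in>V. norm (w f) \<le> C * q f)}"

definition functional_norm ::
  "('d \<Rightarrow> 'k::real_normed_field) set \<Rightarrow> (('d \<Rightarrow> 'k) \<Rightarrow> real) \<Rightarrow> (('d \<Rightarrow> 'k) \<Rightarrow> 'k) \<Rightarrow> real" where
  "functional_norm V q w = Inf {C. C \<ge> 0 \<and> (\<forall>f\<in>V. norm (w f) \<le> C * q f)}"

text \<open>The continuous seminorms for the topology of the single seminorm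
  \<open>n\<close>.\<close>

definition normed_family ::
  "('d \<Rightarrow> 'k::real_normed_field) set \<Rightarrow> (('d \<Rightarrow> 'k) \<Rightarrow> real) \<Rightarrow> (('d \<Rightarrow> 'k) \<Rightarrow> real) \<Rightarrow> bool" where
  "normed_family E n p \<longleftrightarrow> seminorm_on E p \<and> (\<exists>C. \<forall>f\<in>E. p f \<le> C * n f)"

lemma seminorm_family_normed:
  assumes E: "fun_subspace E" and n: "seminorm_on E n" shows "seminorm_family E (normed_family E n)"
  unfolding seminorm_family_def
proof (intro conjI allI impI)
  show "normed_family E n (\<lambda>f. 0)"
    unfolding normed_family_def using seminorm_on_const_0[OF E] by (auto intro: exI[of _ 0])
  show "normed_family E n (\<lambda>f. p f + q f)" if p: "normed_family E n p" and q: "normed_family E n q" for p q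
  proof -
    obtain C D where "\<And>f. f \<in> E \<Longrightarrow> p f \<le> C * n f" "\<And>f. f \<in> E \<Longrightarrow> q f \<le> D * n f"
      using p q unfolding normed_family_def by blast
    then have "p f + q f \<le> (C + D) * n f" if "f \<in> E" for f
      using that by (simp add: distrib_right add_mono)
    moreover have "seminorm_on E (\<lambda>f. p f + q f)"
      using p q by (intro seminorm_on_add E) (auto simp: normed_family_def)
    ultimately show ?thesis unfolding normed_family_def by blast
  qed
  show "normed_family E n q" if p: "normed_family E n p" and q: "seminorm_on E q" and le: "\<forall>f\<in>E. q f \<le> C * p f" for p q C
  proof -
    have ps: "seminorm_on E p" using p by (simp add: normed_family_def)
    obtain D where D: "\<And>f. f \<in> E \<Longrightarrow> p f \<le> D * n f" using p unfolding normed_family_def by blast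
    have "q f \<le> (\<bar>C\<bar> * D) * n f" if f: "f \<in> E" for f
    proof -
      have "q f \<le> C * p f" using le f by blast
      also have "\<dots> \<le> \<bar>C\<bar> * p f" using seminorm_ge_0[OF E ps f] by (intro mult_right_mono) auto
      also have "\<dots> \<le> \<bar>C\<bar> * (D * n f)" using D[OF f] by (intro mult_left_mono) auto
      finally show ?thesis by (simp add: mult.assoc)
    qed
    then show ?thesis using q unfolding normed_family_def by blast
  qed
qed (auto simp: E normed_family_def)

context
  fixes V :: "('d \<Rightarrow> 'k::real_normed_field) set" and q
  assumes V: "fun_subspace V" and q: "seminorm_on V q"
begin

lemma functional_space_subspace: "fun_subspace (functional_space V q)"
  unfolding fun_subspace_def fun_ops
proof (intro conjI ballI allI)
  show "0 \<in> functional_space V q"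
    by (auto simp: functional_space_def linear_on_def fun_apply intro!: exI[of _ 0])
next
  fix v w assume v: "v \<in> functional_space V q" and w: "w \<in> functional_space V q"
  obtain C D where "\<And>f. f \<in> V \<Longrightarrow> norm (v f) \<le> C * q f" "\<And>f. f \<in> V \<Longrightarrow> norm (w f) \<le> D * q f"
    using v w unfolding functional_space_def by blast
  then have "norm ((v + w) f) \<le> (C + D) * q f" if "f \<in> V" for f
    unfolding fun_apply distrib_right using that by (intro norm_triangle_le add_mono) auto
  moreover have "linear_on V (v + w)"
    using v w by (auto simp: functional_space_def linear_on_def fun_apply algebra_simps)
  moreover have "(v + w) f = 0" if "f \<notin> V" for f using v w that by (simp add: functional_space_def fun_apply)
  ultimately show "v + w \<in> functional_space V q" unfolding functional_space_def by blast
next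
  fix c v assume v: "v \<in> functional_space V q"
  obtain C where C: "\<And>f. f \<in> V \<Longrightarrow> norm (v f) \<le> C * q f" using v unfolding functional_space_def by blast
  have "norm (fscale c v f) \<le> (norm c * C) * q f" if "f \<in> V" for f
    unfolding fun_apply norm_mult mult.assoc using C[OF that] by (intro mult_left_mono) auto
  moreover have "linear_on V (fscale c v)"
    using v by (auto simp: functional_space_def linear_on_def fun_apply algebra_simps)
  moreover have "fscale c v f = 0" if "f \<notin> V" for f using v that by (simp add: functional_space_def fun_apply)
  ultimately show "fscale c v \<in> functional_space V q" unfolding functional_space_def by blast
qed

lemma functional_norm_le:
  assumes "C \<ge> 0" "\<And>f. f \<in> V \<Longrightarrow> norm (w f) \<le> C * q f" shows "functional_norm V q w \<le> C"
  unfolding functional_norm_def using assms by (intro cInf_lower bdd_belowI[of _ 0]) auto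

lemma functional_norm_set_nonempty:
  assumes "w \<in> functional_space V q" shows "{C. C \<ge> 0 \<and> (\<forall>f\<in>V. norm (w f) \<le> C * q f)} \<noteq> {}"
proof -
  obtain C where C: "\<And>f. f \<in> V \<Longrightarrow> norm (w f) \<le> C * q f" using assms unfolding functional_space_def by blast
  have "norm (w f) \<le> \<bar>C\<bar> * q f" if "f \<in> V" for f
    using C[OF that] seminorm_ge_0[OF V q that] by (smt (verit) mult_right_mono)
  then show ?thesis by (auto intro!: exI[of _ "\<bar>C\<bar>"])
qed

lemma functional_norm_ge_0: "w \<in> functional_space V q \<Longrightarrow> functional_norm V q w \<ge> 0"
  unfolding functional_norm_def by (rule cInf_greatest[OF functional_norm_set_nonempty]) auto

lemma functional_norm_bound:
  assumes w: "w \<in> functional_space V q" and f: "f \<in> V" shows "norm (w f) \<le> functional_norm V q w * q f"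
proof (cases "q f = 0")
  case True
  obtain C where "norm (w f) \<le> C * q f" using w f unfolding functional_space_def by blast
  then show ?thesis using True by simp
next
  case False
  then have qf: "q f > 0" using seminorm_ge_0[OF V q f] by simp
  have "norm (w f) / q f \<le> functional_norm V q w"
    unfolding functional_norm_def
    by (rule cInf_greatest[OF functional_norm_set_nonempty[OF w]]) (use qf f in \<open>auto simp: field_simps\<close>)
  then show ?thesis using qf by (simp add: field_simps)
qed

lemma seminorm_functional_norm: "seminorm_on (functional_space V q) (functional_norm V q)"
  unfolding seminorm_on_def
proof (intro conjI ballI allI)
  fix v w assume v: "v \<in> functional_space V q" and w: "w \<in> functional_space V q"
  show "functional_norm V q (v + w) \<le> functional_norm V q v + functional_norm V q w"
  proof (rule functional_norm_le)
    fix f assume f: "f \<in> V"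
    show "norm ((v + w) f) \<le> (functional_norm V q v + functional_norm V q w) * q f"
      unfolding fun_apply distrib_right
      by (intro norm_triangle_le add_mono functional_norm_bound v w f)
  qed (use functional_norm_ge_0 v w in auto)
next
  have le: "functional_norm V q (fscale c w) \<le> norm c * functional_norm V q w" if w: "w \<in> functional_space V q" for c w
    by (rule functional_norm_le)
      (auto simp: fun_apply norm_mult mult.assoc functional_norm_ge_0 functional_norm_bound w intro!: mult_left_mono)
  fix c w assume w: "w \<in> functional_space V q"
  have "norm c * functional_norm V q w \<le> functional_norm V q (fscale c w)"
  proof (cases "c = 0")
    case True
    then show ?thesis using functional_norm_ge_0[OF subspace_scale[OF functional_space_subspace w, of 0]] by simp
  next
    case False
    then show ?thesis
      using le[OF subspace_scale[OF functional_space_subspace w, of c], of "1 / c"] by (simp add: norm_divide field_simps)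
  qed
  then show "functional_norm V q (fscale c w) = norm c * functional_norm V q w" using le[OF w, of c] by simp
qed

text \<open>Values converge because the scalars are complete, and the uniform bounds on increments
  survive the passage to the limit.\<close>

lemma functional_space_complete:
  assumes s: "\<And>n. s n \<in> functional_space V q"
    and inc: "\<And>n. functional_norm V q (s (Suc n) - s n) \<le> (1 / 2) ^ n"
  shows "\<exists>w\<in>functional_space V q. \<forall>k. functional_norm V q (s k - w) \<le> 2 * (1 / 2) ^ k"
proof -
  note sub = functional_space_subspace
  have step: "norm (s (Suc n) f - s n f) \<le> q f * (1 / 2) ^ n" if f: "f \<in> V" for n f
  proof -
    have "norm ((s (Suc n) - s n) f) \<le> functional_norm V q (s (Suc n) - s n) * q f"
      by (intro functional_norm_bound subspace_diff[OF sub] s f)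
    also have "\<dots> \<le> (1 / 2) ^ n * q f" by (intro mult_right_mono inc seminorm_ge_0[OF V q f])
    finally show ?thesis by (simp add: fun_apply mult.commute)
  qed
  define w where "w f = (if f \<in> V then lim (\<lambda>n. s n f) else 0)" for f
  have lim: "(\<lambda>n. s n f) \<longlonglongrightarrow> w f" if f: "f \<in> V" for f
  proof -
    have "summable (\<lambda>n. q f * (1 / 2) ^ n)" by (intro summable_mult summable_geometric) simp
    then have "summable (\<lambda>n. norm (s (Suc n) f - s n f))"
      by (rule summable_comparison_test') (use step[OF f] in auto)
    then have "summable (\<lambda>n. s (Suc n) f - s n f)" by (rule scalar_summable_norm_cancel)
    then have "convergent (\<lambda>n. \<Sum>i<n. s (Suc i) f - s i f)" by (simp add: summable_iff_convergent)
    then have "convergent (\<lambda>n. s n f - s 0 f)" unfolding sum_lessThan_telescope[of "\<lambda>n. s n f"] .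
    then have "convergent (\<lambda>n. s n f - s 0 f + s 0 f)" by (intro convergent_add convergent_const)
    then have "convergent (\<lambda>n. s n f)" by simp
    then show ?thesis using f by (simp add: w_def convergent_LIMSEQ_iff)
  qed
  have bound: "norm (s n f - w f) \<le> 2 * (1 / 2) ^ n * q f" if f: "f \<in> V" for f n
  proof -
    \<comment> \<open>As in \<open>telescoping_bound\<close>, the remaining tail is subtracted to
      make the induction close.\<close>
    have *: "norm (s n f - s (n + k) f) \<le> q f * (2 * (1 / 2) ^ n - 2 * (1 / 2) ^ (n + k))" for k
    proof (induction k)
      case (Suc k)
      have "norm (s n f - s (n + Suc k) f) \<le> norm (s n f - s (n + k) f) + norm (s (Suc (n + k)) f - s (n + k) f)"
        using norm_triangle_ineq4[of "s n f - s (n + k) f" "s (Suc (n + k)) f - s (n + k) f"] by simp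
      also have "\<dots> \<le> q f * (2 * (1 / 2) ^ n - 2 * (1 / 2) ^ (n + k)) + q f * (1 / 2) ^ (n + k)"
        by (intro add_mono Suc step f)
      finally show ?case by (simp add: algebra_simps)
    qed simp
    have "(\<lambda>k. norm (s n f - s (n + k) f)) \<longlonglongrightarrow> norm (s n f - w f)"
      using LIMSEQ_ignore_initial_segment[OF lim[OF f], of n] by (intro tendsto_intros) (simp add: add.commute)
    moreover have "norm (s n f - s (n + k) f) \<le> 2 * (1 / 2) ^ n * q f" for k
      using *[of k] seminorm_ge_0[OF V q f] by (smt (verit) mult.commute mult_left_mono zero_le_divide_1_iff zero_le_power)
    ultimately show ?thesis by (intro LIMSEQ_le_const2) auto
  qed
  have slin: "linear_on V (s n)" for n using s by (simp add: functional_space_def)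
  have lin: "linear_on V w"
    unfolding linear_on_def
  proof (intro conjI ballI allI)
    fix f g assume fg: "f \<in> V" "g \<in> V"
    have "(\<lambda>n. s n f + s n g) \<longlonglongrightarrow> w f + w g" by (intro tendsto_add lim fg)
    moreover have "s n f + s n g = s n (f + g)" for n using linear_on_add[OF slin fg] by simp
    ultimately show "w (f + g) = w f + w g" using lim[OF subspace_add[OF V fg]] LIMSEQ_unique by (simp only:)
  next
    fix c f assume f: "f \<in> V"
    have "(\<lambda>n. c * s n f) \<longlonglongrightarrow> c * w f" by (intro tendsto_intros lim f)
    moreover have "c * s n f = s n (fscale c f)" for n using linear_on_scale[OF slin f] by simp
    ultimately have "(\<lambda>n. s n (fscale c f)) \<longlonglongrightarrow> c * w f" by simp
    then show "w (fscale c f) = c * w f" by (rule LIMSEQ_unique[OF lim[OF subspace_scale[OF V f, of c]]])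
  qed
  have diff: "s n - w \<in> functional_space V q" for n
  proof -
    have "linear_on V (s n - w)"
      using s[of n] lin by (auto simp: functional_space_def linear_on_def fun_apply algebra_simps)
    moreover have "(s n - w) f = 0" if "f \<notin> V" for f
      using s[of n] that by (simp add: functional_space_def fun_apply w_def)
    moreover have "norm ((s n - w) f) \<le> 2 * (1 / 2) ^ n * q f" if "f \<in> V" for f
      using bound[OF that, of n] by (simp add: fun_apply)
    ultimately show ?thesis unfolding functional_space_def by blast
  qed
  have "s 0 - (s 0 - w) \<in> functional_space V q" by (intro subspace_diff[OF sub] s diff)
  then have "w \<in> functional_space V q" by simp
  moreover have "functional_norm V q (s k - w) \<le> 2 * (1 / 2) ^ k" for k
    by (rule functional_norm_le) (use bound in \<open>auto simp: fun_apply\<close>)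
  ultimately show ?thesis by blast
qed

text \<open>A constant sequence of norms would not do: \<open>frechet_family\<close> asks for
  domination without a constant, which the multiples \<open>real (Suc n)\<close> absorb.\<close>

lemma frechet_functional_space:
  "frechet_family (functional_space V q) (normed_family (functional_space V q) (functional_norm V q))
     (\<lambda>n w. real (Suc n) * functional_norm V q w)"
  unfolding frechet_family_def
proof (intro conjI allI impI ballI)
  note sub = functional_space_subspace and sn = seminorm_functional_norm and ge = functional_norm_ge_0
  show "seminorm_family (functional_space V q) (normed_family (functional_space V q) (functional_norm V q))"
    by (rule seminorm_family_normed[OF sub sn])
  show "normed_family (functional_space V q) (functional_norm V q) (\<lambda>w. real (Suc n) * functional_norm V q w)" for n
    unfolding normed_family_def using seminorm_on_scale[OF sub sn, of "real (Suc n)"] by auto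
  show "real (Suc n) * functional_norm V q f \<le> real (Suc (Suc n)) * functional_norm V q f"
    if "f \<in> functional_space V q" for n f using ge[OF that] by (intro mult_right_mono) auto
  show "\<exists>n. \<forall>f\<in>functional_space V q. t f \<le> real (Suc n) * functional_norm V q f"
    if t: "normed_family (functional_space V q) (functional_norm V q) t" for t
  proof -
    obtain C where C: "\<And>f. f \<in> functional_space V q \<Longrightarrow> t f \<le> C * functional_norm V q f"
      using t[unfolded normed_family_def, THEN conjunct2] by blast
    obtain n where "C \<le> real n" using real_arch_simple by blast
    then have "t f \<le> real (Suc n) * functional_norm V q f" if "f \<in> functional_space V q" for f
      using C[OF that] mult_right_mono[OF _ ge[OF that], of C "real (Suc n)"] by simp
    then show ?thesis by blast
  qed
  fix s assume s: "\<forall>n. s n \<in> functional_space V q"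
    and le: "\<forall>n. real (Suc n) * functional_norm V q (s (Suc n) - s n) \<le> (1 / 2) ^ n"
  have "functional_norm V q (s (Suc n) - s n) \<le> (1 / 2) ^ n" for n
  proof -
    have "s (Suc n) - s n \<in> functional_space V q" using s by (intro subspace_diff[OF sub]) auto
    then have "1 * functional_norm V q (s (Suc n) - s n) \<le> real (Suc n) * functional_norm V q (s (Suc n) - s n)"
      by (intro mult_right_mono ge) auto
    also have "\<dots> \<le> (1 / 2) ^ n" using le by blast
    finally show ?thesis by simp
  qed
  then obtain w where w: "w \<in> functional_space V q" "\<And>k. functional_norm V q (s k - w) \<le> 2 * (1 / 2) ^ k"
    using functional_space_complete[of s] s by blast
  have "(\<lambda>k. real (Suc n) * functional_norm V q (s k - w)) \<longlonglongrightarrow> 0" for n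
  proof (rule Lim_null_comparison)
    show "\<forall>\<^sub>F k in sequentially. norm (real (Suc n) * functional_norm V q (s k - w)) \<le> real (Suc n) * (2 * (1 / 2) ^ k)"
    proof (intro always_eventually allI)
      fix k
      have "functional_norm V q (s k - w) \<ge> 0" using s w by (intro ge subspace_diff[OF sub]) auto
      then show "norm (real (Suc n) * functional_norm V q (s k - w)) \<le> real (Suc n) * (2 * (1 / 2) ^ k)"
        using w(2)[of k] by (simp add: abs_mult)
    qed
    have "(\<lambda>k. real (Suc n) * (2 * (1 / 2) ^ k)) \<longlonglongrightarrow> real (Suc n) * (2 * 0)"
      by (intro tendsto_intros LIMSEQ_power_zero) simp
    then show "(\<lambda>k. real (Suc n) * (2 * (1 / 2) ^ k)) \<longlonglongrightarrow> 0" by simp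
  qed
  then show "\<exists>f\<in>functional_space V q. \<forall>n. (\<lambda>k. real (Suc n) * functional_norm V q (s k - f)) \<longlonglongrightarrow> 0"
    using w(1) by blast
qed

lemma seminorm_eval:
  assumes "f \<in> V" shows "normed_family (functional_space V q) (functional_norm V q) (\<lambda>w. norm (w f))"
  unfolding normed_family_def
proof (intro conjI exI ballI)
  show "seminorm_on (functional_space V q) (\<lambda>w. norm (w f))"
    by (auto simp: seminorm_on_def fun_apply norm_mult norm_triangle_ineq)
  show "norm (w f) \<le> q f * functional_norm V q w" if "w \<in> functional_space V q" for w
    using functional_norm_bound[OF that assms] by (simp add: mult.commute)
qed

text \<open>The distance from \<open>N\<close>; a functional dominated by it vanishes on
  \<open>N\<close>, which is how Hahn--Banach separates a point from \<open>N\<close>.\<close>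

lemma quotient_seminorm:
  assumes N: "fun_subspace N" "N \<subseteq> V"
  shows "seminorm_on V (\<lambda>f. INF g\<in>N. q (f - g))"
    and "f \<in> V \<Longrightarrow> (INF g\<in>N. q (f - g)) \<le> q f" and "f \<in> N \<Longrightarrow> (INF g\<in>N. q (f - g)) = 0"
    and "f \<in> V \<Longrightarrow> (\<And>g. g \<in> N \<Longrightarrow> c \<le> q (f - g)) \<Longrightarrow> c \<le> (INF g\<in>N. q (f - g))"
proof -
  let ?d = "\<lambda>f. INF g\<in>N. q (f - g)"
  have ne: "N \<noteq> {}" using subspace_0[OF N(1)] by blast
  have pos: "0 \<le> q (f - g)" if "f \<in> V" "g \<in> N" for f g
    using that N by (intro seminorm_ge_0[OF V q] subspace_diff[OF V]) auto
  have bdd: "bdd_below ((\<lambda>g. q (f - g)) ` N)" if "f \<in> V" for f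
    using pos[OF that] by (intro bdd_belowI2) auto
  have le: "?d f \<le> q (f - g)" if "f \<in> V" "g \<in> N" for f g by (rule cINF_lower[OF bdd that(2)]) (rule that)
  have ge: "c \<le> ?d f" if "\<And>g. g \<in> N \<Longrightarrow> c \<le> q (f - g)" for c f by (rule cINF_greatest[OF ne that])
  show "c \<le> ?d f" if "\<And>g. g \<in> N \<Longrightarrow> c \<le> q (f - g)" using ge[OF that] .
  show "?d f \<le> q f" if "f \<in> V" using le[OF that subspace_0[OF N(1)]] by simp
  show "?d f = 0" if "f \<in> N"
    using le[of f f] ge[of 0 f] pos[of f] that N(2) seminorm_0[OF V q] by (auto intro!: antisym)
  show "seminorm_on V ?d"
    unfolding seminorm_on_def
  proof (intro conjI ballI allI)
    fix f f' assume f: "f \<in> V" "f' \<in> V"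
    have "?d (f + f') - q (f - g) \<le> q (f' - g')" if g: "g \<in> N" "g' \<in> N" for g g'
    proof -
      have gV: "g \<in> V" "g' \<in> V" using g N by auto
      have "?d (f + f') \<le> q (f + f' - (g + g'))" by (intro le subspace_add[OF V f] subspace_add[OF N(1) g])
      also have "f + f' - (g + g') = (f - g) + (f' - g')" by simp
      also have "q ((f - g) + (f' - g')) \<le> q (f - g) + q (f' - g')"
        by (intro seminorm_add[OF V q] subspace_diff[OF V] f gV)
      finally show ?thesis by simp
    qed
    then have "?d (f + f') - q (f - g) \<le> ?d f'" if "g \<in> N" for g using that by (intro ge)
    then have "?d (f + f') - ?d f' \<le> ?d f" by (intro ge) (smt (verit))
    then show "?d (f + f') \<le> ?d f + ?d f'" by simp
  next
    have sc: "?d (fscale c f) \<le> norm c * ?d f" if c: "c \<noteq> 0" and f: "f \<in> V" for c f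
    proof -
      have "?d (fscale c f) / norm c \<le> q (f - g)" if g: "g \<in> N" for g
      proof -
        have gV: "g \<in> V" using g N by auto
        have "?d (fscale c f) \<le> q (fscale c f - fscale c g)"
          by (intro le subspace_scale[OF V f] subspace_scale[OF N(1) g])
        also have "\<dots> = norm c * q (f - g)"
          by (simp only: fscale_diff[symmetric] seminorm_scale[OF V q subspace_diff[OF V f gV]])
        finally show ?thesis using c by (simp add: field_simps)
      qed
      then have "?d (fscale c f) / norm c \<le> ?d f" by (rule ge)
      then show ?thesis using c by (simp add: field_simps)
    qed
    fix c f assume f: "f \<in> V"
    show "?d (fscale c f) = norm c * ?d f"
    proof (cases "c = 0")
      case True
      have "?d 0 \<le> q (0 - 0)" by (intro le subspace_0[OF V] subspace_0[OF N(1)])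
      moreover have "0 \<le> ?d 0" by (intro ge pos subspace_0[OF V])
      ultimately show ?thesis using True by (simp add: seminorm_0[OF V q])
    next
      case False
      have "?d (fscale (1 / c) (fscale c f)) \<le> norm (1 / c) * ?d (fscale c f)"
        using False f by (intro sc subspace_scale[OF V]) auto
      then have "norm c * ?d f \<le> ?d (fscale c f)" using False by (simp add: norm_divide field_simps)
      then show ?thesis using sc[OF False f] by simp
    qed
  qed
qed

end

section \<open>Strong duals and reflexive spaces\<close>

lemma lcs_bounded_Un:
  assumes "lcs_bounded T A" "lcs_bounded T B" shows "lcs_bounded T (A \<union> B)"
  unfolding lcs_bounded_def
proof (intro conjI allI impI)
  show "A \<union> B \<subseteq> topspace T" using assms by (simp add: lcs_bounded_def)
  fix U assume U: "openin T U \<and> fzero \<in> U"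
  obtain s t where st: "s > 0" "\<forall>c. norm c \<le> s \<longrightarrow> fscale c ` A \<subseteq> U" "t > 0" "\<forall>c. norm c \<le> t \<longrightarrow> fscale c ` B \<subseteq> U"
    using assms U unfolding lcs_bounded_def by meson
  then show "\<exists>t>0. \<forall>c. norm c \<le> t \<longrightarrow> fscale c ` (A \<union> B) \<subseteq> U"
    by (intro exI[of _ "min s t"]) (auto simp: image_Un)
qed

lemma openin_strong_dual_top:
  "openin (strong_dual_top E T) U \<longleftrightarrow> U \<subseteq> dual E T \<and>
     (\<forall>v\<in>U. \<exists>B e. lcs_bounded T B \<and> e > 0 \<and> {w \<in> dual E T. \<forall>f\<in>B. norm (w f - v f) < e} \<subseteq> U)"
proof -
  have "istopology (\<lambda>U. U \<subseteq> dual E T \<and>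
     (\<forall>v\<in>U. \<exists>B e. lcs_bounded T B \<and> e > 0 \<and> {w \<in> dual E T. \<forall>f\<in>B. norm (w f - v f) < e} \<subseteq> U))"
    unfolding istopology_def
  proof (intro conjI allI impI, goal_cases)
    case (1 S S')
    then show ?case by blast
  next
    case (2 S S')
    show ?case
    proof
      fix v assume v: "v \<in> S \<inter> S'"
      then obtain A B d e where "lcs_bounded T A" "d > 0" "{w \<in> dual E T. \<forall>f\<in>A. norm (w f - v f) < d} \<subseteq> S"
        "lcs_bounded T B" "e > 0" "{w \<in> dual E T. \<forall>f\<in>B. norm (w f - v f) < e} \<subseteq> S'"
        using 2 by (meson IntD1 IntD2)
      then show "\<exists>B e. lcs_bounded T B \<and> e > 0 \<and> {w \<in> dual E T. \<forall>f\<in>B. norm (w f - v f) < e} \<subseteq> S \<inter> S'"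
        by (intro exI[of _ "A \<union> B"] exI[of _ "min d e"]) (auto simp: lcs_bounded_Un)
    qed
  next
    case (3 \<K>)
    then show ?case by blast
  next
    case (4 \<K>)
    show ?case
    proof
      fix v assume "v \<in> \<Union> \<K>"
      then obtain K where K: "K \<in> \<K>" "v \<in> K" by blast
      then obtain B e where "lcs_bounded T B" "e > 0" "{w \<in> dual E T. \<forall>f\<in>B. norm (w f - v f) < e} \<subseteq> K"
        using 4 by meson
      then show "\<exists>B e. lcs_bounded T B \<and> e > 0 \<and> {w \<in> dual E T. \<forall>f\<in>B. norm (w f - v f) < e} \<subseteq> \<Union> \<K>"
        using K(1) by blast
    qed
  qed
  then show ?thesis unfolding strong_dual_top_def by (simp add: topology_inverse')
qed

lemma lcs_bounded_empty: "lcs_bounded T {}"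
  by (auto simp: lcs_bounded_def intro: exI[of _ 1])

lemma topspace_strong_dual_top: "topspace (strong_dual_top E T) = dual E T"
proof
  show "topspace (strong_dual_top E T) \<subseteq> dual E T"
    using openin_topspace[of "strong_dual_top E T"] unfolding openin_strong_dual_top by blast
  have "openin (strong_dual_top E T) (dual E T)"
    unfolding openin_strong_dual_top
    by (intro conjI ballI exI[of _ "{}"] exI[of _ 1]) (auto simp: lcs_bounded_empty)
  then show "dual E T \<subseteq> topspace (strong_dual_top E T)" by (rule openin_subset)
qed

text \<open>Openness comes from the uniform slack \<open>d < 1\<close>; a strict bound at each
  \<open>f\<close> separately would not leave room for a perturbation that is uniform on
  \<open>B\<close>.\<close>

lemma openin_strong_polar:
  assumes "lcs_bounded T B"
  shows "openin (strong_dual_top E T) {w \<in> dual E T. \<exists>d<1. \<forall>f\<in>B. norm (w f) \<le> d}" (is "openin _ ?W")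
  unfolding openin_strong_dual_top
proof (intro conjI ballI)
  show "?W \<subseteq> dual E T" by blast
  fix v assume "v \<in> ?W"
  then obtain d where d: "d < 1" "\<And>f. f \<in> B \<Longrightarrow> norm (v f) \<le> d" by blast
  define e where "e = (1 - d) / 2"
  have "w \<in> ?W" if w: "w \<in> dual E T" "\<forall>f\<in>B. norm (w f - v f) < e" for w
  proof -
    have "norm (w f) \<le> d + e" if f: "f \<in> B" for f
      using d(2)[OF f] w(2) f norm_triangle_ineq2[of "w f" "v f"] by (smt (verit))
    moreover have "d + e < 1" using d(1) by (simp add: e_def field_simps)
    ultimately show ?thesis using w(1) by blast
  qed
  then show "\<exists>B e. lcs_bounded T B \<and> e > 0 \<and> {w \<in> dual E T. \<forall>f\<in>B. norm (w f - v f) < e} \<subseteq> ?W"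
    using assms d(1) by (intro exI[of _ B] exI[of _ e]) (auto simp: e_def)
qed

context
  fixes E :: "('d \<Rightarrow> 'k::real_normed_field) set" and T
  assumes lcs: "lcs E T"
begin

lemma dual_linear: "v \<in> dual E T \<Longrightarrow> linear_on E v"
  by (simp add: dual_iff[OF lcs])

lemma dual_subspace: "fun_subspace (dual E T)"
proof -
  note sub = lcs_subspace[OF lcs]
  have *: "fscale a v + fscale b w \<in> dual E T" if v: "v \<in> dual E T" and w: "w \<in> dual E T" for a b v w
  proof -
    obtain p q where p: "cont_seminorm E T p" "\<And>f. f \<in> E \<Longrightarrow> norm (v f) \<le> p f"
      and q: "cont_seminorm E T q" "\<And>f. f \<in> E \<Longrightarrow> norm (w f) \<le> q f"
      using v w unfolding dual_iff[OF lcs] by blast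
    have "cont_seminorm E T (\<lambda>f. norm a * p f + norm b * q f)"
      by (intro cont_seminorm_add[OF lcs] cont_seminorm_scale[OF lcs] p q) auto
    moreover have "norm ((fscale a v + fscale b w) f) \<le> norm a * p f + norm b * q f" if "f \<in> E" for f
      unfolding fun_apply using p(2)[OF that] q(2)[OF that]
      by (intro norm_triangle_le add_mono) (auto simp: norm_mult mult_left_mono)
    moreover have "linear_on E (fscale a v + fscale b w)"
      using dual_linear[OF v] dual_linear[OF w] by (simp add: linear_on_def fun_apply algebra_simps)
    moreover have "(fscale a v + fscale b w) f = 0" if "f \<notin> E" for f
      using v w that by (simp add: dual_iff[OF lcs] fun_apply)
    ultimately show ?thesis unfolding dual_iff[OF lcs] by blast
  qed
  have "0 \<in> dual E T"
    unfolding dual_iff[OF lcs] using cont_seminorm_zero[OF lcs]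
    by (auto simp: linear_on_def fun_apply intro!: exI[of _ "\<lambda>f. 0"])
  moreover have "v + w \<in> dual E T" if "v \<in> dual E T" "w \<in> dual E T" for v w using *[OF that, of 1 1] by simp
  moreover have "fscale a v \<in> dual E T" if "v \<in> dual E T" for a v using *[OF that that, of a 0] by simp
  ultimately show ?thesis by (simp add: fun_subspace_def fun_ops)
qed

lemma dual_apply_0: "v \<in> dual E T \<Longrightarrow> v 0 = 0"
  using linear_on_0[OF lcs_subspace[OF lcs] dual_linear] .

lemma dual_bounded_on:
  assumes "lcs_bounded T B" "v \<in> dual E T" shows "\<exists>C. \<forall>f\<in>B. norm (v f) \<le> C"
proof -
  obtain p where p: "cont_seminorm E T p" "\<And>f. f \<in> E \<Longrightarrow> norm (v f) \<le> p f"
    using assms(2) unfolding dual_iff[OF lcs] by blast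
  obtain C where "\<And>f. f \<in> B \<Longrightarrow> p f \<le> C" and "B \<subseteq> E"
    using assms(1) p(1) unfolding lcs_bounded_iff[OF lcs] by blast
  then have "norm (v f) \<le> C" if "f \<in> B" for f using p(2)[of f] that by fastforce
  then show ?thesis by blast
qed

lemma dual_norming:
  assumes p: "cont_seminorm E T p" and f0: "f0 \<in> E"
  shows "\<exists>v\<in>dual E T. (\<forall>f\<in>E. norm (v f) \<le> p f) \<and> p f0 \<le> norm (v f0)"
proof -
  obtain v where v: "linear_on E v" "\<forall>f\<in>E. norm (v f) \<le> p f" "p f0 \<le> norm (v f0)" "\<forall>f. f \<notin> E \<longrightarrow> v f = 0"
    using Hahn_Banach[OF lcs_subspace[OF lcs] cont_seminorm_seminorm[OF lcs p] f0] by (elim exE conjE)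
  then have "v \<in> dual E T" unfolding dual_iff[OF lcs] using p by (intro conjI exI[of _ p])
  then show ?thesis using v(2,3) by (intro bexI[of _ v] conjI)
qed

text \<open>The gauge of the polar of \<open>B\<close>. Inserting 0, where functionals vanish, makes
  the supremum meaningful for empty \<open>B\<close>.\<close>

definition sup_norm_on :: "('d \<Rightarrow> 'k) set \<Rightarrow> (('d \<Rightarrow> 'k) \<Rightarrow> 'k) \<Rightarrow> real" where
  "sup_norm_on B v = (SUP f\<in>insert 0 B. norm (v f))"

lemma sup_norm_on:
  assumes B: "lcs_bounded T B"
  shows sup_norm_on_ge: "v \<in> dual E T \<Longrightarrow> f \<in> B \<Longrightarrow> norm (v f) \<le> sup_norm_on B v"
    and sup_norm_on_le: "v \<in> dual E T \<Longrightarrow> 0 \<le> c \<Longrightarrow> (\<And>f. f \<in> B \<Longrightarrow> norm (v f) \<le> c) \<Longrightarrow> sup_norm_on B v \<le> c"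
    and seminorm_sup_norm_on: "seminorm_on (dual E T) (sup_norm_on B)"
proof -
  note sub = dual_subspace
  have bdd: "bdd_above ((\<lambda>f. norm (v f)) ` insert 0 B)" if v: "v \<in> dual E T" for v
  proof -
    obtain C where "\<And>f. f \<in> B \<Longrightarrow> norm (v f) \<le> C" using dual_bounded_on[OF B v] by blast
    then have "norm (v f) \<le> max 0 C" if "f \<in> insert 0 B" for f
      using that dual_apply_0[OF v] by (auto simp: le_max_iff_disj)
    then show ?thesis by (intro bdd_aboveI2)
  qed
  have ge: "norm (v f) \<le> sup_norm_on B v" if "v \<in> dual E T" "f \<in> insert 0 B" for v f
    unfolding sup_norm_on_def by (rule cSUP_upper[OF that(2) bdd[OF that(1)]])
  have le: "sup_norm_on B v \<le> c" if "v \<in> dual E T" "0 \<le> c" "\<And>f. f \<in> B \<Longrightarrow> norm (v f) \<le> c" for v c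
    unfolding sup_norm_on_def using that by (intro cSUP_least) (auto simp: dual_apply_0)
  have pos: "0 \<le> sup_norm_on B v" if "v \<in> dual E T" for v using ge[OF that, of 0] by (simp add: dual_apply_0 that)
  show "norm (v f) \<le> sup_norm_on B v" if "v \<in> dual E T" "f \<in> B" using ge that by blast
  show "sup_norm_on B v \<le> c" if "v \<in> dual E T" "0 \<le> c" "\<And>f. f \<in> B \<Longrightarrow> norm (v f) \<le> c" using le that by blast
  show "seminorm_on (dual E T) (sup_norm_on B)"
    unfolding seminorm_on_def
  proof (intro conjI ballI allI)
    fix v w assume v: "v \<in> dual E T" and w: "w \<in> dual E T"
    show "sup_norm_on B (v + w) \<le> sup_norm_on B v + sup_norm_on B w"
    proof (rule le)
      fix f assume "f \<in> B"
      then show "norm ((v + w) f) \<le> sup_norm_on B v + sup_norm_on B w"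
        unfolding fun_apply using ge[OF v] ge[OF w] by (intro norm_triangle_le add_mono) auto
    qed (use v w pos in \<open>auto intro: subspace_add[OF sub]\<close>)
  next
    have sc: "sup_norm_on B (fscale c v) \<le> norm c * sup_norm_on B v" if v: "v \<in> dual E T" for c v
    proof (rule le)
      fix f assume "f \<in> B"
      then show "norm (fscale c v f) \<le> norm c * sup_norm_on B v"
        unfolding fun_apply norm_mult using ge[OF v] by (intro mult_left_mono) auto
    qed (use v pos in \<open>auto intro: subspace_scale[OF sub]\<close>)
    fix c v assume v: "v \<in> dual E T"
    show "sup_norm_on B (fscale c v) = norm c * sup_norm_on B v"
    proof (cases "c = 0")
      case True
      have "sup_norm_on B (fscale 0 v) \<le> norm (0::'k) * sup_norm_on B v" by (rule sc[OF v])
      then show ?thesis using True pos[OF subspace_0[OF sub]] by simp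
    next
      case False
      have "sup_norm_on B (fscale (1 / c) (fscale c v)) \<le> norm (1 / c) * sup_norm_on B (fscale c v)"
        by (rule sc[OF subspace_scale[OF sub v]])
      then have "norm c * sup_norm_on B v \<le> sup_norm_on B (fscale c v)"
        using False by (simp add: norm_divide field_simps)
      then show ?thesis using sc[OF v, of c] by simp
    qed
  qed
qed

end

section \<open>Consequences of reflexivity\<close>

context
  fixes E :: "('d \<Rightarrow> 'k::real_normed_field) set" and T
  assumes refl: "reflexive_lcs E T"
begin

lemma reflexive_imp_lcs: "lcs E T"
  using refl by (simp add: reflexive_lcs_def)

text \<open>A bound by \<open>sup_norm_on B\<close> gives continuity for the strong topology, so
  surjectivity of the bidual embedding applies.\<close>

lemma reflexive_eval:
  assumes B: "lcs_bounded T B" and w: "linear_on (dual E T) w" "\<And>v. v \<notin> dual E T \<Longrightarrow> w v = 0"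
    and C: "\<And>v. v \<in> dual E T \<Longrightarrow> norm (w v) \<le> C * sup_norm_on B v"
  shows "\<exists>f\<in>E. w = bidual_embed E T f"
proof -
  note lcs = reflexive_imp_lcs and sub = dual_subspace[OF reflexive_imp_lcs]
  have "openin (strong_dual_top E T) {v \<in> dual E T. w v \<in> S}" if S: "open S" for S
    unfolding openin_strong_dual_top
  proof (intro conjI ballI)
    fix v assume "v \<in> {v \<in> dual E T. w v \<in> S}"
    then have v: "v \<in> dual E T" "w v \<in> S" by auto
    then obtain e where e: "e > 0" "ball (w v) e \<subseteq> S" using S by (meson openE)
    define d where "d = e / (2 * (\<bar>C\<bar> + 1))"
    have d: "d > 0" using e by (simp add: d_def)
    have "w u \<in> S" if u: "u \<in> dual E T" "\<forall>f\<in>B. norm (u f - v f) < d" for u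
    proof -
      have uv: "u - v \<in> dual E T" by (rule subspace_diff[OF sub u(1) v(1)])
      have "sup_norm_on B (u - v) \<le> d"
        using u(2) d by (intro sup_norm_on_le[OF lcs B uv]) (auto simp: fun_apply less_imp_le)
      have "norm (w u - w v) \<le> C * sup_norm_on B (u - v)"
        using C[OF uv] by (simp add: linear_on_diff[OF sub w(1) u(1) v(1)])
      also have "\<dots> \<le> \<bar>C\<bar> * d"
        using \<open>sup_norm_on B (u - v) \<le> d\<close> seminorm_ge_0[OF sub seminorm_sup_norm_on[OF lcs B] uv]
        by (intro mult_mono) auto
      also have "\<dots> < e"
      proof -
        have "\<bar>C\<bar> * d \<le> (\<bar>C\<bar> + 1) * d" using d by (intro mult_right_mono) auto
        also have "\<dots> = e / 2" by (simp add: d_def divide_simps)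
        finally show ?thesis using e(1) by simp
      qed
      finally show ?thesis using e(2) by (auto simp: dist_norm norm_minus_commute subset_iff)
    qed
    then show "\<exists>B e. lcs_bounded T B \<and> e > 0 \<and>
        {w' \<in> dual E T. \<forall>f\<in>B. norm (w' f - v f) < e} \<subseteq> {v \<in> dual E T. w v \<in> S}"
      using B d by (intro exI[of _ B] exI[of _ d]) auto
  qed auto
  then have "continuous_map (strong_dual_top E T) euclidean w"
    by (simp add: continuous_map_def topspace_strong_dual_top)
  moreover have "w (fscale a f + fscale b g) = a * w f + b * w g" if "f \<in> dual E T" "g \<in> dual E T" for a b f g
    using that by (simp add: linear_on_add[OF w(1)] linear_on_scale[OF w(1)] subspace_scale[OF sub])
  ultimately have "w \<in> dual (dual E T) (strong_dual_top E T)"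
    using w(2) by (auto simp: dual_def[of "dual E T"] fun_ops)
  then show ?thesis using refl unfolding reflexive_lcs_def bij_betw_def by blast
qed

text \<open>A strongly bounded \<open>M\<close> has a polar that is a neighbourhood of 0 in the
  bidual; continuity of the embedding pulls it back to \<open>E\<close>.\<close>

lemma reflexive_equicontinuous:
  assumes M: "M \<subseteq> dual E T" and bd: "\<And>B. lcs_bounded T B \<Longrightarrow> \<exists>C. \<forall>v\<in>M. \<forall>f\<in>B. norm (v f) \<le> C"
  shows "\<exists>p. cont_seminorm E T p \<and> (\<forall>v\<in>M. \<forall>f\<in>E. norm (v f) \<le> p f)"
proof -
  note lcs = reflexive_imp_lcs and sub = dual_subspace[OF reflexive_imp_lcs] and subE = lcs_subspace[OF reflexive_imp_lcs]
  let ?TS = "strong_dual_top E T"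
  have "lcs_bounded ?TS M"
    unfolding lcs_bounded_def fun_ops
  proof (intro conjI allI impI)
    show "M \<subseteq> topspace ?TS" using M by (simp add: topspace_strong_dual_top)
    fix U assume U: "openin ?TS U \<and> 0 \<in> U"
    then obtain B e where Be: "lcs_bounded T B" "e > 0" "{w \<in> dual E T. \<forall>f\<in>B. norm (w f - 0 f) < e} \<subseteq> U"
      unfolding openin_strong_dual_top by meson
    obtain C where C: "\<And>v f. v \<in> M \<Longrightarrow> f \<in> B \<Longrightarrow> norm (v f) \<le> C" using bd[OF Be(1)] by blast
    let ?t = "e / (\<bar>C\<bar> + 1)"
    have "fscale c v \<in> U" if c: "norm c \<le> ?t" and v: "v \<in> M" for c v
    proof -
      have "norm (fscale c v f) < e" if f: "f \<in> B" for f
      proof -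
        have "norm (fscale c v f) \<le> ?t * \<bar>C\<bar>"
          unfolding fun_apply norm_mult using c C[OF v f] Be(2) by (intro mult_mono) auto
        also have "\<dots> < ?t * (\<bar>C\<bar> + 1)" using Be(2) by (intro mult_strict_left_mono) (auto simp: add_nonneg_pos)
        finally show ?thesis by simp
      qed
      moreover have "fscale c v \<in> dual E T" using v M by (intro subspace_scale[OF sub]) auto
      ultimately have "fscale c v \<in> {w \<in> dual E T. \<forall>f\<in>B. norm (w f - 0 f) < e}" by (simp add: zero_fun_apply)
      then show ?thesis using Be(3) by blast
    qed
    then show "\<exists>t>0. \<forall>c. norm c \<le> t \<longrightarrow> fscale c ` M \<subseteq> U"
      using Be(2) by (intro exI[of _ ?t]) (auto simp: add_nonneg_pos)
  qed
  then have op: "openin (strong_dual_top (dual E T) ?TS) {w \<in> dual (dual E T) ?TS. \<exists>d<1. \<forall>v\<in>M. norm (w v) \<le> d}"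
    (is "openin ?TSS ?W") by (rule openin_strong_polar)
  have cm: "continuous_map T ?TSS (bidual_embed E T)"
    using refl by (auto simp: reflexive_lcs_def homeomorphic_imp_continuous_map)
  have op': "openin T {f \<in> topspace T. bidual_embed E T f \<in> ?W}"
    by (rule openin_continuous_map_preimage[OF cm op])
  have "bidual_embed E T 0 \<in> dual (dual E T) ?TS"
    using cm subspace_0[OF subE] unfolding continuous_map_def topspace_strong_dual_top lcs_topspace[OF lcs] by blast
  moreover have "norm (bidual_embed E T 0 v) \<le> 0" if "v \<in> M" for v
    using that M dual_apply_0[OF lcs, of v] by (auto simp: bidual_embed_def)
  ultimately have "0 \<in> {f \<in> topspace T. bidual_embed E T f \<in> ?W}"
    using subspace_0[OF subE] by (auto simp: lcs_topspace[OF lcs] intro!: exI[of _ 0])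
  then obtain p where p: "cont_seminorm E T p" "{f \<in> E. p f < 1} \<subseteq> {f \<in> topspace T. bidual_embed E T f \<in> ?W}"
    using ex_cont_seminorm_subset[OF lcs op'] by blast
  have "norm (v f) \<le> 1 * (2 * p f)" if v: "v \<in> M" and f: "f \<in> E" for v f
  proof (rule seminorm_dominated[OF subE _ _ _ f])
    show "seminorm_on E (\<lambda>f. 2 * p f)" by (rule seminorm_on_scale[OF subE cont_seminorm_seminorm[OF lcs p(1)]]) simp
    show "seminorm_on E (\<lambda>f. norm (v f))" using v M by (intro seminorm_on_linear[OF subE] dual_linear[OF lcs]) auto
    fix g assume g: "g \<in> E" "2 * p g \<le> 1"
    then have "bidual_embed E T g \<in> ?W" using p(2) by auto
    then obtain d where d: "d < 1" "\<forall>v\<in>M. norm (bidual_embed E T g v) \<le> d" by blast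
    have "norm (v g) = norm (bidual_embed E T g v)" using v M by (auto simp: bidual_embed_def)
    also have "\<dots> \<le> d" using d(2) v by blast
    finally show "norm (v g) \<le> 1" using d(1) by simp
  qed
  then show ?thesis
    using cont_seminorm_scale[OF lcs p(1), of 2] by (intro exI[of _ "\<lambda>f. 2 * p f"]) auto
qed

text \<open>Banach--Mackey: by reflexivity the functionals on the dual that are bounded on the polar of a
  bounded set come from \<open>E\<close>, and they form a Banach space, to which uniform boundedness applies.\<close>

lemma reflexive_pointwise_bounded:
  assumes M: "M \<subseteq> dual E T" and bd: "\<And>f. f \<in> E \<Longrightarrow> \<exists>C. \<forall>v\<in>M. norm (v f) \<le> C"
    and B: "lcs_bounded T B"
  shows "\<exists>C. \<forall>v\<in>M. \<forall>f\<in>B. norm (v f) \<le> C"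
proof -
  note lcs = reflexive_imp_lcs and sub = dual_subspace[OF reflexive_imp_lcs]
  note q = seminorm_sup_norm_on[OF lcs B]
  let ?X = "functional_space (dual E T) (sup_norm_on B)" and ?N = "functional_norm (dual E T) (sup_norm_on B)"
  have sc: "sup_closed ?X (normed_family ?X ?N)"
    by (rule barrelled_family_sup_closed[OF frechet_barrelled_family[OF frechet_functional_space[OF sub q]]])
  have "\<exists>C. \<forall>v\<in>M. norm (w v) \<le> C" if w: "w \<in> ?X" for w
  proof -
    obtain C where "\<And>v. v \<in> dual E T \<Longrightarrow> norm (w v) \<le> C * sup_norm_on B v"
      using w unfolding functional_space_def by blast
    then obtain f where f: "f \<in> E" "w = bidual_embed E T f"
      using reflexive_eval[OF B, of w C] w unfolding functional_space_def by blast
    obtain C where "\<And>v. v \<in> M \<Longrightarrow> norm (v f) \<le> C" using bd[OF f(1)] by blast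
    then show ?thesis using M by (intro exI[of _ C]) (auto simp: f(2) bidual_embed_def)
  qed
  then have "\<exists>s. normed_family ?X ?N s \<and> (\<forall>v\<in>M. \<forall>w\<in>?X. norm (w v) \<le> s w)"
    using seminorm_eval[OF sub q] M by (intro sup_closedD[OF sc]) auto
  then obtain s where s: "normed_family ?X ?N s" "\<And>v w. v \<in> M \<Longrightarrow> w \<in> ?X \<Longrightarrow> norm (w v) \<le> s w"
    by blast
  obtain C where C: "\<And>w. w \<in> ?X \<Longrightarrow> s w \<le> C * ?N w" using s(1) unfolding normed_family_def by blast
  have "norm (v f) \<le> \<bar>C\<bar>" if v: "v \<in> M" and f: "f \<in> B" for v f
  proof -
    have fE: "f \<in> E" using B f lcs_bounded_iff[OF lcs] by blast
    let ?w = "bidual_embed E T f"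
    have b: "norm (?w v) \<le> 1 * sup_norm_on B v" if "v \<in> dual E T" for v
      using sup_norm_on_ge[OF lcs B that f] that by (simp add: bidual_embed_def)
    moreover have "linear_on (dual E T) ?w"
      by (auto simp: linear_on_def bidual_embed_def subspace_add[OF sub] subspace_scale[OF sub] fun_apply)
    moreover have "?w v = 0" if "v \<notin> dual E T" for v using that by (simp add: bidual_embed_def)
    ultimately have w: "?w \<in> ?X" unfolding functional_space_def by blast
    \<comment> \<open>Evaluation at a point of \<open>B\<close> has norm at most 1, so one constant
      serves all of \<open>B\<close>.\<close>
    have N: "?N ?w \<le> 1" by (rule functional_norm_le[OF sub q _ b]) simp
    have "norm (v f) = norm (?w v)" using v M by (auto simp: bidual_embed_def)
    also have "\<dots> \<le> C * ?N ?w" using s(2)[OF v w] C[OF w] by simp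
    also have "\<dots> \<le> \<bar>C\<bar> * 1" using N functional_norm_ge_0[OF sub q w] by (intro mult_mono) auto
    finally show ?thesis by simp
  qed
  then show ?thesis by blast
qed

text \<open>By Hahn--Banach each seminorm in \<open>S\<close> is a supremum of functionals; the
  union of these sets of functionals is pointwise bounded, hence strongly bounded and
  equicontinuous.\<close>

lemma reflexive_sup_closed: "sup_closed E (cont_seminorm E T)"
  unfolding sup_closed_def
proof (intro allI impI)
  note lcs = reflexive_imp_lcs
  fix S assume S: "\<forall>t\<in>S. cont_seminorm E T t" and bd: "\<forall>h\<in>E. \<exists>C. \<forall>t\<in>S. t h \<le> C"
  define M where "M = {v \<in> dual E T. \<exists>t\<in>S. \<forall>f\<in>E. norm (v f) \<le> t f}"
  have ME: "M \<subseteq> dual E T" by (auto simp: M_def)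
  have "\<exists>C. \<forall>v\<in>M. norm (v f) \<le> C" if f: "f \<in> E" for f
  proof -
    obtain C where "\<And>t. t \<in> S \<Longrightarrow> t f \<le> C" using bd f by blast
    then show ?thesis using f unfolding M_def by (intro exI[of _ C]) fastforce
  qed
  then have "\<exists>C. \<forall>v\<in>M. \<forall>f\<in>B. norm (v f) \<le> C" if "lcs_bounded T B" for B
    using reflexive_pointwise_bounded[OF ME _ that] by blast
  then obtain p where p: "cont_seminorm E T p" "\<And>v f. v \<in> M \<Longrightarrow> f \<in> E \<Longrightarrow> norm (v f) \<le> p f"
    using reflexive_equicontinuous[OF ME] by blast
  have "t f \<le> p f" if t: "t \<in> S" and f: "f \<in> E" for t f
  proof -
    obtain v where v: "v \<in> dual E T" "\<forall>f\<in>E. norm (v f) \<le> t f" "t f \<le> norm (v f)"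
      using dual_norming[OF lcs bspec[OF S t] f] by blast
    then have "v \<in> M" using t by (auto simp: M_def)
    then show ?thesis using v(3) p(2)[of v f] f by simp
  qed
  then show "\<exists>s. cont_seminorm E T s \<and> (\<forall>t\<in>S. \<forall>h\<in>E. t h \<le> s h)" using p(1) by blast
qed

end

section \<open>Closed graph theorems and separately continuous bilinear maps\<close>

text \<open>Metrizability supplies a countable base at 0 and thus countably many gauges; partial
  sums of their multiples form the increasing sequence.\<close>

lemma frechet_space_family:
  assumes fr: "frechet_space E T" shows "\<exists>p. frechet_family E (cont_seminorm E T) p"
proof -
  have lcs: "lcs E T" and met: "metrizable_space T" and comp: "complete_lcs T"
    using fr by (auto simp: frechet_space_def)
  note sub = lcs_subspace[OF lcs] and top = lcs_topspace[OF lcs] and sn = cont_seminorm_seminorm[OF lcs]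
  obtain B where B: "countable B" "\<And>V. V \<in> B \<Longrightarrow> openin T V"
    "\<And>U. openin T U \<Longrightarrow> 0 \<in> U \<Longrightarrow> \<exists>V\<in>B. 0 \<in> V \<and> V \<subseteq> U"
    using metrizable_imp_first_countable[OF met] subspace_0[OF sub] unfolding first_countable_def top by meson
  define B' where "B' = {V \<in> B. 0 \<in> V}"
  have B': "countable B'" "B' \<noteq> {}"
    using B(1) B(3)[of E] openin_topspace[of T] subspace_0[OF sub] by (auto simp: B'_def top)
  have "\<exists>p. cont_seminorm E T p \<and> {f \<in> E. p f < 1} \<subseteq> V" if "V \<in> B'" for V
    using that B(2) by (intro ex_cont_seminorm_subset[OF lcs]) (auto simp: B'_def)
  then have "\<exists>p. cont_seminorm E T p \<and> {f \<in> E. p f < 1} \<subseteq> from_nat_into B' n" for n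
    using from_nat_into[OF B'(2)] by blast
  then obtain q where q: "\<And>n. cont_seminorm E T (q n)" "\<And>n. {f \<in> E. q n f < 1} \<subseteq> from_nat_into B' n" by metis
  \<comment> \<open>The factor 2 moves the closed unit ball of a summand into the open unit ball of
    \<open>q i\<close>.\<close>
  define p where "p n f = (\<Sum>i\<le>n. 2 * q i f)" for n f
  have p: "cont_seminorm E T (p n)" for n
    unfolding p_def by (intro cont_seminorm_sum[OF lcs] cont_seminorm_scale[OF lcs] q) simp
  have q0: "q n f \<ge> 0" if "f \<in> E" for n f by (rule seminorm_ge_0[OF sub sn[OF q(1)] that])
  have mono: "p m f \<le> p n f" if "f \<in> E" "m \<le> n" for m n f
    unfolding p_def using that q0[OF that(1)] by (intro sum_mono2) auto
  have dom: "\<exists>n. \<forall>f\<in>E. t f \<le> p n f" if t: "cont_seminorm E T t" for t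
  proof -
    have "openin T {f \<in> E. t (f - 0) < 1}" by (rule openin_seminorm_ball[OF lcs t subspace_0[OF sub]])
    moreover have "0 \<in> {f \<in> E. t (f - 0) < 1}" using subspace_0[OF sub] seminorm_0[OF sub sn[OF t]] by simp
    ultimately obtain V where V: "V \<in> B'" "V \<subseteq> {f \<in> E. t (f - 0) < 1}" using B(3) unfolding B'_def by blast
    obtain n where n: "from_nat_into B' n = V" using V(1) B'(1) by (metis from_nat_into_to_nat_on)
    have "t f \<le> p n f" if f: "f \<in> E" for f
    proof -
      have "t f \<le> 1 * (2 * q n f)"
      proof (rule seminorm_dominated[OF sub seminorm_on_scale[OF sub sn[OF q(1)]] sn[OF t] _ f])
        fix g assume g: "g \<in> E" "2 * q n g \<le> 1"
        then have "g \<in> {f \<in> E. q n f < 1}" by simp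
        then have "g \<in> {f \<in> E. t (f - 0) < 1}" using q(2)[of n] n V(2) by blast
        then show "t g \<le> 1" by simp
      qed simp
      also have "1 * (2 * q n f) \<le> p n f"
        unfolding p_def using member_le_sum[of n "{..n}" "\<lambda>i. 2 * q i f"] q0[OF f] by simp
      finally show ?thesis .
    qed
    then show ?thesis by blast
  qed
  have compl: "\<exists>f\<in>E. \<forall>n. (\<lambda>k. p n (s k - f)) \<longlonglongrightarrow> 0"
    if s: "\<And>n. s n \<in> E" and le: "\<And>n. p n (s (Suc n) - s n) \<le> (1 / 2) ^ n" for s
  proof -
    have tb: "p n (s n - s (n + k)) \<le> 2 * 1 * (1 / 2) ^ n" for n k
      by (rule telescoping_bound[OF sub sn[OF p] mono s]) (simp_all add: le)
    \<comment> \<open>Completeness of a topology is formulated by filters, so the sequence is turned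
      into its tail filter.\<close>
    let ?F = "filtermap s sequentially"
    have "cauchy_filter T ?F"
      unfolding cauchy_filter_def fun_ops
    proof (intro conjI allI impI)
      show "?F \<noteq> bot" by (simp add: filtermap_bot_iff)
      show "eventually (\<lambda>f. f \<in> topspace T) ?F" by (simp add: eventually_filtermap top s)
      fix U assume U: "openin T U \<and> 0 \<in> U"
      then obtain t where t: "cont_seminorm E T t" "{f \<in> E. t f < 1} \<subseteq> U"
        using ex_cont_seminorm_subset[OF lcs] by blast
      obtain m where m: "\<And>f. f \<in> E \<Longrightarrow> t f \<le> p m f" using dom[OF t(1)] by blast
      have "(\<lambda>n. 4 * (1 / 2 :: real) ^ n) \<longlonglongrightarrow> 4 * 0" by (intro tendsto_intros LIMSEQ_power_zero) simp
      then have "eventually (\<lambda>n. 4 * (1 / 2 :: real) ^ n < 1) sequentially" by (rule order_tendstoD(2)) simp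
      then obtain N0 where N0: "\<And>n. n \<ge> N0 \<Longrightarrow> 4 * (1 / 2 :: real) ^ n < 1" unfolding eventually_sequentially by blast
      define N where "N = max N0 m"
      have bd: "p m (s N - s k) \<le> 2 * (1 / 2) ^ N" if "k \<ge> N" for k
      proof -
        have "p m (s N - s k) \<le> p N (s N - s k)" by (intro mono subspace_diff[OF sub] s) (simp add: N_def)
        then show ?thesis using tb[of N "k - N"] that by simp
      qed
      have "s k - s l \<in> U" if "k \<ge> N" "l \<ge> N" for k l
      proof -
        have "p m (s k - s l) \<le> p m (s k - s N) + p m (s N - s l)" by (intro seminorm_triangle3[OF sub sn[OF p]] s)
        also have "p m (s k - s N) = p m (s N - s k)" by (intro seminorm_commute[OF sub sn[OF p]] s)
        finally have "p m (s k - s l) \<le> 4 * (1 / 2) ^ N" using bd[OF that(1)] bd[OF that(2)] by simp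
        also have "\<dots> < 1" by (rule N0) (simp add: N_def)
        finally have "t (s k - s l) < 1" using m[OF subspace_diff[OF sub s s], of k l] by simp
        then show ?thesis using t(2) subspace_diff[OF sub s s] by blast
      qed
      then show "eventually (\<lambda>(f, g). f - g \<in> U) (?F \<times>\<^sub>F ?F)"
        unfolding eventually_prod_filter eventually_filtermap
        by (intro exI[of _ "\<lambda>f. \<exists>k\<ge>N. f = s k"] conjI) (auto simp: eventually_sequentially)
    qed
    then obtain h where h: "h \<in> E" "limitin T (\<lambda>f. f) h ?F" using comp unfolding complete_lcs_def top by blast
    have "(\<lambda>k. p n (s k - h)) \<longlonglongrightarrow> 0" for n
    proof (rule LIMSEQ_I)
      fix e :: real assume e: "e > 0"
      have "openin T {f \<in> E. p n (f - h) < e}" by (rule openin_seminorm_ball[OF lcs p h(1)])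
      moreover have "h \<in> {f \<in> E. p n (f - h) < e}" using h(1) e by (simp add: seminorm_0[OF sub sn[OF p]])
      ultimately have "eventually (\<lambda>f. f \<in> {f \<in> E. p n (f - h) < e}) ?F"
        using h(2) unfolding limitin_def by blast
      then obtain N where "\<And>k. k \<ge> N \<Longrightarrow> p n (s k - h) < e"
        unfolding eventually_filtermap eventually_sequentially by blast
      then show "\<exists>N. \<forall>k\<ge>N. norm (p n (s k - h) - 0) < e"
        using seminorm_ge_0[OF sub sn[OF p] subspace_diff[OF sub s h(1)]] by (intro exI[of _ N]) simp
    qed
    then show ?thesis using h(1) by blast
  qed
  have "frechet_family E (cont_seminorm E T) p"
    unfolding frechet_family_def
    using seminorm_family_lcs[OF lcs] p mono dom compl by (intro conjI allI impI ballI) auto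
  then show ?thesis by blast
qed

text \<open>The functionals on the target whose composition with \<open>u\<close> is continuous form a subspace of the
  dual that is closed under strong convergence of sequences, hence closed because the dual of a DF
  space is metrizable, and that contains the point evaluations. By Hahn--Banach and reflexivity it is
  the whole dual.\<close>

theorem closed_graph_reflexive_DF:
  assumes fam: "seminorm_family H P" and sc: "sup_closed H P"
    and refl: "reflexive_lcs F T" and DF: "DF_space F T"
    and u: "linear_map_on H u" "\<And>h. h \<in> H \<Longrightarrow> u h \<in> F"
    and ptu: "\<And>x. \<exists>s. P s \<and> (\<forall>h\<in>H. norm (u h x) \<le> s h)"
    and ptF: "\<And>x. \<exists>q. cont_seminorm F T q \<and> (\<forall>f\<in>F. norm (f x) \<le> q f)"
    and q: "cont_seminorm F T q"
  shows "P (\<lambda>h. q (u h))"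
proof -
  note lcs = reflexive_imp_lcs[OF refl]
  note subF = lcs_subspace[OF lcs] and subD = dual_subspace[OF lcs] and H = seminorm_familyD(1)[OF fam]
  obtain B :: "nat \<Rightarrow> _" where B: "\<And>n. lcs_bounded T (B n)" "\<And>A. lcs_bounded T A \<Longrightarrow> \<exists>n. A \<subseteq> B n"
    using DF unfolding DF_space_def by blast
  have comp: "seminorm_on H (\<lambda>h. norm (v (u h)))" if "v \<in> dual F T" for v
    by (rule seminorm_on_comp[OF u seminorm_on_linear[OF subF dual_linear[OF lcs that]]])
  have point: "\<exists>k. f \<in> B k" if f: "f \<in> F" for f
    using B(2)[of "{f}"] f by (auto simp: lcs_bounded_iff[OF lcs])
  define N where "N = {v \<in> dual F T. P (\<lambda>h. norm (v (u h)))}"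
  have N: "fun_subspace N" "N \<subseteq> dual F T"
  proof -
    show "N \<subseteq> dual F T" by (auto simp: N_def)
    show "fun_subspace N"
      unfolding fun_subspace_def fun_ops
    proof (intro conjI ballI allI)
      show "0 \<in> N" using subspace_0[OF subD] seminorm_familyD(3)[OF fam] by (simp add: N_def zero_fun_apply)
    next
      fix v w assume v: "v \<in> N" and w: "w \<in> N"
      have vw: "v + w \<in> dual F T" using v w by (intro subspace_add[OF subD]) (auto simp: N_def)
      have s: "P (\<lambda>h. norm (v (u h)) + norm (w (u h)))"
        using v w by (intro seminorm_familyD(4)[OF fam]) (auto simp: N_def)
      have "P (\<lambda>h. norm ((v + w) (u h)))"
        by (rule seminorm_familyD(5)[OF fam s comp[OF vw], of 1]) (simp add: fun_apply norm_triangle_ineq)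
      then show "v + w \<in> N" using vw by (simp add: N_def)
    next
      fix c v assume v: "v \<in> N"
      have cv: "fscale c v \<in> dual F T" using v by (intro subspace_scale[OF subD]) (auto simp: N_def)
      have s: "P (\<lambda>h. norm (v (u h)))" using v by (simp add: N_def)
      have "P (\<lambda>h. norm (fscale c v (u h)))"
        by (rule seminorm_familyD(5)[OF fam s comp[OF cv], of "norm c"]) (simp add: fun_apply norm_mult)
      then show "fscale c v \<in> N" using cv by (simp add: N_def)
    qed
  qed
  have all: "v0 \<in> N" if v0: "v0 \<in> dual F T" for v0
  \<comment> \<open>The question is whether \<open>v0\<close> is a limit of elements of
    \<open>N\<close>, uniformly on each \<open>B k\<close>; the fundamental sequence of bounded sets
    reduces strong closure to sequences.\<close>
  proof (cases "\<forall>n. \<exists>v\<in>N. \<forall>k\<le>n. \<forall>f\<in>B k. norm (v0 f - v f) \<le> 1 / real (Suc n)")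
    case True
    then obtain v where v: "\<And>n. v n \<in> N" "\<And>n k f. k \<le> n \<Longrightarrow> f \<in> B k \<Longrightarrow> norm (v0 f - v n f) \<le> 1 / real (Suc n)"
      by metis
    have "\<exists>C. \<forall>n\<in>UNIV. norm (v n (u h)) \<le> C" if h: "h \<in> H" for h
    proof -
      obtain k where k: "u h \<in> B k" using point[OF u(2)[OF h]] by blast
      \<comment> \<open>Since \<open>u h \<in> B k\<close>, closeness to \<open>v0\<close> holds
        from index \<open>k\<close> on; the finitely many earlier values are added up.\<close>
      have "norm (v n (u h)) \<le> max (norm (v0 (u h)) + 1) (\<Sum>i<k. norm (v i (u h)))" for n
      proof (cases "n < k")
        case True
        then show ?thesis using member_le_sum[of n "{..<k}" "\<lambda>i. norm (v i (u h))"] by simp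
      next
        case False
        then have "norm (v0 (u h) - v n (u h)) \<le> 1 / real (Suc n)" using v(2)[OF _ k, of n] by simp
        also have "\<dots> \<le> 1" by simp
        finally show ?thesis using norm_triangle_ineq2[of "v n (u h)" "v0 (u h)"] by (simp add: norm_minus_commute)
      qed
      then show ?thesis by blast
    qed
    then have "\<exists>s. P s \<and> (\<forall>n\<in>UNIV. \<forall>h\<in>H. norm (v n (u h)) \<le> s h)"
      using v(1) unfolding N_def by (intro sup_closedD[OF sc]) auto
    then obtain s where s: "P s" "\<And>n h. h \<in> H \<Longrightarrow> norm (v n (u h)) \<le> s h" by blast
    have "norm (v0 (u h)) \<le> 1 * s h" if h: "h \<in> H" for h
    proof -
      obtain k where k: "u h \<in> B k" using point[OF u(2)[OF h]] by blast
      have "norm (v0 (u h)) \<le> s h + 1 / real (Suc n)" if "n \<ge> k" for n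
        using v(2)[OF that k] s(2)[OF h, of n] norm_triangle_ineq2[of "v0 (u h)" "v n (u h)"] by linarith
      moreover have "(\<lambda>n. s h + 1 / real (Suc n)) \<longlonglongrightarrow> s h + 0"
        by (intro tendsto_intros LIMSEQ_Suc[OF lim_1_over_n])
      ultimately show ?thesis by (intro LIMSEQ_le_const[of _ "1 * s h"]) auto
    qed
    then have "P (\<lambda>h. norm (v0 (u h)))" by (rule seminorm_familyD(5)[OF fam s(1) comp[OF v0]])
    then show ?thesis using v0 by (simp add: N_def)
  next
    case False
    then obtain n where n: "\<And>v. v \<in> N \<Longrightarrow> \<exists>k\<le>n. \<exists>f\<in>B k. 1 / real (Suc n) < norm (v0 f - v f)"
      by (meson not_le)
    \<comment> \<open>Failure at \<open>n\<close> means that \<open>v0\<close> has positive distance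
      from \<open>N\<close> in the seminorm \<open>sup_norm_on A\<close>.\<close>
    define A where "A = (\<Union>k\<le>n. B k)"
    have A: "lcs_bounded T A"
      unfolding A_def
    proof (induction n)
      case (Suc n)
      then show ?case using B(1) by (simp add: atMost_Suc lcs_bounded_Un)
    qed (simp add: B)
    note q = seminorm_sup_norm_on[OF lcs A]
    let ?d = "\<lambda>v. INF w\<in>N. sup_norm_on A (v - w)"
    note d = quotient_seminorm[OF subD q N]
    have pos: "1 / real (Suc n) \<le> ?d v0"
    proof (rule d(4)[OF v0])
      fix w assume w: "w \<in> N"
      then obtain f where f: "f \<in> A" "1 / real (Suc n) < norm (v0 f - w f)" using n unfolding A_def by blast
      moreover have "norm ((v0 - w) f) \<le> sup_norm_on A (v0 - w)"
        using w N(2) v0 by (intro sup_norm_on_ge[OF lcs A] subspace_diff[OF subD] f(1)) auto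
      ultimately show "1 / real (Suc n) \<le> sup_norm_on A (v0 - w)" by (simp add: fun_apply)
    qed
    obtain w where w: "linear_on (dual F T) w" "\<And>v. v \<in> dual F T \<Longrightarrow> norm (w v) \<le> ?d v"
      "?d v0 \<le> norm (w v0)" "\<And>v. v \<notin> dual F T \<Longrightarrow> w v = 0"
      using Hahn_Banach[OF subD d(1) v0] by (elim exE conjE) blast
    have "norm (w v) \<le> 1 * sup_norm_on A v" if "v \<in> dual F T" for v
      using w(2)[OF that] d(2)[OF that] by simp
    then obtain f where f: "f \<in> F" "w = bidual_embed F T f" using reflexive_eval[OF refl A w(1,4)] by blast
    \<comment> \<open>The functional separating \<open>v0\<close> from \<open>N\<close> is
      evaluation at some \<open>f\<close>; it annihilates the point evaluations, which lie in
      \<open>N\<close>, so \<open>f = 0\<close>.\<close>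
    have "f x = 0" for x
    proof -
      let ?e = "\<lambda>f. if f \<in> F then f x else 0"
      obtain p where "cont_seminorm F T p" "\<forall>f\<in>F. norm (f x) \<le> p f" using ptF by blast
      then have e: "?e \<in> dual F T"
        unfolding dual_iff[OF lcs]
        by (auto simp: linear_on_def subspace_add[OF subF] subspace_scale[OF subF] fun_apply)
      obtain s where s: "P s" "\<forall>h\<in>H. norm (u h x) \<le> s h" using ptu by blast
      have "P (\<lambda>h. norm (?e (u h)))"
        by (rule seminorm_familyD(5)[OF fam s(1) comp[OF e], of 1]) (use s(2) u(2) in auto)
      then have "?e \<in> N" using e by (simp add: N_def)
      then have "norm (w ?e) \<le> 0" using w(2)[OF e] d(3) by simp
      then show "f x = 0" using f e by (simp add: bidual_embed_def)
    qed
    then have "f = 0" by (simp add: fun_eq_iff zero_fun_apply)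
    then have "w v0 = 0" using f(2) dual_apply_0[OF lcs v0] v0 by (simp add: bidual_embed_def)
    then have "?d v0 \<le> 0" using w(3) by simp
    moreover have "0 < 1 / real (Suc n)" by simp
    ultimately show ?thesis using pos by linarith
  qed
  \<comment> \<open>Continuity of every \<open>v \<circ> u\<close> is lifted to
    \<open>q \<circ> u\<close> by uniform boundedness over the polar of \<open>q\<close>.\<close>
  define M where "M = {v \<in> dual F T. \<forall>f\<in>F. norm (v f) \<le> q f}"
  have "\<exists>C. \<forall>v\<in>M. norm (v (u h)) \<le> C" if "h \<in> H" for h
    using u(2)[OF that] by (intro exI[of _ "q (u h)"]) (auto simp: M_def)
  moreover have "P (\<lambda>h. norm (v (u h)))" if "v \<in> M" for v using all[of v] that by (simp add: M_def N_def)
  ultimately have "\<exists>s. P s \<and> (\<forall>v\<in>M. \<forall>h\<in>H. norm (v (u h)) \<le> s h)" by (intro sup_closedD[OF sc])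
  then obtain s where s: "P s" "\<And>v h. v \<in> M \<Longrightarrow> h \<in> H \<Longrightarrow> norm (v (u h)) \<le> s h" by blast
  have le: "q (u h) \<le> 1 * s h" if h: "h \<in> H" for h
  proof -
    obtain v where v: "v \<in> dual F T" "\<forall>f\<in>F. norm (v f) \<le> q f" "q (u h) \<le> norm (v (u h))"
      using dual_norming[OF lcs q u(2)[OF h]] by blast
    then have "v \<in> M" by (simp add: M_def)
    then show ?thesis using s(2)[of v h] h v(3) by simp
  qed
  have "seminorm_on H (\<lambda>h. q (u h))" by (rule seminorm_on_comp[OF u cont_seminorm_seminorm[OF lcs q]])
  from seminorm_familyD(5)[OF fam, OF s(1) this le] show ?thesis .
qed

theorem closed_graph:
  assumes bar: "barrelled_family H P"
    and F: "frechet_space F T \<or> (reflexive_lcs F T \<and> DF_space F T)"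
    and u: "linear_map_on H u" "\<And>h. h \<in> H \<Longrightarrow> u h \<in> F"
    and ptu: "\<And>x. \<exists>s. P s \<and> (\<forall>h\<in>H. norm (u h x) \<le> s h)"
    and ptF: "\<And>x. \<exists>q. cont_seminorm F T q \<and> (\<forall>f\<in>F. norm (f x) \<le> q f)"
    and q: "cont_seminorm F T q"
  shows "P (\<lambda>h. q (u h))"
  using F
proof
  assume "frechet_space F T"
  then obtain p where p: "frechet_family F (cont_seminorm F T) p" using frechet_space_family by blast
  show ?thesis by (rule closed_graph_frechet[OF bar p, OF u ptu ptF q])
next
  assume "reflexive_lcs F T \<and> DF_space F T"
  then have "reflexive_lcs F T" "DF_space F T" by auto
  moreover have "seminorm_family H P" using bar by (simp add: barrelled_family_def)
  ultimately show ?thesis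
    using closed_graph_reflexive_DF[OF _ barrelled_family_sup_closed[OF bar] _ _ u ptu ptF q] by blast
qed

section \<open>Joint bounds for separately continuous bilinear maps\<close>

lemma bilinear_dominated:
  assumes F: "fun_subspace F" and G: "fun_subspace G" and p: "seminorm_on F p" and q: "seminorm_on G q"
    and bF: "\<And>g. g \<in> G \<Longrightarrow> seminorm_on F (\<lambda>f. b f g)" and bG: "\<And>f. f \<in> F \<Longrightarrow> seminorm_on G (\<lambda>g. b f g)"
    and le: "\<And>f g. f \<in> F \<Longrightarrow> g \<in> G \<Longrightarrow> p f \<le> 1 \<Longrightarrow> q g \<le> 1 \<Longrightarrow> b f g \<le> C"
    and f: "f \<in> F" and g: "g \<in> G"
  shows "b f g \<le> C * p f * q g"
proof -
  have "b f g' \<le> C * p f" if "g' \<in> G" "q g' \<le> 1" for g'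
    by (rule seminorm_dominated[OF F p bF[OF that(1)] _ f]) (use le that in auto)
  then show ?thesis by (rule seminorm_dominated[OF G q bG[OF f] _ g])
qed

text \<open>If no pair of equal indices worked, a sequence \<open>g n\<close> with
  \<open>q n (g n) \<le> 1\<close> would be bounded against every \<open>h\<close>, and uniform
  boundedness on \<open>F\<close> would bound \<open>b (f n) (g n)\<close>.\<close>

lemma separately_continuous_frechet:
  fixes b :: "('x \<Rightarrow> 'k::real_normed_field) \<Rightarrow> ('y \<Rightarrow> 'k) \<Rightarrow> real"
  assumes F: "frechet_family F P p" and G: "frechet_family G Q q"
    and bF: "\<And>g. g \<in> G \<Longrightarrow> P (\<lambda>f. b f g)" and bG: "\<And>f. f \<in> F \<Longrightarrow> Q (\<lambda>g. b f g)"
  shows "\<exists>s t. P s \<and> Q t \<and> (\<forall>f\<in>F. \<forall>g\<in>G. b f g \<le> s f * t g)"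
proof -
  note DF = frechet_familyD[OF F] and DG = frechet_familyD[OF G]
  note monoF = frechet_family_mono[OF F] and monoG = frechet_family_mono[OF G]
  note subF = seminorm_familyD(1)[OF DF(1)] and snF = seminorm_familyD(2)[OF DF(1)]
  note subG = seminorm_familyD(1)[OF DG(1)] and snG = seminorm_familyD(2)[OF DG(1)]
  have "\<exists>n::nat. \<forall>f\<in>F. \<forall>g\<in>G. p n f \<le> 1 \<longrightarrow> q n g \<le> 1 \<longrightarrow> b f g \<le> real n"
  proof (rule ccontr)
    assume "\<not> ?thesis"
    then have "\<forall>n. \<exists>f g. f \<in> F \<and> g \<in> G \<and> p n f \<le> 1 \<and> q n g \<le> 1 \<and> real n < b f g" by (meson not_le)
    then obtain f g where fg: "\<And>n. f n \<in> F" "\<And>n. g n \<in> G" "\<And>n. p n (f n) \<le> 1" "\<And>n. q n (g n) \<le> 1"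
      "\<And>n. real n < b (f n) (g n)" by metis
    have "\<exists>C. \<forall>n\<in>UNIV. b h (g n) \<le> C" if h: "h \<in> F" for h
    proof -
      obtain k where k: "\<And>g. g \<in> G \<Longrightarrow> b h g \<le> q k g" using DG(4)[OF bG[OF h]] by blast
      have pos: "0 \<le> b h (g n)" for n by (rule seminorm_ge_0[OF subG snG[OF bG[OF h]] fg(2)])
      have "b h (g n) \<le> max 1 (\<Sum>i<k. b h (g i))" for n
      proof (cases "n < k")
        case True
        then show ?thesis using member_le_sum[of n "{..<k}" "\<lambda>i. b h (g i)"] pos by simp
      next
        case False
        then show ?thesis using k[OF fg(2), of n] monoG[OF fg(2), of k n n] fg(4)[of n] by simp
      qed
      then show ?thesis by blast
    qed
    then have "\<exists>s. P s \<and> (\<forall>n\<in>UNIV. \<forall>h\<in>F. b h (g n) \<le> s h)"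
      using bF[OF fg(2)] by (intro sup_closedD[OF barrelled_family_sup_closed[OF frechet_barrelled_family[OF F]]]) auto
    then obtain s where s: "P s" "\<And>n h. h \<in> F \<Longrightarrow> b h (g n) \<le> s h" by blast
    obtain k where k: "\<And>f. f \<in> F \<Longrightarrow> s f \<le> p k f" using DF(4)[OF s(1)] by blast
    \<comment> \<open>At least \<open>k\<close> for monotonicity of the seminorms, and at least 1 to
      contradict \<open>real n < 1\<close>.\<close>
    define n where "n = max k 1"
    have "real n < b (f n) (g n)" by (rule fg(5))
    also have "\<dots> \<le> s (f n)" by (rule s(2)[OF fg(1)])
    also have "\<dots> \<le> p k (f n)" by (rule k[OF fg(1)])
    also have "\<dots> \<le> p n (f n)" by (rule monoF[OF fg(1)]) (simp add: n_def)
    also have "\<dots> \<le> 1" by (rule fg(3))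
    finally show False by (simp add: n_def)
  qed
  then obtain n :: nat where n: "\<And>f g. f \<in> F \<Longrightarrow> g \<in> G \<Longrightarrow> p n f \<le> 1 \<Longrightarrow> q n g \<le> 1 \<Longrightarrow> b f g \<le> real n" by blast
  have "b f g \<le> real n * p n f * q n g" if "f \<in> F" "g \<in> G" for f g
    by (rule bilinear_dominated[OF subF subG snF[OF DF(2)] snG[OF DG(2)] snF[OF bF] snG[OF bG] n that])
  moreover have "P (\<lambda>f. real n * p n f)" by (rule seminorm_family_scale[OF DF(1), OF DF(2)]) simp
  ultimately show ?thesis using DG(2) by blast
qed

text \<open>The key is the countable neighbourhood property of \<open>F\<close>: suitable weights
  \<open>a n\<close> make one continuous \<open>p\<close> satisfy
  \<open>t n f \<le> a n * p f\<close> for all \<open>n\<close>, where \<open>t n\<close> dominates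
  \<open>b\<close> over the n-th bounded set of \<open>G\<close>. On the unit ball of
  \<open>p\<close> the seminorms \<open>b f\<close> are then pointwise bounded on
  \<open>G\<close>.\<close>

lemma separately_continuous_reflexive_DF:
  fixes b :: "('x \<Rightarrow> 'k::real_normed_field) \<Rightarrow> ('y \<Rightarrow> 'k) \<Rightarrow> real"
  assumes F: "reflexive_lcs F TF" "DF_space F TF" and G: "reflexive_lcs G TG" "DF_space G TG"
    and bF: "\<And>g. g \<in> G \<Longrightarrow> cont_seminorm F TF (\<lambda>f. b f g)"
    and bG: "\<And>f. f \<in> F \<Longrightarrow> cont_seminorm G TG (\<lambda>g. b f g)"
  shows "\<exists>s t. cont_seminorm F TF s \<and> cont_seminorm G TG t \<and> (\<forall>f\<in>F. \<forall>g\<in>G. b f g \<le> s f * t g)"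
proof -
  note lF = reflexive_imp_lcs[OF F(1)] and lG = reflexive_imp_lcs[OF G(1)]
  note subF = lcs_subspace[OF lF] and subG = lcs_subspace[OF lG]
  note snF = cont_seminorm_seminorm[OF lF] and snG = cont_seminorm_seminorm[OF lG]
  obtain B :: "nat \<Rightarrow> _" where B: "\<And>n. lcs_bounded TF (B n)" "\<And>A. lcs_bounded TF A \<Longrightarrow> \<exists>n. A \<subseteq> B n"
    using F(2) unfolding DF_space_def by blast
  obtain C :: "nat \<Rightarrow> _" where C: "\<And>n. lcs_bounded TG (C n)" "\<And>A. lcs_bounded TG A \<Longrightarrow> \<exists>n. A \<subseteq> C n"
    using G(2) unfolding DF_space_def by blast
  have "\<exists>t. cont_seminorm F TF t \<and> (\<forall>g\<in>C n. \<forall>f\<in>F. b f g \<le> t f)" for n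
  proof -
    have CG: "C n \<subseteq> G" and bdd: "\<And>f. f \<in> F \<Longrightarrow> \<exists>c. \<forall>g\<in>C n. b f g \<le> c"
      using C(1)[of n] bG unfolding lcs_bounded_iff[OF lG] by blast+
    show ?thesis
      using CG bF bdd by (intro sup_closedD[OF reflexive_sup_closed[OF F(1)]]) auto
  qed
  then obtain t where t: "\<And>n. cont_seminorm F TF (t n)" "\<And>n f g. g \<in> C n \<Longrightarrow> f \<in> F \<Longrightarrow> b f g \<le> t n f" by metis
  \<comment> \<open>With \<open>a n\<close> bounding \<open>t n\<close> on the sets
    \<open>B k\<close> for \<open>k \<le> n\<close>, all but finitely many of the
    \<open>t n / a n\<close> are at most 1 on a given bounded set.\<close>
  have "\<exists>c>0. \<forall>k\<le>n. \<forall>f\<in>B k. t n f \<le> c" for n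
  proof -
    have "\<forall>k. \<exists>c. \<forall>f\<in>B k. t n f \<le> c" using B(1) t(1) unfolding lcs_bounded_iff[OF lF] by blast
    then obtain c where c: "\<And>k f. f \<in> B k \<Longrightarrow> t n f \<le> c k" by metis
    have "t n f \<le> 1 + (\<Sum>k\<le>n. \<bar>c k\<bar>)" if "k \<le> n" "f \<in> B k" for k f
    proof -
      have "t n f \<le> \<bar>c k\<bar>" using c[OF that(2)] by simp
      also have "\<dots> \<le> (\<Sum>k\<le>n. \<bar>c k\<bar>)" using that by (intro member_le_sum) auto
      finally show ?thesis by simp
    qed
    moreover have "1 + (\<Sum>k\<le>n. \<bar>c k\<bar>) > 0" by (intro add_pos_nonneg sum_nonneg) auto
    ultimately show ?thesis by blast
  qed
  then obtain a where a: "\<And>n. a n > 0" "\<And>n k f. k \<le> n \<Longrightarrow> f \<in> B k \<Longrightarrow> t n f \<le> a n" by metis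
  define M where "M = {v \<in> dual F TF. \<exists>n. \<forall>f\<in>F. norm (v f) \<le> t n f / a n}"
  have MD: "M \<subseteq> dual F TF" by (auto simp: M_def)
  have "\<exists>c. \<forall>v\<in>M. \<forall>f\<in>A. norm (v f) \<le> c" if A: "lcs_bounded TF A" for A
  proof -
    obtain k where k: "A \<subseteq> B k" using B(2)[OF A] by blast
    have AF: "A \<subseteq> F" using A by (simp add: lcs_bounded_iff[OF lF])
    have "\<forall>n. \<exists>c. \<forall>f\<in>A. t n f / a n \<le> c"
    proof
      fix n
      obtain c where "\<And>f. f \<in> A \<Longrightarrow> t n f \<le> c" using A t(1) unfolding lcs_bounded_iff[OF lF] by blast
      then show "\<exists>c. \<forall>f\<in>A. t n f / a n \<le> c" using a(1)[of n] by (intro exI[of _ "c / a n"]) (auto simp: divide_right_mono)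
    qed
    then obtain c where c: "\<And>n f. f \<in> A \<Longrightarrow> t n f / a n \<le> c n" by metis
    have "norm (v f) \<le> max 1 (\<Sum>i<k. \<bar>c i\<bar>)" if v: "v \<in> M" and f: "f \<in> A" for v f
    proof -
      obtain n where n: "norm (v f) \<le> t n f / a n" using v f AF by (auto simp: M_def)
      show ?thesis
      proof (cases "n < k")
        case True
        have "norm (v f) \<le> \<bar>c n\<bar>" using n c[OF f, of n] by simp
        also have "\<dots> \<le> (\<Sum>i<k. \<bar>c i\<bar>)" using True by (intro member_le_sum) auto
        finally show ?thesis by simp
      next
        case False
        then have "t n f / a n \<le> 1" using a(2)[of k n f] k f a(1)[of n] by (auto simp: field_simps)
        then show ?thesis using n by simp
      qed
    qed
    then show ?thesis by blast
  qed
  then obtain p where p: "cont_seminorm F TF p" "\<And>v f. v \<in> M \<Longrightarrow> f \<in> F \<Longrightarrow> norm (v f) \<le> p f"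
    using reflexive_equicontinuous[OF F(1) MD] by blast
  have tp: "t n f \<le> a n * p f" if f: "f \<in> F" for n f
  proof -
    have "cont_seminorm F TF (\<lambda>f. (1 / a n) * t n f)"
      using a(1)[of n] by (intro cont_seminorm_scale[OF lF] t(1)) simp
    from dual_norming[OF lF this f] obtain v where v: "v \<in> dual F TF" "\<forall>f\<in>F. norm (v f) \<le> (1 / a n) * t n f"
      "(1 / a n) * t n f \<le> norm (v f)" by blast
    then have "v \<in> M" by (auto simp: M_def)
    then have "(1 / a n) * t n f \<le> p f" using p(2)[of v f] f v(3) by simp
    then show ?thesis using a(1)[of n] by (simp add: field_simps)
  qed
  define I where "I = {f \<in> F. p f \<le> 1}"
  have "\<exists>c. \<forall>f\<in>I. b f g \<le> c" if g: "g \<in> G" for g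
  proof -
    obtain n where n: "g \<in> C n" using C(2)[of "{g}"] g by (auto simp: lcs_bounded_iff[OF lG])
    have "b f g \<le> a n" if "f \<in> I" for f
    proof -
      have "b f g \<le> a n * p f" using t(2)[OF n, of f] tp[of f n] that by (auto simp: I_def)
      also have "\<dots> \<le> a n * 1" using that a(1)[of n] by (intro mult_left_mono) (auto simp: I_def)
      finally show ?thesis by simp
    qed
    then show ?thesis by blast
  qed
  moreover have "cont_seminorm G TG (\<lambda>g. b f g)" if "f \<in> I" for f using that bG by (simp add: I_def)
  ultimately have "\<exists>s. cont_seminorm G TG s \<and> (\<forall>f\<in>I. \<forall>g\<in>G. b f g \<le> s g)"
    by (intro sup_closedD[OF reflexive_sup_closed[OF G(1)]])
  then obtain q where q: "cont_seminorm G TG q" "\<And>f g. f \<in> I \<Longrightarrow> g \<in> G \<Longrightarrow> b f g \<le> q g" by blast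
  have "b f g \<le> 1 * p f * q g" if "f \<in> F" "g \<in> G" for f g
  proof (rule bilinear_dominated[OF subF subG snF[OF p(1)] snG[OF q(1)] snF[OF bF] snG[OF bG] _ that])
    show "b f g \<le> 1" if "f \<in> F" "g \<in> G" "p f \<le> 1" "q g \<le> 1" for f g
      using q(2)[of f g] that by (simp add: I_def)
  qed
  then show ?thesis using p(1) q(1) by auto
qed

section \<open>Approximation in nuclear spaces\<close>

text \<open>Each \<open>x m\<close> is split as \<open>sqrt (d m)\<close> times
  \<open>x m / sqrt (d m)\<close>; this trades an absolutely summable representation for a Hilbert
  seminorm.\<close>

lemma weighted_Cauchy_Schwarz:
  fixes x d :: "nat \<Rightarrow> real"
  assumes d: "\<And>m. d m > 0" "summable d" and x: "\<And>m. x m \<ge> 0" "summable (\<lambda>m. (x m)\<^sup>2 / d m)"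
  shows "(\<Sum>m<N. x m) \<le> sqrt (suminf d * (\<Sum>m. (x m)\<^sup>2 / d m))"
    and "summable x \<Longrightarrow> suminf x \<le> sqrt (suminf d * (\<Sum>m. (x m)\<^sup>2 / d m))"
proof -
  have part: "(\<Sum>m<N. x m) \<le> sqrt (suminf d * (\<Sum>m. (x m)\<^sup>2 / d m))" for N
  proof (rule real_le_rsqrt)
    have "(\<Sum>m<N. x m)\<^sup>2 = (\<Sum>m<N. sqrt (d m) * (x m / sqrt (d m)))\<^sup>2"
      using d(1) by (simp add: less_imp_neq[THEN not_sym])
    also have "\<dots> \<le> (\<Sum>m<N. (sqrt (d m))\<^sup>2) * (\<Sum>m<N. (x m / sqrt (d m))\<^sup>2)"
      by (rule Cauchy_Schwarz_ineq_sum)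
    also have "\<dots> = (\<Sum>m<N. d m) * (\<Sum>m<N. (x m)\<^sup>2 / d m)"
      using d(1) by (simp add: power_divide less_imp_le)
    also have "\<dots> \<le> suminf d * (\<Sum>m. (x m)\<^sup>2 / d m)"
      using d x by (intro mult_mono sum_le_suminf sum_nonneg suminf_nonneg) (auto simp: less_imp_le)
    finally show "(\<Sum>m<N. x m)\<^sup>2 \<le> suminf d * (\<Sum>m. (x m)\<^sup>2 / d m)" .
  qed
  show "(\<Sum>m<N. x m) \<le> sqrt (suminf d * (\<Sum>m. (x m)\<^sup>2 / d m))" by (rule part)
  show "suminf x \<le> sqrt (suminf d * (\<Sum>m. (x m)\<^sup>2 / d m))" if "summable x"
    by (rule suminf_le_const[OF that part])
qed

text \<open>The weighted square sum of the \<open>b m\<close> is the square of a Hilbert seminorm.\<close>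

context
  fixes G :: "('d \<Rightarrow> 'k::real_normed_field) set" and Q and b :: "nat \<Rightarrow> ('d \<Rightarrow> 'k) \<Rightarrow> 'k" and d :: "nat \<Rightarrow> real"
    and cj :: "'k \<Rightarrow> 'k"
  assumes G: "fun_subspace G" and Q: "\<And>g. g \<in> G \<Longrightarrow> 0 \<le> Q g"
    and b: "\<And>m. linear_on G (b m)" and bQ: "\<And>m g. g \<in> G \<Longrightarrow> norm (b m g) \<le> d m * Q g"
    and d: "\<And>m. d m > 0" "summable d"
    and cj: "\<And>x y. cj (x + y) = cj x + cj y" "\<And>x y. cj (x * y) = cj x * cj y"
      "\<And>x. x * cj x = of_real ((norm x)\<^sup>2)" "\<And>x. cj (cj x) = x" "\<And>x. norm (cj x) = norm x"
begin

definition hsq :: "('d \<Rightarrow> 'k) \<Rightarrow> real" where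
  "hsq g = (\<Sum>m. (norm (b m g))\<^sup>2 / d m)"

text \<open>This form is only semidefinite, as \<open>hsq\<close> can vanish on nonzero functions;
  the degenerate case is met in \<open>near_optimal_orthonormal\<close>.\<close>

definition ip :: "('d \<Rightarrow> 'k) \<Rightarrow> ('d \<Rightarrow> 'k) \<Rightarrow> 'k" where
  "ip f g = (\<Sum>m. b m f * cj (b m g) / of_real (d m))"

lemma cj_of_real: "cj (of_real r) = of_real r"
proof (cases "r = 0")
  case True
  then show ?thesis using cj(1)[of 0 0] by simp
next
  case False
  have "of_real r * cj (of_real r) = (of_real r * of_real r :: 'k)"
    unfolding cj(3) by (simp add: power2_eq_square)
  then show ?thesis using False by simp
qed

lemma bounded_linear_cj: "bounded_linear cj"
  by (rule bounded_linear_intro[where K = 1]) (simp_all add: cj scaleR_conv_of_real cj_of_real)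

lemma cj_sum: "cj (sum f A) = (\<Sum>i\<in>A. cj (f i))"
  by (rule linear_sum[OF bounded_linear.linear[OF bounded_linear_cj]])

lemma ip_term_bound:
  assumes "f \<in> G" "g \<in> G" shows "norm (b m f) * norm (b m g) / d m \<le> d m * (Q f * Q g)"
proof -
  have "norm (b m f) * norm (b m g) \<le> (d m * Q f) * (d m * Q g)"
    using bQ[of f m] bQ[of g m] assms d(1)[of m] Q by (intro mult_mono mult_nonneg_nonneg) (auto simp: less_imp_le)
  then show ?thesis using d(1)[of m] by (simp add: field_simps)
qed

lemma ip_summable_norm:
  assumes "f \<in> G" "g \<in> G" shows "summable (\<lambda>m. norm (b m f * cj (b m g) / of_real (d m)))"
proof (rule summable_comparison_test')
  show "summable (\<lambda>m. d m * (Q f * Q g))" by (intro summable_mult2 d)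
  show "norm (norm (b m f * cj (b m g) / of_real (d m))) \<le> d m * (Q f * Q g)" for m
    using ip_term_bound[OF assms, of m] d(1)[of m] by (simp add: norm_mult norm_divide cj)
qed

lemma ip_summable: "f \<in> G \<Longrightarrow> g \<in> G \<Longrightarrow> summable (\<lambda>m. b m f * cj (b m g) / of_real (d m))"
  by (rule scalar_summable_norm_cancel[OF ip_summable_norm])

lemma hsq_summable: "g \<in> G \<Longrightarrow> summable (\<lambda>m. (norm (b m g))\<^sup>2 / d m)"
  using ip_summable_norm[of g g] by (simp add: norm_mult norm_divide cj power2_eq_square abs_of_pos[OF d(1)])

lemma hsq_ge_0: "g \<in> G \<Longrightarrow> hsq g \<ge> 0"
  unfolding hsq_def using d(1) by (intro suminf_nonneg hsq_summable) (auto simp: less_imp_le)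

lemma hsq_le:
  assumes "g \<in> G" shows "hsq g \<le> suminf d * (Q g)\<^sup>2"
proof -
  have "hsq g \<le> (\<Sum>m. d m * (Q g * Q g))"
    unfolding hsq_def
    using ip_term_bound[OF assms assms] by (intro suminf_le hsq_summable assms summable_mult2 d) (simp add: power2_eq_square)
  then show ?thesis using suminf_mult2[OF d(2), of "Q g * Q g"] by (simp add: power2_eq_square)
qed

lemma ip_linear: "g \<in> G \<Longrightarrow> linear_on G (\<lambda>f. ip f g)"
  unfolding linear_on_def
proof (intro conjI ballI allI)
  fix f f' assume g: "g \<in> G" and f: "f \<in> G" "f' \<in> G"
  have "ip (f + f') g = (\<Sum>m. b m f * cj (b m g) / of_real (d m) + b m f' * cj (b m g) / of_real (d m))"
    unfolding ip_def by (simp add: linear_on_add[OF b f] distrib_right add_divide_distrib)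
  then show "ip (f + f') g = ip f g + ip f' g"
    unfolding ip_def by (simp add: suminf_add[OF ip_summable[OF f(1) g] ip_summable[OF f(2) g]])
next
  fix c f assume g: "g \<in> G" and f: "f \<in> G"
  have "ip (fscale c f) g = (\<Sum>m. c * (b m f * cj (b m g) / of_real (d m)))"
    unfolding ip_def by (simp add: linear_on_scale[OF b f] mult.assoc)
  then show "ip (fscale c f) g = c * ip f g"
    unfolding ip_def by (simp only: suminf_mult[OF ip_summable[OF f g]])
qed

lemma ip_commute:
  assumes "f \<in> G" "g \<in> G" shows "cj (ip f g) = ip g f"
proof -
  have e: "cj (b m f * cj (b m g) / of_real (d m)) = b m g * cj (b m f) / of_real (d m)" for m
    unfolding divide_inverse of_real_inverse[symmetric] by (simp only: cj cj_of_real mult.commute)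
  show ?thesis
    unfolding ip_def
    by (simp only: bounded_linear.suminf[OF bounded_linear_cj ip_summable[OF assms]] e)
qed

lemma ip_self: "g \<in> G \<Longrightarrow> ip g g = of_real (hsq g)"
  unfolding ip_def hsq_def cj(3) of_real_divide[symmetric]
  by (rule suminf_of_real[OF hsq_summable, symmetric])

section \<open>Finite orthonormal systems and projections\<close>

definition orthonormal :: "nat \<Rightarrow> (nat \<Rightarrow> 'd \<Rightarrow> 'k) \<Rightarrow> bool" where
  "orthonormal n e \<longleftrightarrow> (\<forall>j<n. e j \<in> G) \<and> (\<forall>i<n. \<forall>j<n. ip (e i) (e j) = (if i = j then 1 else 0))"

context
  fixes n e assumes e: "orthonormal n e"
begin

lemma orthonormal_in: "j < n \<Longrightarrow> e j \<in> G"
  using e by (simp add: orthonormal_def)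

lemma orthonormal_combination_in: "(\<Sum>j<n. fscale (s j) (e j)) \<in> G"
  by (intro subspace_sum[OF G] subspace_scale[OF G] orthonormal_in) simp

lemma ip_combination:
  assumes g: "g \<in> G" shows "ip (\<Sum>j<n. fscale (s j) (e j)) g = (\<Sum>j<n. s j * ip (e j) g)"
proof -
  have "ip (\<Sum>j<n. fscale (s j) (e j)) g = (\<Sum>j<n. ip (fscale (s j) (e j)) g)"
    by (rule linear_on_sum[OF G ip_linear[OF g]]) (auto intro: subspace_scale[OF G] orthonormal_in)
  also have "\<dots> = (\<Sum>j<n. s j * ip (e j) g)"
    by (intro sum.cong refl linear_on_scale[OF ip_linear[OF g]] orthonormal_in) simp
  finally show ?thesis .
qed

lemma ip_combination_coeff:
  assumes k: "k < n" shows "ip (\<Sum>j<n. fscale (s j) (e j)) (e k) = s k"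
proof -
  have "(\<Sum>j<n. s j * ip (e j) (e k)) = (\<Sum>j<n. if j = k then s j else 0)"
    using e k by (intro sum.cong) (auto simp: orthonormal_def)
  then show ?thesis using k by (simp add: ip_combination orthonormal_in)
qed

lemma hsq_combination: "hsq (\<Sum>j<n. fscale (s j) (e j)) = (\<Sum>j<n. (norm (s j))\<^sup>2)"
proof -
  let ?w = "\<Sum>j<n. fscale (s j) (e j)"
  have w: "?w \<in> G" by (rule orthonormal_combination_in)
  have "of_real (hsq ?w) = ip ?w ?w" by (rule ip_self[OF w, symmetric])
  also have "\<dots> = (\<Sum>j<n. s j * ip (e j) ?w)" by (rule ip_combination[OF w])
  also have "\<dots> = (\<Sum>j<n. s j * cj (s j))"
  proof (intro sum.cong refl)
    fix j assume "j \<in> {..<n}"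
    then have j: "j < n" by simp
    have "ip (e j) ?w = cj (ip ?w (e j))" by (rule ip_commute[OF w orthonormal_in[OF j], symmetric])
    then show "s j * ip (e j) ?w = s j * cj (s j)" by (simp add: ip_combination_coeff[OF j])
  qed
  also have "\<dots> = of_real (\<Sum>j<n. (norm (s j))\<^sup>2)" by (simp only: cj(3) of_real_sum)
  finally show ?thesis by (simp only: of_real_eq_iff)
qed

text \<open>Tested on the combination with coefficients \<open>cj (a (e j))\<close>, both
  \<open>a\<close> and \<open>hsq\<close> take the value \<open>S\<close>, which gives
  \<open>S * S \<le> K * S\<close>.\<close>

lemma Bessel:
  assumes a: "linear_on G a" and K: "K \<ge> 0" "\<And>g. g \<in> G \<Longrightarrow> (norm (a g))\<^sup>2 \<le> K * hsq g"
  shows "(\<Sum>j<n. (norm (a (e j)))\<^sup>2) \<le> K"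
proof -
  define S where "S = (\<Sum>j<n. (norm (a (e j)))\<^sup>2)"
  let ?w = "\<Sum>j<n. fscale (cj (a (e j))) (e j)"
  have "a ?w = (\<Sum>j<n. a (fscale (cj (a (e j))) (e j)))"
    by (rule linear_on_sum[OF G a]) (auto intro: subspace_scale[OF G] orthonormal_in)
  also have "\<dots> = (\<Sum>j<n. cj (a (e j)) * a (e j))"
    by (intro sum.cong refl linear_on_scale[OF a] orthonormal_in) simp
  also have "\<dots> = of_real S" unfolding S_def of_real_sum by (simp only: cj(3) mult.commute[of "cj _"])
  finally have aw: "a ?w = of_real S" .
  have "hsq ?w = S" unfolding hsq_combination by (simp add: cj S_def)
  with K(2)[OF orthonormal_combination_in, of "\<lambda>j. cj (a (e j))"] aw have "S * S \<le> K * S"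
    by (simp add: power2_eq_square)
  moreover have "S \<ge> 0" by (simp add: S_def sum_nonneg)
  ultimately have "S \<le> K" using K(1) by (cases "S = 0") auto
  then show ?thesis by (simp add: S_def)
qed

definition proj :: "('d \<Rightarrow> 'k) \<Rightarrow> 'd \<Rightarrow> 'k" where
  "proj g = (\<Sum>j<n. fscale (ip g (e j)) (e j))"

lemma proj_in: "proj g \<in> G"
  unfolding proj_def by (rule orthonormal_combination_in)

lemma ip_diff_proj:
  assumes g: "g \<in> G" and k: "k < n" shows "ip (g - proj g) (e k) = 0" "ip (e k) (g - proj g) = 0"
proof -
  have "ip (g - proj g) (e k) = ip g (e k) - ip (proj g) (e k)"
    by (rule linear_on_diff[OF G ip_linear[OF orthonormal_in[OF k]] g proj_in])
  then show *: "ip (g - proj g) (e k) = 0" unfolding proj_def by (simp add: ip_combination_coeff[OF k])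
  have "ip (e k) (g - proj g) = cj (ip (g - proj g) (e k))"
    by (intro ip_commute[symmetric] subspace_diff[OF G] g proj_in orthonormal_in k)
  then show "ip (e k) (g - proj g) = 0" using * cj_of_real[of 0] by simp
qed

text \<open>Pythagoras: \<open>g - proj g\<close> and \<open>proj g\<close> are orthogonal.\<close>

lemma hsq_diff_proj_le:
  assumes g: "g \<in> G" shows "hsq (g - proj g) \<le> hsq g"
proof -
  let ?g = "g - proj g"
  have g': "?g \<in> G" by (intro subspace_diff[OF G] g proj_in)
  have pg: "ip (proj g) ?g = 0"
    unfolding proj_def[of g] ip_combination[OF g'[unfolded proj_def]]
    using ip_diff_proj(2)[OF g] by (simp add: proj_def)
  have split: "ip g h = ip ?g h + ip (proj g) h" if "h \<in> G" for h
    using linear_on_add[OF ip_linear[OF that] g' proj_in[of g]] by simp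
  have 1: "ip ?g g = of_real (hsq ?g)"
  proof -
    have "ip ?g g = cj (ip g ?g)" by (rule ip_commute[OF g g', symmetric])
    also have "\<dots> = cj (of_real (hsq ?g))" by (simp add: split[OF g'] pg ip_self[OF g'])
    finally show ?thesis by (simp add: cj_of_real)
  qed
  have 2: "ip (proj g) g = of_real (hsq (proj g))"
  proof -
    have "ip ?g (proj g) = cj (ip (proj g) ?g)" by (rule ip_commute[OF proj_in g', symmetric])
    then have "ip ?g (proj g) = 0" using pg cj_of_real[of 0] by simp
    moreover have "ip (proj g) g = cj (ip g (proj g))" by (rule ip_commute[OF g proj_in, symmetric])
    ultimately show ?thesis by (simp add: split[OF proj_in] ip_self[OF proj_in] cj_of_real)
  qed
  have "of_real (hsq g) = (of_real (hsq ?g + hsq (proj g)) :: 'k)"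
    using split[OF g] 1 2 by (simp add: ip_self[OF g])
  then have "hsq g = hsq ?g + hsq (proj g)" by (simp only: of_real_eq_iff)
  then show ?thesis using hsq_ge_0[OF proj_in[of g]] by simp
qed

text \<open>One step of the Gram--Schmidt process.\<close>

lemma orthonormal_extend:
  assumes g: "g \<in> G" and pos: "hsq (g - proj g) > 0"
  shows "orthonormal (Suc n) (e(n := fscale (of_real (1 / sqrt (hsq (g - proj g)))) (g - proj g)))"
proof -
  let ?g = "g - proj g" and ?r = "of_real (1 / sqrt (hsq (g - proj g))) :: 'k"
  let ?f = "fscale ?r ?g"
  have g': "?g \<in> G" by (intro subspace_diff[OF G] g proj_in)
  have f: "?f \<in> G" by (rule subspace_scale[OF G g'])
  have sc: "ip ?f h = ?r * ip ?g h" if "h \<in> G" for h by (rule linear_on_scale[OF ip_linear[OF that] g'])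
  have "ip ?g ?f = cj (ip ?f ?g)" by (rule ip_commute[OF f g', symmetric])
  also have "\<dots> = ?r * of_real (hsq ?g)" by (simp only: sc[OF g'] ip_self[OF g'] cj cj_of_real)
  finally have "ip ?f ?f = ?r * (?r * of_real (hsq ?g))" by (simp only: sc[OF f])
  also have "\<dots> = of_real (1 / sqrt (hsq ?g) * (1 / sqrt (hsq ?g) * hsq ?g))" by (simp only: of_real_mult)
  also have "1 / sqrt (hsq ?g) * (1 / sqrt (hsq ?g) * hsq ?g) = 1" using pos by simp
  finally have ff: "ip ?f ?f = 1" by simp
  have fe: "ip ?f (e k) = 0" "ip (e k) ?f = 0" if k: "k < n" for k
  proof -
    show *: "ip ?f (e k) = 0" using sc[OF orthonormal_in[OF k]] ip_diff_proj(1)[OF g k] by simp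
    show "ip (e k) ?f = 0" using ip_commute[OF f orthonormal_in[OF k]] * cj_of_real[of 0] by simp
  qed
  show ?thesis
    using e f ff fe by (auto simp: orthonormal_def less_Suc_eq)
qed

end

text \<open>An orthonormal system whose Hilbert--Schmidt sum is within \<open>r\<close> of the supremum cannot be
  extended by a vector of larger Hilbert--Schmidt contribution.\<close>

lemma near_optimal_orthonormal:
  fixes a :: "nat \<Rightarrow> ('d \<Rightarrow> 'k) \<Rightarrow> 'k"
  assumes a: "\<And>k. linear_on G (a k)" and c: "\<And>k. c k > 0" "summable c" and D: "D \<ge> 0"
    and ac: "\<And>k g. g \<in> G \<Longrightarrow> (norm (a k g))\<^sup>2 \<le> (c k)\<^sup>2 * D * hsq g" and r: "r > 0"
  shows "\<exists>n e. orthonormal n e \<and> (\<forall>g\<in>G. summable (\<lambda>k. (norm (a k (g - proj n e g)))\<^sup>2 / c k) \<and>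
    (\<Sum>k. (norm (a k (g - proj n e g)))\<^sup>2 / c k) \<le> r * hsq g)"
proof -
  define A where "A g = (\<Sum>k. (norm (a k g))\<^sup>2 / c k)" for g
  have term_le: "(norm (a k g))\<^sup>2 / c k \<le> c k * (D * hsq g)" if "g \<in> G" for k g
    using ac[OF that, of k] c(1)[of k] by (simp add: field_simps power2_eq_square)
  have summ: "summable (\<lambda>k. (norm (a k g))\<^sup>2 / c k)" if g: "g \<in> G" for g
    by (rule summable_comparison_test'[of "\<lambda>k. c k * (D * hsq g)"])
      (use term_le[OF g] c in \<open>auto simp: less_imp_le intro: summable_mult2\<close>)
  have A0: "A g \<ge> 0" if "g \<in> G" for g
    unfolding A_def using c(1) by (intro suminf_nonneg summ that) (auto simp: less_imp_le)
  have Ale: "A g \<le> suminf c * (D * hsq g)" if "g \<in> G" for g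
    unfolding A_def suminf_mult2[OF c(2)]
    by (intro suminf_le term_le summ that summable_mult2 c)
  \<comment> \<open>The supremum is the squared Hilbert--Schmidt norm of the family
    \<open>a k / sqrt (c k)\<close>. Bessel's inequality bounds it termwise by
    \<open>c k * D\<close>, since the weight cancels one of the two factors
    \<open>c k\<close>.\<close>
  define S where "S = {\<Sum>j<n. A (e j) | n e. orthonormal n e}"
  have "x \<le> suminf c * D" if "x \<in> S" for x
  proof -
    obtain n e where e: "orthonormal n e" and x: "x = (\<Sum>j<n. A (e j))" using \<open>x \<in> S\<close> by (auto simp: S_def)
    note eG = orthonormal_in[OF e]
    have "x = (\<Sum>k. \<Sum>j<n. (norm (a k (e j)))\<^sup>2 / c k)"
      unfolding x A_def by (rule suminf_sum[symmetric]) (simp add: summ eG)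
    also have "\<dots> \<le> (\<Sum>k. c k * D)"
    proof (rule suminf_le)
      show "summable (\<lambda>k. \<Sum>j<n. (norm (a k (e j)))\<^sup>2 / c k)" by (intro summable_sum summ eG) simp
      show "summable (\<lambda>k. c k * D)" by (intro summable_mult2 c)
      fix k
      have "(\<Sum>j<n. (norm (a k (e j)))\<^sup>2) \<le> (c k)\<^sup>2 * D"
        by (rule Bessel[OF e a _ ac]) (simp_all add: D)
      then have "(\<Sum>j<n. (norm (a k (e j)))\<^sup>2) / c k \<le> (c k)\<^sup>2 * D / c k"
        using c(1)[of k] by (intro divide_right_mono) auto
      then show "(\<Sum>j<n. (norm (a k (e j)))\<^sup>2 / c k) \<le> c k * D"
        using c(1)[of k] by (simp add: sum_divide_distrib power2_eq_square)
    qed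
    also have "\<dots> = suminf c * D" by (rule suminf_mult2[OF c(2), symmetric])
    finally show ?thesis .
  qed
  then have bdd: "bdd_above S" by (rule bdd_aboveI)
  have "orthonormal 0 (\<lambda>_. 0)" by (simp add: orthonormal_def)
  then have ne: "S \<noteq> {}" unfolding S_def by blast
  obtain x where x: "x \<in> S" "Sup S - r < x" using less_cSup_iff[OF ne bdd, of "Sup S - r"] r by auto
  then obtain n e where e: "orthonormal n e" "Sup S - r < (\<Sum>j<n. A (e j))" by (auto simp: S_def)
  have "A (g - proj n e g) \<le> r * hsq g" if g: "g \<in> G" for g
  proof (cases "hsq (g - proj n e g) > 0")
    \<comment> \<open>A residual with \<open>hsq\<close> zero cannot be normalized, but all
      \<open>a k\<close> vanish on it.\<close>
    case False
    have g': "g - proj n e g \<in> G" by (intro subspace_diff[OF G] g proj_in[OF e(1)])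
    then have "hsq (g - proj n e g) = 0" using False hsq_ge_0 by force
    then have "A (g - proj n e g) \<le> 0" using Ale[OF g'] by simp
    then show ?thesis using r hsq_ge_0[OF g] by (smt (verit) mult_nonneg_nonneg)
  next
    case True
    let ?g = "g - proj n e g" and ?f = "fscale (of_real (1 / sqrt (hsq (g - proj n e g)))) (g - proj n e g)"
    have g': "?g \<in> G" by (intro subspace_diff[OF G] g proj_in[OF e(1)])
    have "(\<Sum>j<Suc n. A ((e(n := ?f)) j)) \<in> S"
      using orthonormal_extend[OF e(1) g True] unfolding S_def by blast
    then have "(\<Sum>j<Suc n. A ((e(n := ?f)) j)) \<le> Sup S" by (rule cSup_upper[OF _ bdd])
    also have "(\<Sum>j<Suc n. A ((e(n := ?f)) j)) = (\<Sum>j<n. A (e j)) + A ?f" by simp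
    finally have "A ?f \<le> r" using e(2) by simp
    moreover have "A ?f = (1 / hsq ?g) * A ?g"
    proof -
      have "(norm (a k ?f))\<^sup>2 / c k = (1 / hsq ?g) * ((norm (a k ?g))\<^sup>2 / c k)" for k
      proof -
        have "norm (a k ?f) = (1 / sqrt (hsq ?g)) * norm (a k ?g)"
          unfolding linear_on_scale[OF a g'] norm_mult norm_of_real using True by simp
        then show ?thesis using True by (simp add: power_mult_distrib power_divide)
      qed
      then show ?thesis unfolding A_def by (simp only: suminf_mult[OF summ[OF g']])
    qed
    ultimately have "(1 / hsq ?g) * A ?g \<le> r" by simp
    then have "A ?g \<le> r * hsq ?g" using True by (simp add: pos_divide_le_eq)
    also have "\<dots> \<le> r * hsq g" using r hsq_diff_proj_le[OF e(1) g] by (intro mult_left_mono) auto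
    finally show ?thesis .
  qed
  then show ?thesis using e(1) summ subspace_diff[OF G _ proj_in[OF e(1)]] unfolding A_def by blast
qed

end

section \<open>Finite-rank approximation of the identity\<close>

lemma scalar_norm_suminf_le:
  fixes f :: "nat \<Rightarrow> 'k::real_normed_field"
  assumes "summable f" "summable g" "\<And>n. norm (f n) \<le> g n" shows "norm (suminf f) \<le> suminf g"
proof (rule LIMSEQ_le_const2[OF tendsto_norm[OF summable_LIMSEQ[OF assms(1)]]])
  have "norm (\<Sum>i<n. f i) \<le> suminf g" for n
  proof -
    have "norm (\<Sum>i<n. f i) \<le> (\<Sum>i<n. g i)" by (rule sum_norm_le) (rule assms(3))
    also have "\<dots> \<le> suminf g" by (rule sum_le_suminf[OF assms(2)]) (auto intro: order_trans[OF norm_ge_zero assms(3)])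
    finally show ?thesis .
  qed
  then show "\<exists>N. \<forall>n\<ge>N. norm (\<Sum>i<n. f i) \<le> suminf g" by blast
qed

lemma fscale_sum_left: "fscale (\<Sum>i\<in>A. s i) f = (\<Sum>i\<in>A. fscale (s i) f)"
  by (simp add: fun_eq_iff sum_fun_apply fscale_apply sum_distrib_right)

text \<open>The added \<open>(1 / 2) ^ n\<close> makes the weights strictly positive, because they
  later occur as divisors.\<close>

lemma nuclearD:
  assumes nuc: "nuclear G T" and p: "cont_seminorm G T p"
  shows "\<exists>q a c. cont_seminorm G T q \<and> (\<forall>n. a n \<in> dual G T) \<and> (\<forall>n. c n > 0) \<and> summable c \<and>
    (\<forall>n. \<forall>f\<in>G. norm (a n f) \<le> c n * q f) \<and>
    (\<forall>f\<in>G. summable (\<lambda>n. norm (a n f)) \<and> p f \<le> (\<Sum>n. norm (a n f)))"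
proof -
  have lcs: "lcs G T" using nuc by (simp add: nuclear_def)
  obtain q a c where q: "cont_seminorm G T q" and a: "\<forall>n. a n \<in> dual G T" and c: "\<forall>n. c n \<ge> 0" "summable c"
    and ac: "\<forall>n. \<forall>f\<in>G. norm (a n f) \<le> c n * q f"
    and pa: "\<forall>f\<in>G. summable (\<lambda>n. norm (a n f)) \<and> p f \<le> (\<Sum>n. norm (a n f))"
    using nuc[unfolded nuclear_def, THEN conjunct2, rule_format, OF p] by (elim exE conjE)
  have "\<forall>n. c n + (1 / 2) ^ n > 0" using c(1) by (simp add: add_nonneg_pos)
  moreover have "summable (\<lambda>n. c n + (1 / 2) ^ n)" by (intro summable_add c(2) summable_geometric) simp
  moreover have "\<forall>n. \<forall>f\<in>G. norm (a n f) \<le> (c n + (1 / 2) ^ n) * q f"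
  proof (intro allI ballI)
    fix n f assume f: "f \<in> G"
    have "q f \<ge> 0" by (rule seminorm_ge_0[OF lcs_subspace[OF lcs] cont_seminorm_seminorm[OF lcs q] f])
    then have "c n * q f \<le> (c n + (1 / 2) ^ n) * q f" by (intro mult_right_mono) auto
    then show "norm (a n f) \<le> (c n + (1 / 2) ^ n) * q f" using ac f by (meson order_trans)
  qed
  ultimately show ?thesis using q a pa by (intro exI[of _ q] exI[of _ a] exI[of _ "\<lambda>n. c n + (1 / 2) ^ n"]) simp
qed

text \<open>Two applications of nuclearity make the seminorm \<open>q\<close> Hilbert--Schmidt with respect to a Hilbert
  seminorm that is itself given by the summable sequence \<open>b\<close>; truncated orthogonal projections then
  approximate the identity with uniformly bounded nuclear norm.\<close>

theorem nuclear_approximation: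
  assumes nuc: "nuclear G T" and q: "cont_seminorm G T q"
  shows "\<exists>Q K. cont_seminorm G T Q \<and> K \<ge> 0 \<and> (\<forall>r>0. \<exists>(N::nat) b z.
    (\<forall>m<N. b m \<in> dual G T \<and> z m \<in> G \<and> (\<forall>g\<in>G. norm (b m g) \<le> Q g)) \<and>
    (\<Sum>m<N. q (z m)) \<le> K \<and> (\<forall>g\<in>G. q (g - (\<Sum>m<N. fscale (b m g) (z m))) \<le> r * Q g))"
proof -
  have lcs: "lcs G T" using nuc by (simp add: nuclear_def)
  note G = lcs_subspace[OF lcs] and sn = cont_seminorm_seminorm[OF lcs]
  from nuclearD[OF nuc q] obtain q1 a c where q1: "cont_seminorm G T q1" and a: "\<And>n. a n \<in> dual G T"
    and c: "\<And>n. c n > 0" "summable c" and ac: "\<And>n f. f \<in> G \<Longrightarrow> norm (a n f) \<le> c n * q1 f"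
    and qa: "\<And>f. f \<in> G \<Longrightarrow> summable (\<lambda>n. norm (a n f))" "\<And>f. f \<in> G \<Longrightarrow> q f \<le> (\<Sum>n. norm (a n f))"
    by (elim exE conjE) blast
  from nuclearD[OF nuc q1] obtain Q b d where Q: "cont_seminorm G T Q" and b: "\<And>n. b n \<in> dual G T"
    and d: "\<And>n. d n > 0" "summable d" and bd: "\<And>n f. f \<in> G \<Longrightarrow> norm (b n f) \<le> d n * Q f"
    and q1b: "\<And>f. f \<in> G \<Longrightarrow> summable (\<lambda>n. norm (b n f))" "\<And>f. f \<in> G \<Longrightarrow> q1 f \<le> (\<Sum>n. norm (b n f))"
    by (elim exE conjE) blast
  obtain cj :: "'b \<Rightarrow> 'b" where cj: "\<And>x y. cj (x + y) = cj x + cj y" "\<And>x y. cj (x * y) = cj x * cj y"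
    "\<And>x. x * cj x = of_real ((norm x)\<^sup>2)" "\<And>x. cj (cj x) = x" "\<And>x. norm (cj x) = norm x"
    by (rule scalar_conjugation) blast
  note la = dual_linear[OF lcs a] and lb = dual_linear[OF lcs b]
  have Q0: "0 \<le> Q g" if "g \<in> G" for g by (rule seminorm_ge_0[OF G sn[OF Q] that])
  note H = G Q0 lb bd d cj
  define D where "D = suminf d"
  define C where "C = suminf c"
  have D: "D > 0" unfolding D_def by (rule suminf_pos[OF d(2,1)])
  have C: "C > 0" unfolding C_def by (rule suminf_pos[OF c(2,1)])
  \<comment> \<open>The second representation bounds \<open>q1\<close> by the Hilbert seminorm, so
    that each \<open>a k\<close> is bounded for the inner product.\<close>
  have q1H: "q1 g \<le> sqrt (D * hsq b d g)" if g: "g \<in> G" for g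
  proof -
    have "q1 g \<le> (\<Sum>n. norm (b n g))" by (rule q1b(2)[OF g])
    also have "\<dots> \<le> sqrt (suminf d * (\<Sum>n. (norm (b n g))\<^sup>2 / d n))"
      by (rule weighted_Cauchy_Schwarz(2)[OF d _ hsq_summable[OF H g] q1b(1)[OF g]]) simp
    finally show ?thesis by (simp add: D_def hsq_def[OF H])
  qed
  have ac2: "(norm (a k g))\<^sup>2 \<le> (c k)\<^sup>2 * D * hsq b d g" if g: "g \<in> G" for k g
  proof -
    have "norm (a k g) \<le> c k * sqrt (D * hsq b d g)"
      by (rule order_trans[OF ac[OF g] mult_left_mono[OF q1H[OF g] less_imp_le[OF c(1)]]])
    then have "(norm (a k g))\<^sup>2 \<le> (c k * sqrt (D * hsq b d g))\<^sup>2" by (intro power_mono) auto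
    also have "\<dots> = (c k)\<^sup>2 * D * hsq b d g"
      using D hsq_ge_0[OF H g] by (simp add: power_mult_distrib)
    finally show ?thesis .
  qed
  have main: "\<exists>(N::nat) b z. (\<forall>m<N. b m \<in> dual G T \<and> z m \<in> G \<and> (\<forall>g\<in>G. norm (b m g) \<le> Q g)) \<and>
    (\<Sum>m<N. q (z m)) \<le> D * C \<and> (\<forall>g\<in>G. q (g - (\<Sum>m<N. fscale (b m g) (z m))) \<le> r * Q g)" if r: "r > 0" for r
  proof -
    \<comment> \<open>Solves \<open>sqrt (C * (s * D)) = r / 2\<close>, which leaves the other half
      of \<open>r\<close> for the truncation.\<close>
    define s where "s = (r / 2)\<^sup>2 / (C * D)"
    have s: "s > 0" using r C D by (simp add: s_def)
    have "\<exists>n e. orthonormal G b d cj n e \<and>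
        (\<forall>g\<in>G. summable (\<lambda>k. (norm (a k (g - proj b d cj n e g)))\<^sup>2 / c k) \<and>
          (\<Sum>k. (norm (a k (g - proj b d cj n e g)))\<^sup>2 / c k) \<le> s * hsq b d g)"
      by (rule near_optimal_orthonormal[OF H la c less_imp_le[OF D] ac2 s])
    then obtain n e where e: "orthonormal G b d cj n e"
      and near: "\<forall>g\<in>G. summable (\<lambda>k. (norm (a k (g - proj b d cj n e g)))\<^sup>2 / c k) \<and>
          (\<Sum>k. (norm (a k (g - proj b d cj n e g)))\<^sup>2 / c k) \<le> s * hsq b d g"
      by (elim exE conjE)
    note e1 = near[rule_format, THEN conjunct1] and e2 = near[rule_format, THEN conjunct2]
    have eG: "e j \<in> G" if "j < n" for j by (rule orthonormal_in[OF H e that])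
    have pG: "proj b d cj n e g \<in> G" for g by (rule proj_in[OF H e])
    have q_proj: "q (g - proj b d cj n e g) \<le> r / 2 * Q g" if g: "g \<in> G" for g
    proof -
      let ?g = "g - proj b d cj n e g"
      have g': "?g \<in> G" by (intro subspace_diff[OF G] g pG)
      have "q ?g \<le> (\<Sum>k. norm (a k ?g))" by (rule qa(2)[OF g'])
      also have "\<dots> \<le> sqrt (suminf c * (\<Sum>k. (norm (a k ?g))\<^sup>2 / c k))"
        by (rule weighted_Cauchy_Schwarz(2)[OF c _ e1[OF g] qa(1)[OF g']]) simp
      also have "\<dots> \<le> sqrt (C * (s * (D * (Q g)\<^sup>2)))"
      proof (rule real_sqrt_le_mono)
        have "(\<Sum>k. (norm (a k ?g))\<^sup>2 / c k) \<le> s * (D * (Q g)\<^sup>2)"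
          unfolding D_def by (intro order_trans[OF e2[OF g]] mult_left_mono hsq_le[OF H g] less_imp_le[OF s])
        then show "suminf c * (\<Sum>k. (norm (a k ?g))\<^sup>2 / c k) \<le> C * (s * (D * (Q g)\<^sup>2))"
          using C unfolding C_def by (intro mult_left_mono) auto
      qed
      also have "C * (s * (D * (Q g)\<^sup>2)) = (r / 2 * Q g)\<^sup>2"
        using C D by (simp add: s_def power_mult_distrib power_divide)
      also have "sqrt ((r / 2 * Q g)\<^sup>2) = r / 2 * Q g" using r Q0[OF g] by simp
      finally show ?thesis .
    qed
    \<comment> \<open>Measures how strongly truncation errors of the coefficients are amplified;
      \<open>N\<close> is chosen after it.\<close>
    define W where "W = (\<Sum>j<n. Q (e j) * q (e j))"
    have q0: "q g \<ge> 0" if "g \<in> G" for g by (rule seminorm_ge_0[OF G sn[OF q] that])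
    have W: "W \<ge> 0" unfolding W_def by (intro sum_nonneg mult_nonneg_nonneg Q0 q0 eG) auto
    have "r / (2 * (W + 1)) > 0" using r W by simp
    from suminf_exist_split[OF this d(2)] obtain N where N: "norm (\<Sum>i. d (i + N)) < r / (2 * (W + 1))" by blast
    \<comment> \<open>Expanding the coefficients \<open>ip g (e j)\<close> of the projection as
      series over \<open>m\<close> and interchanging sums gives the series of
      \<open>fscale (b' m g) (z m)\<close>, which is cut off at \<open>N\<close>.\<close>
    define z where "z m = (\<Sum>j<n. fscale (cj (b m (e j))) (e j))" for m
    have zG: "z m \<in> G" for m unfolding z_def by (rule orthonormal_combination_in[OF H e])
    define b' where "b' m = fscale (of_real (1 / d m)) (b m)" for m
    have b'1: "b' m \<in> dual G T" for m unfolding b'_def by (rule subspace_scale[OF dual_subspace[OF lcs] b])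
    have b'2: "norm (b' m g) \<le> Q g" if g: "g \<in> G" for m g
    proof -
      have "norm (b' m g) = norm (b m g) / d m"
        unfolding b'_def fscale_apply norm_mult norm_of_real using d(1)[of m] by simp
      also have "\<dots> \<le> Q g" using bd[OF g, of m] d(1)[of m] by (simp add: pos_divide_le_eq mult.commute)
      finally show ?thesis .
    qed
    \<comment> \<open>The bound must depend neither on the orthonormal system nor on
      \<open>N\<close>. The duality \<open>norm (a k (z m)) = norm (b m (w k))\<close> exchanges the
      two families, after which Cauchy--Schwarz over \<open>m\<close> and Bessel over
      \<open>j\<close> give \<open>D * c k\<close>.\<close>
    have zsum: "(\<Sum>m<N. q (z m)) \<le> D * C"
    proof -
      define w where "w k = (\<Sum>j<n. fscale (cj (a k (e j))) (e j))" for k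
      have wG: "w k \<in> G" for k unfolding w_def by (rule orthonormal_combination_in[OF H e])
      have az: "norm (a k (z m)) = norm (b m (w k))" for k m
      proof -
        have "a k (z m) = (\<Sum>j<n. a k (fscale (cj (b m (e j))) (e j)))"
          unfolding z_def by (rule linear_on_sum[OF G la]) (auto intro: subspace_scale[OF G] eG)
        also have "\<dots> = (\<Sum>j<n. cj (b m (e j)) * a k (e j))"
          by (intro sum.cong refl linear_on_scale[OF la] eG) simp
        also have "\<dots> = cj (\<Sum>j<n. b m (e j) * cj (a k (e j)))"
          by (simp only: cj_sum[OF H] cj)
        also have "(\<Sum>j<n. b m (e j) * cj (a k (e j))) = (\<Sum>j<n. b m (fscale (cj (a k (e j))) (e j)))"
        proof (intro sum.cong refl)
          fix j assume "j \<in> {..<n}"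
          then show "b m (e j) * cj (a k (e j)) = b m (fscale (cj (a k (e j))) (e j))"
            using linear_on_scale[OF lb eG, of j m "cj (a k (e j))"] by (simp add: mult.commute)
        qed
        also have "\<dots> = b m (w k)"
          unfolding w_def by (rule linear_on_sum[OF G lb, symmetric]) (auto intro: subspace_scale[OF G] eG)
        finally show ?thesis by (simp add: cj)
      qed
      have "(\<Sum>m<N. q (z m)) \<le> (\<Sum>m<N. \<Sum>k. norm (a k (z m)))" by (intro sum_mono qa(2) zG)
      also have "\<dots> = (\<Sum>k. \<Sum>m<N. norm (a k (z m)))" by (rule suminf_sum[symmetric]) (rule qa(1)[OF zG])
      also have "\<dots> \<le> (\<Sum>k. D * c k)"
      proof (rule suminf_le)
        show "summable (\<lambda>k. \<Sum>m<N. norm (a k (z m)))" by (intro summable_sum qa(1) zG)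
        show "summable (\<lambda>k. D * c k)" by (intro summable_mult c)
        fix k
        have "(\<Sum>m<N. norm (a k (z m))) = (\<Sum>m<N. norm (b m (w k)))" by (simp only: az)
        also have "\<dots> \<le> sqrt (suminf d * (\<Sum>m. (norm (b m (w k)))\<^sup>2 / d m))"
          by (rule weighted_Cauchy_Schwarz(1)[OF d _ hsq_summable[OF H wG]]) simp
        also have "\<dots> = sqrt (D * hsq b d (w k))" by (simp add: D_def hsq_def[OF H])
        also have "hsq b d (w k) = (\<Sum>j<n. (norm (a k (e j)))\<^sup>2)"
          by (simp only: w_def hsq_combination[OF H e] cj)
        also have "sqrt (D * (\<Sum>j<n. (norm (a k (e j)))\<^sup>2)) \<le> sqrt (D * ((c k)\<^sup>2 * D))"
        proof (intro real_sqrt_le_mono mult_left_mono)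
          show "(\<Sum>j<n. (norm (a k (e j)))\<^sup>2) \<le> (c k)\<^sup>2 * D"
            by (rule Bessel[OF H e la _ ac2]) (use D in auto)
        qed (use D in auto)
        also have "D * ((c k)\<^sup>2 * D) = (D * c k)\<^sup>2" by (simp add: power2_eq_square)
        also have "sqrt ((D * c k)\<^sup>2) = D * c k" using D c(1)[of k] by simp
        finally show "(\<Sum>m<N. norm (a k (z m))) \<le> D * c k" .
      qed
      also have "\<dots> = D * C" unfolding C_def by (rule suminf_mult[OF c(2)])
      finally show ?thesis .
    qed
    have trunc: "q (proj b d cj n e g - (\<Sum>m<N. fscale (b' m g) (z m))) \<le> r / 2 * Q g" if g: "g \<in> G" for g
    proof -
      let ?t = "\<lambda>j m. b m g * cj (b m (e j)) / of_real (d m)"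
      have "(\<Sum>m<N. fscale (b' m g) (z m)) = (\<Sum>m<N. \<Sum>j<n. fscale (?t j m) (e j))"
        unfolding z_def fscale_sum by (simp add: b'_def fscale_apply)
      also have "\<dots> = (\<Sum>j<n. \<Sum>m<N. fscale (?t j m) (e j))" by (rule sum.swap)
      also have "\<dots> = (\<Sum>j<n. fscale (\<Sum>m<N. ?t j m) (e j))" by (simp only: fscale_sum_left)
      finally have P: "proj b d cj n e g - (\<Sum>m<N. fscale (b' m g) (z m))
          = (\<Sum>j<n. fscale (ip b d cj g (e j) - (\<Sum>m<N. ?t j m)) (e j))"
        by (simp add: proj_def[OF H e] sum_subtractf[symmetric] fscale_diff_left)
      have tail: "norm (ip b d cj g (e j) - (\<Sum>m<N. ?t j m)) \<le> (\<Sum>i. d (i + N)) * (Q g * Q (e j))" if j: "j < n" for j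
      proof -
        have "ip b d cj g (e j) - (\<Sum>m<N. ?t j m) = (\<Sum>m. ?t j (m + N))"
          by (simp only: ip_def[OF H] suminf_minus_initial_segment[OF ip_summable[OF H g eG[OF j]]])
        also have "norm \<dots> \<le> (\<Sum>m. d (m + N) * (Q g * Q (e j)))"
        proof (rule scalar_norm_suminf_le)
          show "summable (\<lambda>m. ?t j (m + N))" by (rule summable_ignore_initial_segment[OF ip_summable[OF H g eG[OF j]]])
          show "summable (\<lambda>m. d (m + N) * (Q g * Q (e j)))"
            by (intro summable_mult2 summable_ignore_initial_segment d)
          show "norm (?t j (m + N)) \<le> d (m + N) * (Q g * Q (e j))" for m
            using ip_term_bound[OF H g eG[OF j], of "m + N"] d(1)[of "m + N"] by (simp add: norm_mult norm_divide cj)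
        qed
        also have "\<dots> = (\<Sum>i. d (i + N)) * (Q g * Q (e j))"
          by (rule suminf_mult2[OF summable_ignore_initial_segment[OF d(2)], symmetric])
        finally show ?thesis .
      qed
      have "q (proj b d cj n e g - (\<Sum>m<N. fscale (b' m g) (z m)))
          \<le> (\<Sum>j<n. q (fscale (ip b d cj g (e j) - (\<Sum>m<N. ?t j m)) (e j)))"
        unfolding P by (rule seminorm_sum[OF G sn[OF q]]) (auto intro: subspace_scale[OF G] eG)
      also have "\<dots> = (\<Sum>j<n. norm (ip b d cj g (e j) - (\<Sum>m<N. ?t j m)) * q (e j))"
        by (intro sum.cong refl seminorm_scale[OF G sn[OF q]] eG) simp
      also have "\<dots> \<le> (\<Sum>j<n. (\<Sum>i. d (i + N)) * (Q g * Q (e j)) * q (e j))"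
        by (intro sum_mono mult_right_mono tail q0 eG) auto
      also have "\<dots> = (\<Sum>i. d (i + N)) * (Q g * W)" by (simp add: W_def sum_distrib_left mult.assoc)
      also have "\<dots> \<le> r / (2 * (W + 1)) * (Q g * W)"
        using N W Q0[OF g] by (intro mult_right_mono mult_nonneg_nonneg) auto
      also have "\<dots> \<le> r / (2 * (W + 1)) * (Q g * (W + 1))"
        using r W Q0[OF g] by (intro mult_left_mono) auto
      also have "\<dots> = r / 2 * Q g" using W by (simp add: divide_simps)
      finally show ?thesis .
    qed
    have "q (g - (\<Sum>m<N. fscale (b' m g) (z m))) \<le> r * Q g" if g: "g \<in> G" for g
    proof -
      have "(\<Sum>m<N. fscale (b' m g) (z m)) \<in> G" by (intro subspace_sum[OF G] subspace_scale[OF G] zG)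
      then show ?thesis
        using seminorm_triangle3[OF G sn[OF q] g pG[of g], of "\<Sum>m<N. fscale (b' m g) (z m)"]
          q_proj[OF g] trunc[OF g] by simp
    qed
    then show ?thesis using b'1 b'2 zG zsum by (intro exI[of _ N] exI[of _ b'] exI[of _ z]) simp
  qed
  show ?thesis by (intro exI[of _ Q] exI[of _ "D * C"] conjI Q) (use main D C in auto)
qed

section \<open>Tensor products of function spaces\<close>

lemma tensor_fun_apply: "tensor_fun f g (x, y) = f x * g y"
  by (simp add: tensor_fun_def)

lemma linear_map_tensor_fun:
  "linear_map_on E (\<lambda>f. tensor_fun f g)" "linear_map_on E (\<lambda>g. tensor_fun f g)"
  by (auto simp: linear_map_on_def linear_on_def tensor_fun_def fun_apply algebra_simps)

lemma tensor_fun_linear: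
  "tensor_fun (f + f') g = tensor_fun f g + tensor_fun f' g"
  "tensor_fun (f - f') g = tensor_fun f g - tensor_fun f' g"
  "tensor_fun f (g + g') = tensor_fun f g + tensor_fun f g'"
  "tensor_fun f (g - g') = tensor_fun f g - tensor_fun f g'"
  "tensor_fun (fscale c f) g = fscale c (tensor_fun f g)"
  by (auto simp: fun_eq_iff fun_apply tensor_fun_def algebra_simps)

lemma tensor_span_iff:
  "u \<in> tensor_span F G \<longleftrightarrow>
     (\<exists>(n::nat) f g. (\<forall>i<n. f i \<in> F \<and> g i \<in> G) \<and> u = (\<Sum>i<n. tensor_fun (f i) (g i)))"
  by (simp add: tensor_span_def fun_eq_iff sum_fun_apply)

lemma tensor_spanI:
  assumes "finite A" "\<And>i. i \<in> A \<Longrightarrow> f i \<in> F" "\<And>i. i \<in> A \<Longrightarrow> g i \<in> G"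
  shows "(\<Sum>i\<in>A. tensor_fun (f i) (g i)) \<in> tensor_span F G"
proof -
  obtain h where h: "bij_betw h {0..<card A} A" using ex_bij_betw_nat_finite[OF assms(1)] by blast
  have "(\<Sum>i<card A. tensor_fun (f (h i)) (g (h i))) = (\<Sum>i\<in>A. tensor_fun (f i) (g i))"
    using sum.reindex_bij_betw[OF h, of "\<lambda>i. tensor_fun (f i) (g i)"] by (simp add: atLeast0LessThan)
  moreover have "h i \<in> A" if "i < card A" for i using h that by (auto simp: bij_betw_def)
  ultimately show ?thesis
    unfolding tensor_span_iff using assms(2,3)
    by (intro exI[of _ "card A"] exI[of _ "\<lambda>i. f (h i)"] exI[of _ "\<lambda>i. g (h i)"]) simp
qed

context
  fixes F :: "('x \<Rightarrow> 'k::real_normed_field) set" and G :: "('y \<Rightarrow> 'k) set"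
  assumes F: "fun_subspace F" and G: "fun_subspace G"
begin

lemma tensor_span_subspace: "fun_subspace (tensor_span F G)"
  unfolding fun_subspace_def fun_ops
proof (intro conjI ballI allI)
  show "0 \<in> tensor_span F G" unfolding tensor_span_iff by (intro exI[of _ 0]) simp
next
  fix u w assume "u \<in> tensor_span F G" "w \<in> tensor_span F G"
  then obtain n n' :: nat and f g f' g' where u: "\<forall>i<n. f i \<in> F \<and> g i \<in> G" "u = (\<Sum>i<n. tensor_fun (f i) (g i))"
    and w: "\<forall>i<n'. f' i \<in> F \<and> g' i \<in> G" "w = (\<Sum>i<n'. tensor_fun (f' i) (g' i))"
    unfolding tensor_span_iff by blast
  have "u + w = (\<Sum>i\<in>{..<n::nat} <+> {..<n'::nat}. tensor_fun (case_sum f f' i) (case_sum g g' i))"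
    by (simp add: sum.Plus u w)
  also have "\<dots> \<in> tensor_span F G" by (rule tensor_spanI) (use u w in auto)
  finally show "u + w \<in> tensor_span F G" .
next
  fix c u assume "u \<in> tensor_span F G"
  then obtain n :: nat and f g where u: "\<forall>i<n. f i \<in> F \<and> g i \<in> G" "u = (\<Sum>i<n. tensor_fun (f i) (g i))"
    unfolding tensor_span_iff by blast
  have "fscale c u = (\<Sum>i<n. tensor_fun (fscale c (f i)) (g i))"
    by (simp add: u fscale_sum tensor_fun_linear)
  also have "\<dots> \<in> tensor_span F G" by (rule tensor_spanI) (use u subspace_scale[OF F] in auto)
  finally show "fscale c u \<in> tensor_span F G" .
qed

context
  fixes p q assumes p: "seminorm_on F p" and q: "seminorm_on G q"
begin

lemma pi_seminorm_eq:
  "pi_seminorm F G p q u = Inf {\<Sum>i<n. p (f i) * q (g i) |(n::nat) f g.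
     (\<forall>i<n. f i \<in> F \<and> g i \<in> G) \<and> u = (\<Sum>i<n. tensor_fun (f i) (g i))}"
  by (simp add: pi_seminorm_def fun_eq_iff sum_fun_apply)

lemma pi_seminorm_le:
  assumes "finite A" "\<And>i. i \<in> A \<Longrightarrow> f i \<in> F" "\<And>i. i \<in> A \<Longrightarrow> g i \<in> G"
  shows "pi_seminorm F G p q (\<Sum>i\<in>A. tensor_fun (f i) (g i)) \<le> (\<Sum>i\<in>A. p (f i) * q (g i))"
proof -
  obtain h where h: "bij_betw h {0..<card A} A" using ex_bij_betw_nat_finite[OF assms(1)] by blast
  have e1: "(\<Sum>i\<in>A. tensor_fun (f i) (g i)) = (\<Sum>i<card A. tensor_fun (f (h i)) (g (h i)))"
    and e2: "(\<Sum>i\<in>A. p (f i) * q (g i)) = (\<Sum>i<card A. p (f (h i)) * q (g (h i)))"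
    using sum.reindex_bij_betw[OF h, of "\<lambda>i. tensor_fun (f i) (g i)"]
      sum.reindex_bij_betw[OF h, of "\<lambda>i. p (f i) * q (g i)"] by (simp_all add: atLeast0LessThan)
  have hA: "h i \<in> A" if "i < card A" for i using h that by (auto simp: bij_betw_def)
  show ?thesis
    unfolding pi_seminorm_eq e1 e2
  proof (rule cInf_lower)
    show "bdd_below {\<Sum>i<n. p (f' i) * q (g' i) |(n::nat) f' g'. (\<forall>i<n. f' i \<in> F \<and> g' i \<in> G) \<and>
        (\<Sum>i<card A. tensor_fun (f (h i)) (g (h i))) = (\<Sum>i<n. tensor_fun (f' i) (g' i))}"
      by (rule bdd_belowI[of _ 0])
        (auto intro!: sum_nonneg mult_nonneg_nonneg seminorm_ge_0[OF F p] seminorm_ge_0[OF G q])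
    have "\<forall>i<card A. f (h i) \<in> F \<and> g (h i) \<in> G" using hA assms(2,3) by blast
    then show "(\<Sum>i<card A. p (f (h i)) * q (g (h i))) \<in> {\<Sum>i<n. p (f' i) * q (g' i) |(n::nat) f' g'.
        (\<forall>i<n. f' i \<in> F \<and> g' i \<in> G) \<and>
        (\<Sum>i<card A. tensor_fun (f (h i)) (g (h i))) = (\<Sum>i<n. tensor_fun (f' i) (g' i))}"
      unfolding mem_Collect_eq
      by (intro exI[of _ "card A"] exI[of _ "\<lambda>i. f (h i)"] exI[of _ "\<lambda>i. g (h i)"]) simp
  qed
qed

text \<open>The triangle inequality for every representation of \<open>u\<close>: the projective
  seminorm is the largest one bounded by \<open>p f * q g\<close> on elementary tensors.\<close>

lemma pi_seminorm_ge:
  assumes H: "fun_subspace H" and t: "seminorm_on H t"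
    and tH: "\<And>f g. f \<in> F \<Longrightarrow> g \<in> G \<Longrightarrow> tensor_fun f g \<in> H"
    and le: "\<And>f g. f \<in> F \<Longrightarrow> g \<in> G \<Longrightarrow> t (tensor_fun f g) \<le> p f * q g" and u: "u \<in> tensor_span F G"
  shows "t u \<le> pi_seminorm F G p q u"
  unfolding pi_seminorm_eq
proof (rule cInf_greatest)
  show "{\<Sum>i<n. p (f i) * q (g i) |(n::nat) f g. (\<forall>i<n. f i \<in> F \<and> g i \<in> G) \<and> u = (\<Sum>i<n. tensor_fun (f i) (g i))} \<noteq> {}"
    using u unfolding tensor_span_iff by blast
  fix s assume "s \<in> {\<Sum>i<n. p (f i) * q (g i) |(n::nat) f g. (\<forall>i<n. f i \<in> F \<and> g i \<in> G) \<and> u = (\<Sum>i<n. tensor_fun (f i) (g i))}"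
  then obtain n f g where fg: "\<And>i. i < n \<Longrightarrow> f i \<in> F" "\<And>i. i < n \<Longrightarrow> g i \<in> G"
    and s: "s = (\<Sum>i<n::nat. p (f i) * q (g i))" and u: "u = (\<Sum>i<n. tensor_fun (f i) (g i))" by blast
  have "t u \<le> (\<Sum>i<n. t (tensor_fun (f i) (g i)))"
    unfolding u by (rule seminorm_sum[OF H t]) (auto intro: tH fg)
  also have "\<dots> \<le> s" unfolding s by (intro sum_mono le fg) auto
  finally show "t u \<le> s" .
qed

end

end

lemma openin_seminorm_top:
  "openin (seminorm_top S P) U \<longleftrightarrow> U \<subseteq> S \<and>
     (\<forall>u\<in>U. \<exists>Q e. finite Q \<and> Q \<subseteq> P \<and> e > 0 \<and> {w \<in> S. \<forall>p\<in>Q. p (fdiff w u) < e} \<subseteq> U)"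
proof -
  have "istopology (\<lambda>U. U \<subseteq> S \<and>
     (\<forall>u\<in>U. \<exists>Q e. finite Q \<and> Q \<subseteq> P \<and> e > 0 \<and> {w \<in> S. \<forall>p\<in>Q. p (fdiff w u) < e} \<subseteq> U))"
    unfolding istopology_def
  proof (intro conjI allI impI, goal_cases)
    case (1 U U')
    then show ?case by blast
  next
    case (2 U U')
    show ?case
    proof
      fix u assume u: "u \<in> U \<inter> U'"
      then obtain A d B e where "finite A" "A \<subseteq> P" "d > 0" "{w \<in> S. \<forall>p\<in>A. p (fdiff w u) < d} \<subseteq> U"
        "finite B" "B \<subseteq> P" "e > 0" "{w \<in> S. \<forall>p\<in>B. p (fdiff w u) < e} \<subseteq> U'"
        using 2 by (meson IntD1 IntD2)
      then show "\<exists>Q e. finite Q \<and> Q \<subseteq> P \<and> e > 0 \<and> {w \<in> S. \<forall>p\<in>Q. p (fdiff w u) < e} \<subseteq> U \<inter> U'"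
        by (intro exI[of _ "A \<union> B"] exI[of _ "min d e"]) auto
    qed
  next
    case (3 \<K>)
    then show ?case by blast
  next
    case (4 \<K>)
    show ?case
    proof
      fix u assume "u \<in> \<Union> \<K>"
      then obtain K where K: "K \<in> \<K>" "u \<in> K" by blast
      then obtain Q e where "finite Q" "Q \<subseteq> P" "e > 0" "{w \<in> S. \<forall>p\<in>Q. p (fdiff w u) < e} \<subseteq> K"
        using 4 by meson
      then show "\<exists>Q e. finite Q \<and> Q \<subseteq> P \<and> e > 0 \<and> {w \<in> S. \<forall>p\<in>Q. p (fdiff w u) < e} \<subseteq> \<Union> \<K>"
        using K(1) by blast
    qed
  qed
  then show ?thesis unfolding seminorm_top_def by (simp add: topology_inverse')
qed

lemma cont_seminorm_point:
  assumes lcs: "lcs E T" and c: "continuous_map T euclidean (\<lambda>f. f x)"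
  shows "cont_seminorm E T (\<lambda>f. norm (f x))"
proof -
  have "linear_on E (\<lambda>f. f x)" by (auto simp: linear_on_def fun_apply)
  then show ?thesis
    unfolding cont_seminorm_iff
    using seminorm_on_linear[OF lcs_subspace[OF lcs]] c by (auto intro: continuous_map_norm)
qed

text \<open>\<open>slice h v\<close> is the function \<open>h_v\<close> of the paper.\<close>

definition slice :: "('x \<times> 'y \<Rightarrow> 'k::real_normed_field) \<Rightarrow> (('y \<Rightarrow> 'k) \<Rightarrow> 'k) \<Rightarrow> 'x \<Rightarrow> 'k" where
  "slice h v = (\<lambda>x. v (\<lambda>y. h (x, y)))"

lemma section_linear:
  "(\<lambda>y. (h + h') (x, y)) = (\<lambda>y. h (x, y)) + (\<lambda>y. h' (x, y))"
  "(\<lambda>y. (h - h') (x, y)) = (\<lambda>y. h (x, y)) - (\<lambda>y. h' (x, y))"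
  "(\<lambda>y. fscale c h (x, y)) = fscale c (\<lambda>y. h (x, y))"
  by (simp_all add: fun_eq_iff fun_apply)

lemma section_tensor_sum:
  "(\<lambda>y. (\<Sum>i\<in>A. tensor_fun (f i) (g i)) (x, y)) = (\<Sum>i\<in>A. fscale (f i x) (g i))"
  by (simp add: fun_eq_iff sum_fun_apply fscale_apply tensor_fun_def)

section \<open>The spaces of the theorem: sections, slices and their continuity\<close>

context
  fixes F :: "('x \<Rightarrow> 'k::real_normed_field) set" and TF :: "('x \<Rightarrow> 'k) topology"
    and G :: "('y \<Rightarrow> 'k) set" and TG :: "('y \<Rightarrow> 'k) topology"
    and H :: "('x \<times> 'y \<Rightarrow> 'k) set" and TH :: "('x \<times> 'y \<Rightarrow> 'k) topology"
  assumes lcsF: "lcs F TF" and lcsG: "lcs G TG"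
    and FG: "(frechet_space F TF \<and> frechet_space G TG) \<or>
             (reflexive_lcs F TF \<and> DF_space F TF \<and> reflexive_lcs G TG \<and> DF_space G TG)"
    and barH: "barrelled H TH" and complH: "complete_lcs TH"
    and nucG: "nuclear G TG"
    and ptF: "\<And>x. continuous_map TF euclidean (\<lambda>f. f x)"
    and ptG: "\<And>y. continuous_map TG euclidean (\<lambda>g. g y)"
    and ptH: "\<And>z. continuous_map TH euclidean (\<lambda>h. h z)"
    and i1: "\<And>f g. f \<in> F \<Longrightarrow> g \<in> G \<Longrightarrow> tensor_fun f g \<in> H"
    and i2: "\<And>f. f \<in> F \<Longrightarrow> continuous_map TG TH (\<lambda>g. tensor_fun f g)"
    and i3: "\<And>g. g \<in> G \<Longrightarrow> continuous_map TF TH (\<lambda>f. tensor_fun f g)"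
    and ii1: "\<And>h x. h \<in> H \<Longrightarrow> (\<lambda>y. h (x, y)) \<in> G"
    and ii2: "\<And>h v. h \<in> H \<Longrightarrow> v \<in> dual G TG \<Longrightarrow> slice h v \<in> F"
begin

lemma lcsH: "lcs H TH"
  using barH by (simp add: barrelled_def)

lemmas subF = lcs_subspace[OF lcsF] and subG = lcs_subspace[OF lcsG] and subH = lcs_subspace[OF lcsH]
  and snF = cont_seminorm_seminorm[OF lcsF] and snG = cont_seminorm_seminorm[OF lcsG]
  and snH = cont_seminorm_seminorm[OF lcsH] and subD = dual_subspace[OF lcsG]

text \<open>Joint continuity in terms of seminorms; each alternative for \<open>F\<close> and
  \<open>G\<close> has its own uniform boundedness argument.\<close>

lemma tensor_dominated:
  assumes t: "cont_seminorm H TH t"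
  shows "\<exists>p q. cont_seminorm F TF p \<and> cont_seminorm G TG q \<and> (\<forall>f\<in>F. \<forall>g\<in>G. t (tensor_fun f g) \<le> p f * q g)"
proof -
  have ct: "continuous_map TH euclideanreal t" using t by (simp add: cont_seminorm_iff)
  have bF: "cont_seminorm F TF (\<lambda>f. t (tensor_fun f g))" if g: "g \<in> G" for g
    unfolding cont_seminorm_iff
    using seminorm_on_comp[OF linear_map_tensor_fun(1) i1[OF _ g] snH[OF t]]
      continuous_map_compose[OF i3[OF g] ct] by (simp add: o_def)
  have bG: "cont_seminorm G TG (\<lambda>g. t (tensor_fun f g))" if f: "f \<in> F" for f
    unfolding cont_seminorm_iff
    using seminorm_on_comp[OF linear_map_tensor_fun(2) i1[OF f] snH[OF t]]
      continuous_map_compose[OF i2[OF f] ct] by (simp add: o_def)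
  from FG show ?thesis
  proof
    assume fr: "frechet_space F TF \<and> frechet_space G TG"
    obtain pF where pF: "frechet_family F (cont_seminorm F TF) pF"
      using frechet_space_family[OF fr[THEN conjunct1]] by blast
    obtain pG where pG: "frechet_family G (cont_seminorm G TG) pG"
      using frechet_space_family[OF fr[THEN conjunct2]] by blast
    show ?thesis by (rule separately_continuous_frechet[OF pF pG]) (fact bF bG)+
  next
    assume DF: "reflexive_lcs F TF \<and> DF_space F TF \<and> reflexive_lcs G TG \<and> DF_space G TG"
    show ?thesis by (rule separately_continuous_reflexive_DF) (use DF bF bG in auto)
  qed
qed

text \<open>Makes \<open>slice h v x\<close> depend continuously on \<open>h\<close>, which is the
  graph condition in \<open>cont_seminorm_slice\<close>.\<close>

lemma cont_seminorm_section:
  assumes q: "cont_seminorm G TG q" shows "cont_seminorm H TH (\<lambda>h. q (\<lambda>y. h (x, y)))"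
proof (rule closed_graph[OF barrelled_family_barrelled[OF barH], where F = G and T = TG])
  show "frechet_space G TG \<or> reflexive_lcs G TG \<and> DF_space G TG" using FG by blast
  show "linear_map_on H (\<lambda>h y. h (x, y))" by (auto simp: linear_map_on_def linear_on_def fun_apply)
  show "\<exists>s. cont_seminorm H TH s \<and> (\<forall>h\<in>H. norm (h (x, y)) \<le> s h)" for y
    using cont_seminorm_point[OF lcsH ptH] by blast
  show "\<exists>q. cont_seminorm G TG q \<and> (\<forall>g\<in>G. norm (g y) \<le> q g)" for y
    using cont_seminorm_point[OF lcsG ptG] by blast
qed (use q ii1 in auto)

lemma slice_linear_left: "v \<in> dual G TG \<Longrightarrow> linear_map_on H (\<lambda>h. slice h v)"
  using dual_linear[OF lcsG, of v] ii1
  by (auto simp: linear_map_on_def linear_on_def slice_def section_linear)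

lemma slice_linear_right:
  "slice h (v + w) = slice h v + slice h w" "slice h (v - w) = slice h v - slice h w"
  "slice h (fscale c v) = fscale c (slice h v)"
  by (simp_all add: slice_def fun_eq_iff fun_apply)

lemma cont_seminorm_slice:
  assumes v: "v \<in> dual G TG" and p: "cont_seminorm F TF p"
  shows "cont_seminorm H TH (\<lambda>h. p (slice h v))"
proof (rule closed_graph[OF barrelled_family_barrelled[OF barH], where F = F and T = TF])
  show "frechet_space F TF \<or> reflexive_lcs F TF \<and> DF_space F TF" using FG by blast
  show "linear_map_on H (\<lambda>h. slice h v)" by (rule slice_linear_left[OF v])
  obtain q where q: "cont_seminorm G TG q" "\<And>g. g \<in> G \<Longrightarrow> norm (v g) \<le> q g"
    using v unfolding dual_iff[OF lcsG] by blast
  show "\<exists>s. cont_seminorm H TH s \<and> (\<forall>h\<in>H. norm (slice h v x) \<le> s h)" for x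
    using cont_seminorm_section[OF q(1), of x] q(2)[OF ii1] unfolding slice_def by blast
  show "\<exists>q. cont_seminorm F TF q \<and> (\<forall>f\<in>F. norm (f x) \<le> q f)" for x
    using cont_seminorm_point[OF lcsF ptF] by blast
qed (use p v ii2 in auto)

text \<open>For fixed \<open>h\<close>, boundedness over the polar of \<open>q\<close> is the closed graph theorem for \<open>v \<mapsto> h_v\<close> on the
  Banach space of functionals bounded by a multiple of \<open>q\<close>; the supremum is then continuous because
  \<open>H\<close> is barrelled.\<close>

lemma slice_equicontinuous:
  assumes p: "cont_seminorm F TF p" and q: "cont_seminorm G TG q"
  shows "\<exists>s. cont_seminorm H TH s \<and>
    (\<forall>h\<in>H. \<forall>v\<in>dual G TG. (\<forall>g\<in>G. norm (v g) \<le> q g) \<longrightarrow> p (slice h v) \<le> s h)"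
proof -
  let ?X = "functional_space G q" and ?N = "functional_norm G q"
  note fr = frechet_functional_space[OF subG snG[OF q]]
  have XD: "?X \<subseteq> dual G TG"
  proof
    fix v assume v: "v \<in> ?X"
    then obtain C where C: "\<And>g. g \<in> G \<Longrightarrow> norm (v g) \<le> C * q g" unfolding functional_space_def by blast
    have "norm (v g) \<le> \<bar>C\<bar> * q g" if g: "g \<in> G" for g
      using C[OF g] mult_right_mono[OF abs_ge_self seminorm_ge_0[OF subG snG[OF q] g], of C] by linarith
    then show "v \<in> dual G TG"
      using v cont_seminorm_scale[OF lcsG q, of "\<bar>C\<bar>"]
      unfolding dual_iff[OF lcsG] functional_space_def by (auto intro!: exI[of _ "\<lambda>g. \<bar>C\<bar> * q g"])
  qed
  define I where "I = {v \<in> dual G TG. \<forall>g\<in>G. norm (v g) \<le> q g}"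
  have bd: "\<exists>C. \<forall>v\<in>I. p (slice h v) \<le> C" if h: "h \<in> H" for h
  proof -
    have "normed_family ?X ?N (\<lambda>v. p (slice h v))"
    proof (rule closed_graph[OF frechet_barrelled_family[OF fr], where F = F and T = TF])
      show "frechet_space F TF \<or> reflexive_lcs F TF \<and> DF_space F TF" using FG by blast
      show "linear_map_on ?X (\<lambda>v. slice h v)"
        by (simp add: linear_map_on_def linear_on_def slice_linear_right fun_apply)
      show "\<exists>s. normed_family ?X ?N s \<and> (\<forall>v\<in>?X. norm (slice h v x) \<le> s v)" for x
        using seminorm_eval[OF subG snG[OF q] ii1[OF h, of x]] unfolding slice_def by blast
      show "\<exists>q. cont_seminorm F TF q \<and> (\<forall>f\<in>F. norm (f x) \<le> q f)" for x
        using cont_seminorm_point[OF lcsF ptF] by blast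
    qed (use p ii2[OF h] XD in auto)
    then obtain C where C: "\<And>v. v \<in> ?X \<Longrightarrow> p (slice h v) \<le> C * ?N v" unfolding normed_family_def by blast
    have "p (slice h v) \<le> \<bar>C\<bar>" if v: "v \<in> I" for v
    proof -
      have b: "norm (v g) \<le> 1 * q g" if "g \<in> G" for g using v that by (simp add: I_def)
      have vX: "v \<in> ?X"
        using v b unfolding functional_space_def by (auto simp: I_def dual_iff[OF lcsG] intro!: exI[of _ 1])
      have N: "0 \<le> ?N v" "?N v \<le> 1"
        by (rule functional_norm_ge_0[OF subG snG[OF q] vX], rule functional_norm_le[OF subG snG[OF q] _ b]) simp
      have "p (slice h v) \<le> C * ?N v" by (rule C[OF vX])
      also have "\<dots> \<le> \<bar>C\<bar> * 1" using N by (intro mult_mono) auto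
      finally show ?thesis by simp
    qed
    then show ?thesis by blast
  qed
  have "\<exists>s. cont_seminorm H TH s \<and> (\<forall>v\<in>I. \<forall>h\<in>H. p (slice h v) \<le> s h)"
    by (rule sup_closedD[OF barrelled_family_sup_closed[OF barrelled_family_barrelled[OF barH]] _ bd])
      (auto simp: I_def intro: cont_seminorm_slice p)
  then show ?thesis unfolding I_def by blast
qed

section \<open>Projective seminorms, embedding and density\<close>

lemma tensor_span_subset: "tensor_span F G \<subseteq> H"
proof
  fix u assume "u \<in> tensor_span F G"
  then obtain n f g where "\<forall>i<n. f i \<in> F \<and> g i \<in> G" "u = (\<Sum>i<n::nat. tensor_fun (f i) (g i))"
    unfolding tensor_span_iff by blast
  then show "u \<in> H" using i1 by (auto intro!: subspace_sum[OF subH])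
qed

text \<open>For a finite-rank operator \<open>P\<close> with functionals \<open>b m\<close> and
  vectors \<open>z m\<close>, \<open>u\<close> splits into the tensors of
  \<open>slice u (b m)\<close> with \<open>z m\<close> and a remainder having
  \<open>g i - P (g i)\<close> in place of \<open>g i\<close>. The first part costs at most
  \<open>K * s\<close> at every accuracy. The bound \<open>s\<close> is a parameter because it is a
  seminorm of \<open>H\<close> in the embedding and a fixed number in the Cauchy estimate.\<close>

lemma pi_seminorm_slice:
  assumes p: "cont_seminorm F TF p" and q: "cont_seminorm G TG q"
  shows "\<exists>Q K. cont_seminorm G TG Q \<and> K \<ge> 0 \<and> (\<forall>u\<in>tensor_span F G. \<forall>s.
    (\<forall>v\<in>dual G TG. (\<forall>g\<in>G. norm (v g) \<le> Q g) \<longrightarrow> p (slice u v) \<le> s) \<longrightarrow> pi_seminorm F G p q u \<le> K * s)"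
proof -
  from nuclear_approximation[OF nucG q] obtain Q K where Q: "cont_seminorm G TG Q" and K: "K \<ge> 0"
    and approx: "\<And>r. r > 0 \<Longrightarrow> \<exists>(N::nat) b z.
      (\<forall>m<N. b m \<in> dual G TG \<and> z m \<in> G \<and> (\<forall>g\<in>G. norm (b m g) \<le> Q g)) \<and>
      (\<Sum>m<N. q (z m)) \<le> K \<and> (\<forall>g\<in>G. q (g - (\<Sum>m<N. fscale (b m g) (z m))) \<le> r * Q g)"
    by (elim exE conjE) blast
  have p0: "0 \<le> p f" if "f \<in> F" for f by (rule seminorm_ge_0[OF subF snF[OF p] that])
  have q0: "0 \<le> q g" if "g \<in> G" for g by (rule seminorm_ge_0[OF subG snG[OF q] that])
  have Q0: "0 \<le> Q g" if "g \<in> G" for g by (rule seminorm_ge_0[OF subG snG[OF Q] that])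
  have "pi_seminorm F G p q u \<le> K * s"
    if u: "u \<in> tensor_span F G"
      and s: "\<And>v. v \<in> dual G TG \<Longrightarrow> (\<forall>g\<in>G. norm (v g) \<le> Q g) \<Longrightarrow> p (slice u v) \<le> s" for u s
  proof (rule field_le_epsilon)
    fix e :: real assume e: "e > 0"
    obtain n f g where fg: "\<And>i. i < n \<Longrightarrow> f i \<in> F" "\<And>i. i < n \<Longrightarrow> g i \<in> G"
      and u_eq: "u = (\<Sum>i<n::nat. tensor_fun (f i) (g i))" using u unfolding tensor_span_iff by blast
    \<comment> \<open>Depends on the chosen representation of \<open>u\<close>, hence the accuracy
      \<open>r\<close> is fixed only now; the \<open>+ 1\<close> in \<open>r\<close> avoids a
      vanishing denominator.\<close>
    define W where "W = (\<Sum>i<n. p (f i) * Q (g i))"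
    have W: "W \<ge> 0" unfolding W_def by (intro sum_nonneg mult_nonneg_nonneg p0 Q0 fg) auto
    define r where "r = e / (W + 1)"
    have r: "r > 0" using e W by (simp add: r_def)
    from approx[OF r] obtain N b z where b: "\<And>m. m < N \<Longrightarrow> b m \<in> dual G TG" and z: "\<And>m. m < N \<Longrightarrow> z m \<in> G"
      and bQ: "\<And>m g. m < N \<Longrightarrow> g \<in> G \<Longrightarrow> norm (b m g) \<le> Q g" and zK: "(\<Sum>m<N::nat. q (z m)) \<le> K"
      and P: "\<And>g. g \<in> G \<Longrightarrow> q (g - (\<Sum>m<N. fscale (b m g) (z m))) \<le> r * Q g"
      by (elim exE conjE) blast
    define g' where "g' i = g i - (\<Sum>m<N. fscale (b m (g i)) (z m))" for i
    have uH: "u \<in> H" using u tensor_span_subset by blast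
    have sl: "slice u (b m) \<in> F" if "m < N" for m by (rule ii2[OF uH b[OF that]])
    have g': "g' i \<in> G" if "i < n" for i
      unfolding g'_def using that by (intro subspace_diff[OF subG] subspace_sum[OF subG] subspace_scale[OF subG] fg z) auto
    let ?A = "{..<N} <+> {..<n}"
    have slice_u: "slice u (b m) x = (\<Sum>i<n. f i x * b m (g i))" if m: "m < N" for m x
    proof -
      note lin = dual_linear[OF lcsG b[OF m]]
      have "slice u (b m) x = b m (\<Sum>i<n. fscale (f i x) (g i))"
        unfolding slice_def u_eq section_tensor_sum ..
      also have "\<dots> = (\<Sum>i<n. b m (fscale (f i x) (g i)))"
        by (rule linear_on_sum[OF subG lin]) (auto intro: subspace_scale[OF subG] fg)
      also have "\<dots> = (\<Sum>i<n. f i x * b m (g i))"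
        by (intro sum.cong refl linear_on_scale[OF lin] fg) simp
      finally show ?thesis .
    qed
    have "u = (\<Sum>i\<in>?A. tensor_fun (case_sum (\<lambda>m. slice u (b m)) f i) (case_sum z g' i))"
    proof (rule ext)
      fix xy :: "'x \<times> 'y"
      obtain x y where xy: "xy = (x, y)" by force
      have "(\<Sum>m<N. tensor_fun (slice u (b m)) (z m)) xy = (\<Sum>m<N. (\<Sum>i<n. f i x * b m (g i)) * z m y)"
        unfolding sum_fun_apply xy tensor_fun_apply by (intro sum.cong refl) (simp add: slice_u)
      also have "\<dots> = (\<Sum>m<N. \<Sum>i<n. f i x * (b m (g i) * z m y))" by (simp add: sum_distrib_right mult.assoc)
      also have "\<dots> = (\<Sum>i<n. \<Sum>m<N. f i x * (b m (g i) * z m y))" by (rule sum.swap)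
      also have "\<dots> = (\<Sum>i<n. f i x * (\<Sum>m<N. b m (g i) * z m y))" by (simp add: sum_distrib_left)
      finally have 1: "(\<Sum>m<N. tensor_fun (slice u (b m)) (z m)) xy = (\<Sum>i<n. f i x * (\<Sum>m<N. b m (g i) * z m y))" .
      have 2: "(\<Sum>i<n. tensor_fun (f i) (g' i)) xy = (\<Sum>i<n. f i x * (g i y - (\<Sum>m<N. b m (g i) * z m y)))"
        by (simp add: sum_fun_apply xy tensor_fun_apply g'_def fun_apply)
      have "u xy = (\<Sum>i<n. f i x * g i y)" by (simp add: u_eq xy sum_fun_apply tensor_fun_apply)
      also have "\<dots> = (\<Sum>m<N. tensor_fun (slice u (b m)) (z m)) xy + (\<Sum>i<n. tensor_fun (f i) (g' i)) xy"
        unfolding 1 2 by (simp add: sum.distrib[symmetric] algebra_simps)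
      also have "\<dots> = (\<Sum>i\<in>?A. tensor_fun (case_sum (\<lambda>m. slice u (b m)) f i) (case_sum z g' i)) xy"
        by (simp add: sum.Plus plus_fun_apply)
      finally show "u xy = (\<Sum>i\<in>?A. tensor_fun (case_sum (\<lambda>m. slice u (b m)) f i) (case_sum z g' i)) xy" .
    qed
    moreover have "pi_seminorm F G p q (\<Sum>i\<in>?A. tensor_fun (case_sum (\<lambda>m. slice u (b m)) f i) (case_sum z g' i))
        \<le> (\<Sum>i\<in>?A. p (case_sum (\<lambda>m. slice u (b m)) f i) * q (case_sum z g' i))"
      by (rule pi_seminorm_le[OF subF subG snF[OF p] snG[OF q]]) (use sl fg z g' in auto)
    ultimately have "pi_seminorm F G p q u \<le> (\<Sum>i\<in>?A. p (case_sum (\<lambda>m. slice u (b m)) f i) * q (case_sum z g' i))"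
      by simp
    also have "\<dots> = (\<Sum>m<N. p (slice u (b m)) * q (z m)) + (\<Sum>i<n. p (f i) * q (g' i))"
      by (simp add: sum.Plus)
    also have "(\<Sum>m<N. p (slice u (b m)) * q (z m)) \<le> (\<Sum>m<N. s * q (z m))"
      by (intro sum_mono mult_right_mono s b q0 z) (auto simp: bQ)
    also have "(\<Sum>m<N. s * q (z m)) \<le> K * s"
    proof -
      \<comment> \<open>The functional 0 shows that any admissible \<open>s\<close> is
        nonnegative.\<close>
      have "0 \<in> dual G TG" by (rule subspace_0[OF subD])
      then have "p (slice u 0) \<le> s" by (rule s) (simp add: zero_fun_apply Q0)
      moreover have "0 \<le> p (slice u 0)" by (intro p0 ii2 uH subspace_0[OF subD])
      ultimately have "s \<ge> 0" by simp
      then show ?thesis using mult_left_mono[OF zK, of s] by (simp add: sum_distrib_left mult.commute)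
    qed
    also have "(\<Sum>i<n. p (f i) * q (g' i)) \<le> (\<Sum>i<n. p (f i) * (r * Q (g i)))"
      unfolding g'_def by (intro sum_mono mult_left_mono P fg p0) auto
    also have "\<dots> = r * W" by (simp add: W_def sum_distrib_left algebra_simps)
    also have "r * W \<le> e" using e W by (simp add: r_def divide_simps)
    finally show "pi_seminorm F G p q u \<le> K * s + e" by simp
  qed
  then show ?thesis using Q K by blast
qed

lemma pi_seminorm_continuous:
  assumes p: "cont_seminorm F TF p" and q: "cont_seminorm G TG q"
  shows "\<exists>s. cont_seminorm H TH s \<and> (\<forall>u\<in>tensor_span F G. pi_seminorm F G p q u \<le> s u)"
proof -
  obtain Q K where Q: "cont_seminorm G TG Q" and K: "K \<ge> 0"
    and le: "\<And>u s. u \<in> tensor_span F G \<Longrightarrow>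
      (\<forall>v\<in>dual G TG. (\<forall>g\<in>G. norm (v g) \<le> Q g) \<longrightarrow> p (slice u v) \<le> s) \<Longrightarrow> pi_seminorm F G p q u \<le> K * s"
    using pi_seminorm_slice[OF p q] by (elim exE conjE) blast
  obtain s where s: "cont_seminorm H TH s"
    "\<forall>h\<in>H. \<forall>v\<in>dual G TG. (\<forall>g\<in>G. norm (v g) \<le> Q g) \<longrightarrow> p (slice h v) \<le> s h"
    using slice_equicontinuous[OF p Q] by blast
  have "pi_seminorm F G p q u \<le> K * s u" if u: "u \<in> tensor_span F G" for u
    by (rule le[OF u]) (use s(2) u tensor_span_subset in blast)
  then show ?thesis using cont_seminorm_scale[OF lcsH s(1) K] by blast
qed

lemma continuous_map_tensor_fun: "continuous_map (prod_topology TF TG) TH (\<lambda>(f, g). tensor_fun f g)"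
  unfolding continuous_map_def
proof (intro conjI allI impI)
  show "(\<lambda>(f, g). tensor_fun f g) \<in> topspace (prod_topology TF TG) \<rightarrow> topspace TH"
    using i1 by (auto simp: lcs_topspace[OF lcsF] lcs_topspace[OF lcsG] lcs_topspace[OF lcsH])
  fix U assume U: "openin TH U"
  show "openin (prod_topology TF TG) {z \<in> topspace (prod_topology TF TG). (case z of (f, g) \<Rightarrow> tensor_fun f g) \<in> U}"
    unfolding openin_prod_topology_alt
  proof (intro allI impI)
    fix f0 g0
    assume "(f0, g0) \<in> {z \<in> topspace (prod_topology TF TG). (case z of (f, g) \<Rightarrow> tensor_fun f g) \<in> U}"
    then have fg0: "f0 \<in> F" "g0 \<in> G" "tensor_fun f0 g0 \<in> U"
      by (auto simp: lcs_topspace[OF lcsF] lcs_topspace[OF lcsG])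
    then obtain t where t: "cont_seminorm H TH t" "{h \<in> H. t (h - tensor_fun f0 g0) < 1} \<subseteq> U"
      using U unfolding openin_iff_cont_seminorm[OF lcsH] by blast
    obtain p q where p: "cont_seminorm F TF p" and q: "cont_seminorm G TG q"
      and pq: "\<And>f g. f \<in> F \<Longrightarrow> g \<in> G \<Longrightarrow> t (tensor_fun f g) \<le> p f * q g"
      using tensor_dominated[OF t(1)] by blast
    have p0: "0 \<le> p f" if "f \<in> F" for f by (rule seminorm_ge_0[OF subF snF[OF p] that])
    have q0: "0 \<le> q g" if "g \<in> G" for g by (rule seminorm_ge_0[OF subG snG[OF q] that])
    \<comment> \<open>Among the three terms of the bilinear expansion at \<open>(f0, g0)\<close>,
      the quadratic one is reduced to a linear one by \<open>a \<le> 1\<close>, so that the sum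
      stays below \<open>a * (1 + q g0 + p f0) = 1\<close>.\<close>
    define a where "a = 1 / (1 + q g0 + p f0)"
    have a: "0 < a" "a \<le> 1" "a * (1 + q g0 + p f0) = 1" using p0[OF fg0(1)] q0[OF fg0(2)] by (auto simp: a_def)
    have "tensor_fun f g \<in> U" if f: "f \<in> F" "p (f - f0) < a" and g: "g \<in> G" "q (g - g0) < a" for f g
    proof -
      have d: "f - f0 \<in> F" "g - g0 \<in> G" using f g fg0 by (auto intro: subspace_diff[OF subF] subspace_diff[OF subG])
      have e: "tensor_fun f g - tensor_fun f0 g0
          = (tensor_fun (f - f0) (g - g0) + tensor_fun (f - f0) g0) + tensor_fun f0 (g - g0)"
        by (simp add: tensor_fun_linear)
      have "t (tensor_fun f g - tensor_fun f0 g0)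
          \<le> (t (tensor_fun (f - f0) (g - g0)) + t (tensor_fun (f - f0) g0)) + t (tensor_fun f0 (g - g0))"
        unfolding e
        by (intro order_trans[OF seminorm_add[OF subH snH[OF t(1)]]] add_right_mono
            seminorm_add[OF subH snH[OF t(1)]] subspace_add[OF subH] i1 d fg0)
      also have "\<dots> \<le> (p (f - f0) * q (g - g0) + p (f - f0) * q g0) + p f0 * q (g - g0)"
        by (intro add_mono pq d fg0)
      also have "\<dots> \<le> (p (f - f0) * 1 + p (f - f0) * q g0) + p f0 * a"
        using f(2) g(2) a p0 q0 d fg0 by (intro add_mono mult_left_mono) auto
      also have "\<dots> = p (f - f0) * (1 + q g0) + p f0 * a" by (simp add: algebra_simps)
      also have "\<dots> < a * (1 + q g0) + p f0 * a"
        using f(2) q0[OF fg0(2)] by (intro add_strict_right_mono mult_strict_right_mono) auto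
      also have "\<dots> = 1" using a(3) by (simp add: algebra_simps)
      finally show ?thesis using t(2) i1[OF f(1) g(1)] by blast
    qed
    moreover have "openin TF {f \<in> F. p (f - f0) < a}" "openin TG {g \<in> G. q (g - g0) < a}"
      by (rule openin_seminorm_ball[OF lcsF p fg0(1)] openin_seminorm_ball[OF lcsG q fg0(2)])+
    moreover have "f0 \<in> {f \<in> F. p (f - f0) < a}" "g0 \<in> {g \<in> G. q (g - g0) < a}"
      using fg0 a by (auto simp: seminorm_0[OF subF snF[OF p]] seminorm_0[OF subG snG[OF q]])
    ultimately show "\<exists>V W. openin TF V \<and> openin TG W \<and> f0 \<in> V \<and> g0 \<in> W \<and>
        V \<times> W \<subseteq> {z \<in> topspace (prod_topology TF TG). (case z of (f, g) \<Rightarrow> tensor_fun f g) \<in> U}"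
      by (intro exI[of _ "{f \<in> F. p (f - f0) < a}"] exI[of _ "{g \<in> G. q (g - g0) < a}"])
        (auto simp: lcs_topspace[OF lcsF] lcs_topspace[OF lcsG])
  qed
qed

text \<open>One direction is continuity of the tensor map, which bounds seminorms of
  \<open>H\<close> by projective ones; the other is the nuclear estimate
  \<open>pi_seminorm_continuous\<close>.\<close>

lemma subtopology_tensor_span: "subtopology TH (tensor_span F G) = proj_tensor_top F TF G TG"
  unfolding topology_eq
proof (intro allI iffI)
  let ?S = "tensor_span F G" and ?P = "{pi_seminorm F G p q | p q. cont_seminorm F TF p \<and> cont_seminorm G TG q}"
  note subS = tensor_span_subspace[OF subF subG]
  fix W
  {
    assume "openin (subtopology TH ?S) W"
    then obtain U where U: "openin TH U" "W = U \<inter> ?S" unfolding openin_subtopology by blast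
    show "openin (proj_tensor_top F TF G TG) W"
      unfolding proj_tensor_top_def openin_seminorm_top
    proof (intro conjI ballI)
      show "W \<subseteq> ?S" using U by blast
      fix u assume u: "u \<in> W"
      then obtain t where t: "cont_seminorm H TH t" "{h \<in> H. t (h - u) < 1} \<subseteq> U"
        using U unfolding openin_iff_cont_seminorm[OF lcsH] by blast
      obtain p q where p: "cont_seminorm F TF p" and q: "cont_seminorm G TG q"
        and pq: "\<And>f g. f \<in> F \<Longrightarrow> g \<in> G \<Longrightarrow> t (tensor_fun f g) \<le> p f * q g"
        using tensor_dominated[OF t(1)] by blast
      have "w \<in> W" if w: "w \<in> ?S" "pi_seminorm F G p q (fdiff w u) < 1" for w
      proof -
        have "w - u \<in> ?S" using w u U(2) by (intro subspace_diff[OF subS]) auto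
        then have "t (w - u) \<le> pi_seminorm F G p q (w - u)"
          by (intro pi_seminorm_ge[OF subF subG snF[OF p] snG[OF q] subH snH[OF t(1)]] i1 pq)
        then have "w \<in> U" using t(2) w tensor_span_subset by (auto simp: fun_ops)
        then show ?thesis using w U(2) by blast
      qed
      then show "\<exists>Q e. finite Q \<and> Q \<subseteq> ?P \<and> e > 0 \<and> {w \<in> ?S. \<forall>p\<in>Q. p (fdiff w u) < e} \<subseteq> W"
        using p q by (intro exI[of _ "{pi_seminorm F G p q}"] exI[of _ 1]) auto
    qed
  next
    assume W: "openin (proj_tensor_top F TF G TG) W"
    then have WS: "W \<subseteq> ?S" unfolding proj_tensor_top_def openin_seminorm_top by blast
    have "\<exists>t. cont_seminorm H TH t \<and> {w \<in> ?S. t (w - u) < 1} \<subseteq> W" if u: "u \<in> W" for u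
    proof -
      obtain Q e where Q: "finite Q" "Q \<subseteq> ?P" "e > 0" "{w \<in> ?S. \<forall>p\<in>Q. p (fdiff w u) < e} \<subseteq> W"
        using W u unfolding proj_tensor_top_def openin_seminorm_top by meson
      have "\<forall>p\<in>Q. \<exists>s. cont_seminorm H TH s \<and> (\<forall>u\<in>?S. p u \<le> s u)"
        using Q(2) pi_seminorm_continuous by blast
      then obtain s where s: "\<And>p. p \<in> Q \<Longrightarrow> cont_seminorm H TH (s p)" "\<And>p u. p \<in> Q \<Longrightarrow> u \<in> ?S \<Longrightarrow> p u \<le> s p u"
        by metis
      \<comment> \<open>A single seminorm of \<open>H\<close> that controls the finitely many
        projective seminorms at radius \<open>e\<close>.\<close>
      define t where "t h = (1 / e) * (\<Sum>p\<in>Q. s p h)" for h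
      have t: "cont_seminorm H TH t"
        unfolding t_def using Q(3) by (intro cont_seminorm_scale[OF lcsH] cont_seminorm_sum[OF lcsH] s) auto
      have "w \<in> W" if w: "w \<in> ?S" "t (w - u) < 1" for w
      proof -
        have wu: "w - u \<in> ?S" using w u WS by (intro subspace_diff[OF subS]) auto
        have wuH: "w - u \<in> H" using wu tensor_span_subset by blast
        have "p (w - u) < e" if pQ: "p \<in> Q" for p
        proof -
          have "p (w - u) \<le> s p (w - u)" by (rule s(2)[OF pQ wu])
          also have "\<dots> \<le> (\<Sum>p\<in>Q. s p (w - u))"
            using Q(1) pQ seminorm_ge_0[OF subH snH[OF s(1)] wuH] by (intro member_le_sum) auto
          also have "\<dots> < e" using w(2) Q(3) by (simp add: t_def field_simps)
          finally show ?thesis .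
        qed
        then show ?thesis using Q(4) w(1) by (auto simp: fun_ops)
      qed
      then show ?thesis using t by blast
    qed
    then have "\<forall>u\<in>W. \<exists>t. cont_seminorm H TH t \<and> {w \<in> ?S. t (w - u) < 1} \<subseteq> W" by blast
    from bchoice[OF this] obtain t where "\<forall>u\<in>W. cont_seminorm H TH (t u) \<and> {w \<in> ?S. t u (w - u) < 1} \<subseteq> W"
      by (elim exE)
    then have t: "\<And>u. u \<in> W \<Longrightarrow> cont_seminorm H TH (t u)"
      "\<And>u. u \<in> W \<Longrightarrow> {w \<in> ?S. t u (w - u) < 1} \<subseteq> W" by simp_all
    \<comment> \<open>The balls are taken in the whole of \<open>H\<close>, which makes their union
      open there; their traces on the tensor product lie in \<open>W\<close>.\<close>
    define U where "U = (\<Union>u\<in>W. {w \<in> H. t u (w - u) < 1})"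
    have "openin TH U"
      unfolding U_def using t(1) WS tensor_span_subset by (intro openin_Union) (auto intro: openin_seminorm_ball[OF lcsH])
    moreover have "W = U \<inter> ?S"
    proof
      show "W \<subseteq> U \<inter> ?S"
      proof
        fix u assume u: "u \<in> W"
        then have "u \<in> {w \<in> H. t u (w - u) < 1}"
          using WS tensor_span_subset seminorm_0[OF subH snH[OF t(1)[OF u]]] by auto
        then show "u \<in> U \<inter> ?S" using u WS unfolding U_def by blast
      qed
      show "U \<inter> ?S \<subseteq> W" unfolding U_def using t(2) by blast
    qed
    ultimately show "openin (subtopology TH ?S) W" unfolding openin_subtopology by blast
  }
qed

text \<open>With \<open>u\<close> the tensor built from \<open>slice h (b m)\<close> and
  \<open>z m\<close>, slicing \<open>h - u\<close> by \<open>v\<close> is slicing \<open>h\<close>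
  by \<open>v\<close> composed with the error of the finite-rank operator, a functional bounded by
  \<open>r * Q g\<close>.\<close>

lemma slice_approximation:
  assumes h: "h \<in> H" and p: "cont_seminorm F TF p" and q: "cont_seminorm G TG q"
  shows "\<exists>u\<in>tensor_span F G. \<forall>v\<in>dual G TG. (\<forall>g\<in>G. norm (v g) \<le> q g) \<longrightarrow> p (slice (h - u) v) \<le> 1"
proof -
  from nuclear_approximation[OF nucG q] obtain Q K where Q: "cont_seminorm G TG Q"
    and approx: "\<And>r. r > 0 \<Longrightarrow> \<exists>(N::nat) b z.
      (\<forall>m<N. b m \<in> dual G TG \<and> z m \<in> G \<and> (\<forall>g\<in>G. norm (b m g) \<le> Q g)) \<and>
      (\<Sum>m<N. q (z m)) \<le> K \<and> (\<forall>g\<in>G. q (g - (\<Sum>m<N. fscale (b m g) (z m))) \<le> r * Q g)"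
    by (elim exE conjE) blast
  obtain s where s: "\<And>v. v \<in> dual G TG \<Longrightarrow> (\<forall>g\<in>G. norm (v g) \<le> Q g) \<Longrightarrow> p (slice h v) \<le> s"
    using slice_equicontinuous[OF p Q] h by blast
  \<comment> \<open>Makes \<open>r * s \<le> 1\<close>, and is positive for every
    \<open>s\<close>.\<close>
  define r where "r = 1 / (\<bar>s\<bar> + 1)"
  have r: "r > 0" by (simp add: r_def add_nonneg_pos)
  from approx[OF r] obtain N b z where b: "\<And>m. m < N \<Longrightarrow> b m \<in> dual G TG" and z: "\<And>m. m < (N::nat) \<Longrightarrow> z m \<in> G"
    and P: "\<And>g. g \<in> G \<Longrightarrow> q (g - (\<Sum>m<N. fscale (b m g) (z m))) \<le> r * Q g"
    by (elim exE conjE) blast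
  define u where "u = (\<Sum>m<N. tensor_fun (slice h (b m)) (z m))"
  have u: "u \<in> tensor_span F G" unfolding u_def by (rule tensor_spanI) (use ii2[OF h b] z in auto)
  have "p (slice (h - u) v) \<le> 1" if v: "v \<in> dual G TG" and vq: "\<forall>g\<in>G. norm (v g) \<le> q g" for v
  proof -
    note lv = dual_linear[OF lcsG v]
    define w where "w = v - (\<Sum>m<N. fscale (v (z m)) (b m))"
    have w: "w \<in> dual G TG"
      unfolding w_def by (intro subspace_diff[OF subD] subspace_sum[OF subD] subspace_scale[OF subD] v b) simp
    have w_eq: "w g = v (g - (\<Sum>m<N. fscale (b m g) (z m)))" if g: "g \<in> G" for g
    proof -
      have Pg: "(\<Sum>m<N. fscale (b m g) (z m)) \<in> G"
        by (intro subspace_sum[OF subG] subspace_scale[OF subG] z) simp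
      have "v (g - (\<Sum>m<N. fscale (b m g) (z m))) = v g - v (\<Sum>m<N. fscale (b m g) (z m))"
        by (rule linear_on_diff[OF subG lv g Pg])
      also have "v (\<Sum>m<N. fscale (b m g) (z m)) = (\<Sum>m<N. v (fscale (b m g) (z m)))"
        by (rule linear_on_sum[OF subG lv]) (auto intro: subspace_scale[OF subG] z)
      also have "\<dots> = (\<Sum>m<N. b m g * v (z m))"
        by (intro sum.cong refl linear_on_scale[OF lv] z) simp
      also have "v g - (\<Sum>m<N. b m g * v (z m)) = w g" by (simp add: w_def fun_apply sum_fun_apply mult.commute)
      finally show ?thesis by (rule sym)
    qed
    have "slice (h - u) v = slice h w"
    proof (rule ext)
      fix x
      have hx: "(\<lambda>y. h (x, y)) \<in> G" by (rule ii1[OF h])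
      have "(\<lambda>y. u (x, y)) = (\<Sum>m<N. fscale (b m (\<lambda>y. h (x, y))) (z m))"
        unfolding u_def section_tensor_sum by (simp add: slice_def)
      then show "slice (h - u) v x = slice h w x"
        unfolding slice_def section_linear w_eq[OF hx] by simp
    qed
    moreover have "p (slice h w) \<le> 1"
    proof -
      have "p (slice h (fscale (of_real (1 / r)) w)) \<le> s"
      proof (rule s)
        show "fscale (of_real (1 / r)) w \<in> dual G TG" by (rule subspace_scale[OF subD w])
        show "\<forall>g\<in>G. norm (fscale (of_real (1 / r)) w g) \<le> Q g"
        proof
          fix g assume g: "g \<in> G"
          have "(\<Sum>m<N. fscale (b m g) (z m)) \<in> G"
            by (intro subspace_sum[OF subG] subspace_scale[OF subG] z) simp
          then have "norm (w g) \<le> q (g - (\<Sum>m<N. fscale (b m g) (z m)))"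
            unfolding w_eq[OF g] using vq subspace_diff[OF subG g] by blast
          also have "\<dots> \<le> r * Q g" by (rule P[OF g])
          finally have "norm (w g) \<le> r * Q g" .
          then show "norm (fscale (of_real (1 / r)) w g) \<le> Q g"
            unfolding fscale_apply norm_mult norm_of_real using r by (simp add: field_simps)
        qed
      qed
      moreover have "p (slice h (fscale (of_real (1 / r)) w)) = 1 / r * p (slice h w)"
        unfolding slice_linear_right seminorm_scale[OF subF snF[OF p] ii2[OF h w]] norm_of_real using r by simp
      ultimately have "1 / r * p (slice h w) \<le> s" by simp
      then have "p (slice h w) \<le> r * s" using r by (simp add: pos_divide_le_eq mult.commute)
      also have "\<dots> \<le> 1" by (auto simp: r_def divide_simps)
      finally show ?thesis .
    qed
    ultimately show ?thesis by simp
  qed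
  then show ?thesis using u by blast
qed

text \<open>The approximants of \<open>h\<close> generate a filter on the tensor product that is Cauchy in \<open>H\<close> by the
  estimate of the projective seminorms; its limit agrees with \<open>h\<close> pointwise.\<close>

lemma closure_of_tensor_span: "TH closure_of (tensor_span F G) = H"
proof
  show "TH closure_of (tensor_span F G) \<subseteq> H"
    using closure_of_subset_topspace[of TH "tensor_span F G"] by (simp add: lcs_topspace[OF lcsH])
  show "H \<subseteq> TH closure_of (tensor_span F G)"
  proof
    fix h assume h: "h \<in> H"
    let ?S = "tensor_span F G"
    note subS = tensor_span_subspace[OF subF subG]
    define A where "A pq = {u \<in> ?S. \<forall>v\<in>dual G TG. (\<forall>g\<in>G. norm (v g) \<le> snd pq g) \<longrightarrow> fst pq (slice (h - u) v) \<le> (1::real)}" for pq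
    define I where "I = {pq. cont_seminorm F TF (fst pq) \<and> cont_seminorm G TG (snd pq)}"
    \<comment> \<open>The filter is indexed by pairs of seminorms, because the spaces may be
      nonmetrizable and one sequence of approximants need not suffice.\<close>
    define \<F> where "\<F> = (INF pq\<in>I. principal (A pq))"
    have ne: "A pq \<noteq> {}" if "pq \<in> I" for pq
      using slice_approximation[OF h, of "fst pq" "snd pq"] that unfolding A_def I_def by blast
    have dir: "\<exists>x\<in>I. principal (A x) \<le> inf (principal (A pq)) (principal (A pq'))" if "pq \<in> I" "pq' \<in> I" for pq pq'
    proof -
      obtain p q p' q' where eq: "pq = (p, q)" "pq' = (p', q')" by (metis surj_pair)
      have c: "cont_seminorm F TF p" "cont_seminorm G TG q" "cont_seminorm F TF p'" "cont_seminorm G TG q'"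
        using that by (auto simp: I_def eq)
      \<comment> \<open>Adding seminorms enlarges the set of test functionals and sharpens the
        bound, so this set of approximants lies in both given ones.\<close>
      let ?x = "(\<lambda>f. p f + p' f, \<lambda>g. q g + q' g)"
      have "?x \<in> I" using c cont_seminorm_add[OF lcsF] cont_seminorm_add[OF lcsG] by (simp add: I_def)
      moreover have "u \<in> A pq \<inter> A pq'" if u: "u \<in> A ?x" for u
      proof -
        have uS: "u \<in> ?S" using u by (simp add: A_def)
        have hu: "h - u \<in> H" using h uS tensor_span_subset by (intro subspace_diff[OF subH]) auto
        have "p (slice (h - u) v) \<le> 1 \<and> p' (slice (h - u) v) \<le> 1"
          if v: "v \<in> dual G TG" and le: "\<And>g. g \<in> G \<Longrightarrow> norm (v g) \<le> q g + q' g" for v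
        proof -
          have "p (slice (h - u) v) + p' (slice (h - u) v) \<le> 1" using u v le unfolding A_def by auto
          moreover have "p (slice (h - u) v) \<ge> 0" "p' (slice (h - u) v) \<ge> 0"
            by (rule seminorm_ge_0[OF subF snF ii2[OF hu v]], rule c)+
          ultimately show ?thesis by linarith
        qed
        moreover have "norm (v g) \<le> q g + q' g" if "norm (v g) \<le> q g \<or> norm (v g) \<le> q' g" "g \<in> G" for v g
          using that seminorm_ge_0[OF subG snG[OF c(2)] that(2)] seminorm_ge_0[OF subG snG[OF c(4)] that(2)] by linarith
        ultimately show ?thesis using uS unfolding A_def eq by auto
      qed
      ultimately show ?thesis by (intro bexI[of _ ?x]) auto
    qed
    have "(\<lambda>f. 0, \<lambda>g. 0) \<in> I" by (simp add: I_def cont_seminorm_zero[OF lcsF] cont_seminorm_zero[OF lcsG])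
    then have Ine: "I \<noteq> {}" by blast
    have ev: "eventually P \<F> \<longleftrightarrow> (\<exists>pq\<in>I. \<forall>u\<in>A pq. P u)" for P
      unfolding \<F>_def by (subst eventually_INF_base[OF Ine dir]) (auto simp: eventually_principal)
    have nb: "\<F> \<noteq> bot"
      unfolding trivial_limit_def ev using ne by auto
    have evA: "eventually (\<lambda>u. u \<in> A pq) \<F>" if "pq \<in> I" for pq unfolding ev using that by blast
    have evS: "eventually (\<lambda>u. u \<in> ?S) \<F>"
      unfolding ev using Ine by (auto simp: A_def)
    have "cauchy_filter TH \<F>"
      unfolding cauchy_filter_def fun_ops
    proof (intro conjI allI impI nb)
      show "eventually (\<lambda>f. f \<in> topspace TH) \<F>"
        using evS tensor_span_subset unfolding lcs_topspace[OF lcsH] by (auto elim: eventually_mono)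
      fix U assume "openin TH U \<and> 0 \<in> U"
      then obtain t where t: "cont_seminorm H TH t" "{f \<in> H. t f < 1} \<subseteq> U"
        using ex_cont_seminorm_subset[OF lcsH] by blast
      obtain p q where p: "cont_seminorm F TF p" and q: "cont_seminorm G TG q"
        and pq: "\<And>f g. f \<in> F \<Longrightarrow> g \<in> G \<Longrightarrow> t (tensor_fun f g) \<le> p f * q g"
        using tensor_dominated[OF t(1)] by blast
      obtain Q K where Q: "cont_seminorm G TG Q" and K: "K \<ge> 0"
        and piK: "\<And>u s. u \<in> ?S \<Longrightarrow> (\<forall>v\<in>dual G TG. (\<forall>g\<in>G. norm (v g) \<le> Q g) \<longrightarrow> p (slice u v) \<le> s)
          \<Longrightarrow> pi_seminorm F G p q u \<le> K * s"
        using pi_seminorm_slice[OF p q] by (elim exE conjE) blast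
      \<comment> \<open>Slices of two approximants differ by at most \<open>2 / c\<close> in
        \<open>p\<close>, and \<open>K * (2 / c) < 1\<close>.\<close>
      define c where "c = 4 * (K + 1)"
      have c: "c > 0" using K by (simp add: c_def)
      have I: "(\<lambda>f. c * p f, Q) \<in> I" using c Q cont_seminorm_scale[OF lcsF p, of c] by (simp add: I_def)
      have "u - w \<in> U" if u: "u \<in> A (\<lambda>f. c * p f, Q)" and w: "w \<in> A (\<lambda>f. c * p f, Q)" for u w
      proof -
        have uw: "u \<in> ?S" "w \<in> ?S" using u w by (auto simp: A_def)
        have uwS: "u - w \<in> ?S" by (rule subspace_diff[OF subS uw])
        have hu: "h - u \<in> H" "h - w \<in> H"
          using h uw tensor_span_subset by (auto intro!: subspace_diff[OF subH])
        have "p (slice (u - w) v) \<le> 2 / c" if v: "v \<in> dual G TG" and vQ: "\<forall>g\<in>G. norm (v g) \<le> Q g" for v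
        proof -
          have "slice (u - w) v = slice (h - w) v - slice (h - u) v"
            using linear_map_diff[OF subH slice_linear_left[OF v] hu(2) hu(1)] by simp
          then have "c * p (slice (u - w) v) \<le> c * (p (slice (h - w) v) + p (slice (h - u) v))"
            using c seminorm_diff[OF subF snF[OF p] ii2[OF hu(2) v] ii2[OF hu(1) v]] by simp
          moreover have "c * p (slice (h - w) v) \<le> 1" "c * p (slice (h - u) v) \<le> 1"
            using u w v vQ unfolding A_def by auto
          ultimately have "c * p (slice (u - w) v) \<le> 2" by (simp add: distrib_left)
          then show ?thesis using c by (simp add: pos_le_divide_eq mult.commute)
        qed
        then have pi: "pi_seminorm F G p q (u - w) \<le> K * (2 / c)" by (intro piK[OF uwS]) blast
        have "t (u - w) \<le> pi_seminorm F G p q (u - w)"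
          by (intro pi_seminorm_ge[OF subF subG snF[OF p] snG[OF q] subH snH[OF t(1)]] i1 pq uwS)
        also note pi
        also have "K * (2 / c) < 1" using K by (simp add: c_def divide_simps)
        finally have "t (u - w) < 1" .
        then show ?thesis using t(2) uwS tensor_span_subset by blast
      qed
      then show "eventually (\<lambda>(f, g). f - g \<in> U) (\<F> \<times>\<^sub>F \<F>)"
        unfolding eventually_prod_filter using evA[OF I]
        by (intro exI[of _ "\<lambda>u. u \<in> A (\<lambda>f. c * p f, Q)"] conjI) auto
    qed
    then obtain h' where h': "h' \<in> H" "limitin TH (\<lambda>f. f) h' \<F>"
      using complH unfolding complete_lcs_def lcs_topspace[OF lcsH] by blast
    have "h' (x, y) = h (x, y)" for x y
    proof (rule ccontr)
      assume ne': "h' (x, y) \<noteq> h (x, y)"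
      define e where "e = norm (h' (x, y) - h (x, y)) / 2"
      have e: "e > 0" using ne' by (simp add: e_def)
      have pt: "cont_seminorm H TH (\<lambda>h. norm (h (x, y)))" by (rule cont_seminorm_point[OF lcsH ptH])
      have "openin TH {f \<in> H. norm ((f - h') (x, y)) < e}" by (rule openin_seminorm_ball[OF lcsH pt h'(1)])
      moreover have "h' \<in> {f \<in> H. norm ((f - h') (x, y)) < e}" using h'(1) e by (simp add: fun_apply)
      ultimately have 1: "eventually (\<lambda>f. f \<in> {f \<in> H. norm ((f - h') (x, y)) < e}) \<F>"
        using h'(2) unfolding limitin_def by blast
      \<comment> \<open>Evaluation at \<open>y\<close>, set to 0 outside \<open>G\<close> as
        \<open>dual\<close> demands; slicing by it recovers the value at
        \<open>(x, y)\<close>.\<close>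
      let ?d = "\<lambda>g. if g \<in> G then g y else 0"
      have q: "cont_seminorm G TG (\<lambda>g. norm (g y))" by (rule cont_seminorm_point[OF lcsG ptG])
      have d: "?d \<in> dual G TG"
        unfolding dual_iff[OF lcsG] using q
        by (auto simp: linear_on_def subspace_add[OF subG] subspace_scale[OF subG] fun_apply intro!: exI[of _ "\<lambda>g. norm (g y)"])
      let ?pq = "(\<lambda>f. 1 / e * norm (f x), \<lambda>g. norm (g y))"
      have I: "?pq \<in> I"
        using q cont_seminorm_scale[OF lcsF cont_seminorm_point[OF lcsF ptF[of x]], of "1 / e"] e by (simp add: I_def)
      have evu: "eventually (\<lambda>u. u \<in> {f \<in> H. norm ((f - h') (x, y)) < e} \<and> u \<in> A ?pq) \<F>"
        by (rule eventually_conj[OF 1 evA[OF I]])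
      then obtain u where u: "u \<in> H" "norm ((u - h') (x, y)) < e" "u \<in> A ?pq"
        using eventually_happens[OF evu] nb by auto
      have hu: "h - u \<in> H" by (rule subspace_diff[OF subH h u(1)])
      have "1 / e * norm (slice (h - u) ?d x) \<le> 1" using u(3) d unfolding A_def by auto
      moreover have "slice (h - u) ?d x = (h - u) (x, y)" unfolding slice_def using ii1[OF hu, of x] by simp
      ultimately have "norm ((h - u) (x, y)) \<le> e" using e by (simp add: field_simps)
      then have "norm (h' (x, y) - h (x, y)) < 2 * e"
        using u(2) norm_triangle_ineq[of "u (x, y) - h' (x, y)" "h (x, y) - u (x, y)"]
        by (simp add: fun_apply norm_minus_commute)
      then show False by (simp add: e_def)
    qed
    then have "h' = h" by (auto simp: fun_eq_iff)
    show "h \<in> TH closure_of ?S"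
      unfolding in_closure_of
    proof (intro conjI allI impI)
      show "h \<in> topspace TH" using h by (simp add: lcs_topspace[OF lcsH])
      fix U assume "h \<in> U \<and> openin TH U"
      then have "eventually (\<lambda>f. f \<in> U) \<F>" using h'(2) unfolding limitin_def \<open>h' = h\<close> by blast
      then have "eventually (\<lambda>f. f \<in> U \<and> f \<in> ?S) \<F>" using evS by (rule eventually_conj)
      from eventually_happens[OF this] show "\<exists>y. y \<in> ?S \<and> y \<in> U" using nb by blast
    qed
  qed
qed

end

theorem theorem2p1:
  fixes F :: "('x \<Rightarrow> 'k::real_normed_field) set" and TF :: "('x \<Rightarrow> 'k) topology"
    and G :: "('y \<Rightarrow> 'k) set" and TG :: "('y \<Rightarrow> 'k) topology"
    and H :: "('x \<times> 'y \<Rightarrow> 'k) set" and TH :: "('x \<times> 'y \<Rightarrow> 'k) topology"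
  assumes lcsF: "lcs F TF" and lcsG: "lcs G TG"
    and FG: "(frechet_space F TF \<and> frechet_space G TG) \<or>
             (reflexive_lcs F TF \<and> DF_space F TF \<and> reflexive_lcs G TG \<and> DF_space G TG)"
    and barH: "barrelled H TH" and hausH: "Hausdorff_space TH" and complH: "complete_lcs TH"
    and nucG: "nuclear G TG"
    and ptF: "\<forall>x. continuous_map TF euclidean (\<lambda>f. f x)"
    and ptG: "\<forall>y. continuous_map TG euclidean (\<lambda>g. g y)"
    and ptH: "\<forall>z. continuous_map TH euclidean (\<lambda>h. h z)"
    and i1: "\<forall>f\<in>F. \<forall>g\<in>G. tensor_fun f g \<in> H"
    and i2: "\<forall>f\<in>F. continuous_map TG TH (\<lambda>g. tensor_fun f g)"
    and i3: "\<forall>g\<in>G. continuous_map TF TH (\<lambda>f. tensor_fun f g)"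
    and ii1: "\<forall>h\<in>H. \<forall>x. (\<lambda>y. h (x, y)) \<in> G"
    and ii2: "\<forall>h\<in>H. \<forall>v\<in>dual G TG. (\<lambda>x. v (\<lambda>y. h (x, y))) \<in> F"
  shows "continuous_map (prod_topology TF TG) TH (\<lambda>(f, g). tensor_fun f g) \<and>
         completed_proj_tensor_iso F TF G TG H TH"
proof (intro conjI)
  note A = lcsF lcsG FG barH complH nucG ptF[rule_format] ptG[rule_format] ptH[rule_format] i1[rule_format]
    i2[rule_format] i3[rule_format] ii1[rule_format] ii2[rule_format, folded slice_def]
  show "continuous_map (prod_topology TF TG) TH (\<lambda>(f, g). tensor_fun f g)"
    by (rule continuous_map_tensor_fun[OF A])
  show "completed_proj_tensor_iso F TF G TG H TH"
    unfolding completed_proj_tensor_iso_def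
    using tensor_span_subset[OF A] subtopology_tensor_span[OF A] closure_of_tensor_span[OF A] by blast
qed

end
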